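(* For each $\theta\in[0,1]$, the assignment $\odot^\theta$ defined below is an operator space tensor norm. That is, for all normed operator spaces $E,F$ the norms $(\odot^\theta)_k$, $k\in\mathbb N$, define an operator space structure on $E\otimes F$, the identity maps $E\otimes_{\mathrm{proj}}F\to E\otimes_{\odot^\theta}F\to E\otimes_{\min}F$ are complete contractions, and for all completely bounded $S:E_1\to E_2$, $T:F_1\to F_2$ one has $\|S\otimes T: E_1\otimes_{\odot^\theta}F_1\to E_2\otimes_{\odot^\theta}F_2\|_{cb}\le\|S\|_{cb}\|T\|_{cb}$.
   Context: Normed operator spaces are (not necessarily complete) vector spaces $E$ with norms on each $M_n(E)$ satisfying Ruan's axioms; $\|\cdot\|_{cb}$ is the completely bounded norm, and $E'$ carries the dual structure $M_n(E')=CB(E,M_n)$. For $\theta\in[0,1]$ and $j\in\mathbb N$ let $\odot^\theta_j:M_j\times M_j\to M_j$, $\odot^\theta_j(A,B)=(1-\theta)AB+\theta BA$, and let $\otimes_{\odot^\theta_j}:M_j(E)\times M_j(F)\to M_j(E\otimes F)$ be the bilinear map determined by $(a_1\otimes x,a_2\otimes y)\mapsto \odot^\theta_j(a_1,a_2)\otimes x\otimes y$. For $u\in M_k(E\otimes F)$ set $(\odot^\theta)_k(u)=\inf\{\|a\|\|v_1\|_{M_j(E)}\|v_2\|_{M_j(F)}\|b\|\}$, the infimum over all $j\in\mathbb N$ and decompositions $u=a\,\otimes_{\odot^\theta_j}(v_1,v_2)\,b$ with $a\in M_{k,j}$, $b\in M_{j,k}$, $v_1\in M_j(E)$, $v_2\in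 M_j(F)$. The minimal norm is $\min_n(u)=\sup\{\|(f\otimes g)_n(u)\|: f\in M_p(E'),g\in M_q(F'),\|f\|,\|g\|\le1\}$; the projective norm is $\mathrm{proj}_n(u)=\inf\{\|a\|\|x\|\|y\|\|b\|: u=a(x\otimes y)b,\ x\in M_p(E),y\in M_q(F),a\in M_{n,pq},b\in M_{pq,n}\}$. *)

theory Defs
  imports Complex_Main "HOL-Library.Function_Algebras"
begin

text \<open>Conventions. A (normed) operator space is given by a complex vector space
  (a carrier subset V of an additive group type, with a complex scalar multiplication)
  together with norms on the matrix levels M_n(V), n >= 1. Matrices are functions
  nat => nat => 'a, whose entries outside the index range are 0.\<close>

type_synonym 'a mat = "nat \<Rightarrow> nat \<Rightarrow> 'a"

record 'a ospace =
  osc :: "complex \<Rightarrow> 'a \<Rightarrow> 'a"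
  ocar :: "'a set"
  onorm :: "nat \<Rightarrow> 'a mat \<Rightarrow> real"

definition matset :: "nat \<Rightarrow> nat \<Rightarrow> 'a::zero set \<Rightarrow> 'a mat set" where
  "matset m n V = {v. \<forall>i j. (i < m \<and> j < n \<longrightarrow> v i j \<in> V) \<and> (\<not> (i < m \<and> j < n) \<longrightarrow> v i j = 0)}"

definition vnorm2 :: "nat \<Rightarrow> (nat \<Rightarrow> complex) \<Rightarrow> real" where
  "vnorm2 n x = sqrt (\<Sum>i<n. (cmod (x i))\<^sup>2)"

definition cmnorm :: "nat \<Rightarrow> nat \<Rightarrow> complex mat \<Rightarrow> real" where
  "cmnorm m n A = Sup {vnorm2 m (\<lambda>i. \<Sum>j<n. A i j * x j) | x. vnorm2 n x \<le> 1}"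

definition mmul :: "(complex \<Rightarrow> 'a \<Rightarrow> 'a) \<Rightarrow> nat \<Rightarrow> nat \<Rightarrow> complex mat \<Rightarrow> 'a::ab_group_add mat
    \<Rightarrow> complex mat \<Rightarrow> 'a mat" where
  "mmul sc k n a v b = (\<lambda>i l. if i < k \<and> l < k
      then (\<Sum>p<n. \<Sum>q<n. sc (a i p * b q l) (v p q)) else 0)"

definition dsum :: "nat \<Rightarrow> nat \<Rightarrow> 'a::zero mat \<Rightarrow> 'a mat \<Rightarrow> 'a mat" where
  "dsum n m v w = (\<lambda>i j. if i < n \<and> j < n then v i j
      else if n \<le> i \<and> i < n + m \<and> n \<le> j \<and> j < n + m then w (i - n) (j - n) else 0)"

definition opspace :: "'a::ab_group_add ospace \<Rightarrow> bool" where
  "opspace E \<longleftrightarrow>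
    (let sc = osc E; V = ocar E; N = onorm E in
      0 \<in> V \<and> (\<forall>x\<in>V. \<forall>y\<in>V. x + y \<in> V) \<and> (\<forall>c. \<forall>x\<in>V. sc c x \<in> V) \<and>
      (\<forall>c. \<forall>x\<in>V. \<forall>y\<in>V. sc c (x + y) = sc c x + sc c y) \<and>
      (\<forall>c d. \<forall>x\<in>V. sc (c + d) x = sc c x + sc d x) \<and>
      (\<forall>c d. \<forall>x\<in>V. sc (c * d) x = sc c (sc d x)) \<and>
      (\<forall>x\<in>V. sc 1 x = x) \<and>
      (\<forall>n\<ge>1. \<forall>v\<in>matset n n V.
          0 \<le> N n v \<and> (N n v = 0 \<longleftrightarrow> v = 0) \<and>
          (\<forall>c. N n (\<lambda>i j. sc c (v i j)) = cmod c * N n v) \<and>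
          (\<forall>w\<in>matset n n V. N n (v + w) \<le> N n v + N n w)) \<and>
      (\<forall>n\<ge>1. \<forall>m\<ge>1. \<forall>v\<in>matset n n V. \<forall>w\<in>matset m m V.
          N (n + m) (dsum n m v w) = max (N n v) (N m w)) \<and>
      (\<forall>n\<ge>1. \<forall>k\<ge>1. \<forall>v\<in>matset n n V. \<forall>a b.
          N k (mmul sc k n a v b) \<le> cmnorm k n a * N n v * cmnorm n k b))"

definition oslinear :: "'a::ab_group_add ospace \<Rightarrow> 'b::ab_group_add ospace \<Rightarrow> ('a \<Rightarrow> 'b) \<Rightarrow> bool" where
  "oslinear E F T \<longleftrightarrow> (\<forall>x\<in>ocar E. T x \<in> ocar F) \<and>
     (\<forall>x\<in>ocar E. \<forall>y\<in>ocar E. T (x + y) = T x + T y) \<and>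
     (\<forall>c. \<forall>x\<in>ocar E. T (osc E c x) = osc F c (T x))"

definition amp :: "nat \<Rightarrow> ('a \<Rightarrow> 'b::zero) \<Rightarrow> 'a mat \<Rightarrow> 'b mat" where
  "amp n T v = (\<lambda>i j. if i < n \<and> j < n then T (v i j) else 0)"

definition cb_set :: "'a::ab_group_add ospace \<Rightarrow> 'b::ab_group_add ospace \<Rightarrow> ('a \<Rightarrow> 'b) \<Rightarrow> real set" where
  "cb_set E F T = {onorm F n (amp n T v) | n v. 1 \<le> n \<and> v \<in> matset n n (ocar E) \<and> onorm E n v \<le> 1}"

definition cb_norm :: "'a::ab_group_add ospace \<Rightarrow> 'b::ab_group_add ospace \<Rightarrow> ('a \<Rightarrow> 'b) \<Rightarrow> real" where
  "cb_norm E F T = Sup (cb_set E F T)"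

definition completely_bounded :: "'a::ab_group_add ospace \<Rightarrow> 'b::ab_group_add ospace \<Rightarrow> ('a \<Rightarrow> 'b) \<Rightarrow> bool" where
  "completely_bounded E F T \<longleftrightarrow> oslinear E F T \<and> bdd_above (cb_set E F T)"

definition blk :: "nat \<Rightarrow> 'a mat mat \<Rightarrow> 'a mat" where
  "blk p w = (\<lambda>I J. w (I div p) (J div p) (I mod p) (J mod p))"

definition Mspace :: "nat \<Rightarrow> complex mat ospace" where
  "Mspace p = \<lparr>osc = (\<lambda>c A i j. c * A i j), ocar = matset p p UNIV,
               onorm = (\<lambda>n w. cmnorm (n * p) (n * p) (blk p w))\<rparr>"

text \<open>Model of the algebraic tensor product E (x) F: x (x) y is represented by the bilinear
  form (phi, psi) |-> phi x * psi y on (linear functionals on E) x (linear functionals on F)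
  (the value is 0 if phi or psi is not linear). E (x) F is the span of these.\<close>

type_synonym ('a, 'b) tens = "('a \<Rightarrow> complex) \<Rightarrow> ('b \<Rightarrow> complex) \<Rightarrow> complex"

definition lfun :: "'a::ab_group_add ospace \<Rightarrow> ('a \<Rightarrow> complex) \<Rightarrow> bool" where
  "lfun E \<phi> \<longleftrightarrow> (\<forall>x\<in>ocar E. \<forall>y\<in>ocar E. \<phi> (x + y) = \<phi> x + \<phi> y) \<and>
                  (\<forall>c. \<forall>x\<in>ocar E. \<phi> (osc E c x) = c * \<phi> x)"

definition ten :: "'a::ab_group_add ospace \<Rightarrow> 'b::ab_group_add ospace \<Rightarrow> 'a \<Rightarrow> 'b \<Rightarrow> ('a, 'b) tens" where
  "ten E F x y = (\<lambda>\<phi> \<psi>. if lfun E \<phi> \<and> lfun F \<psi> then \<phi> x * \<psi> y else 0)"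

definition tspace :: "'a::ab_group_add ospace \<Rightarrow> 'b::ab_group_add ospace \<Rightarrow> ('a, 'b) tens set" where
  "tspace E F = {\<Sum>i<m. ten E F (x i) (y i) | (m::nat) x y. \<forall>i<m. x i \<in> ocar E \<and> y i \<in> ocar F}"

definition tsc :: "complex \<Rightarrow> ('a, 'b) tens \<Rightarrow> ('a, 'b) tens" where
  "tsc c t = (\<lambda>\<phi> \<psi>. c * t \<phi> \<psi>)"

text \<open>The bilinear map (x)_{odot^theta_j} : M_j(E) x M_j(F) -> M_j(E (x) F), determined by
  (a1 (x) x, a2 (x) y) |-> ((1-theta) a1 a2 + theta a2 a1) (x) x (x) y; written out
  on matrix units this gives the entry formula below.\<close>
definition odot_map :: "real \<Rightarrow> 'a::ab_group_add ospace \<Rightarrow> 'b::ab_group_add ospace \<Rightarrow> nat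
    \<Rightarrow> 'a mat \<Rightarrow> 'b mat \<Rightarrow> ('a, 'b) tens mat" where
  "odot_map \<theta> E F j v1 v2 = (\<lambda>i l. if i < j \<and> l < j then
      tsc (complex_of_real (1 - \<theta>)) (\<Sum>m<j. ten E F (v1 i m) (v2 m l)) +
      tsc (complex_of_real \<theta>) (\<Sum>m<j. ten E F (v1 m l) (v2 i m)) else 0)"

definition odot_norm :: "real \<Rightarrow> 'a::ab_group_add ospace \<Rightarrow> 'b::ab_group_add ospace \<Rightarrow> nat
    \<Rightarrow> ('a, 'b) tens mat \<Rightarrow> real" where
  "odot_norm \<theta> E F k u = Inf {cmnorm k j a * onorm E j v1 * onorm F j v2 * cmnorm j k b
      | j a v1 v2 b. 1 \<le> j \<and> v1 \<in> matset j j (ocar E) \<and> v2 \<in> matset j j (ocar F) \<and>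
          u = mmul tsc k j a (odot_map \<theta> E F j v1 v2) b}"

definition odot_ten :: "real \<Rightarrow> 'a::ab_group_add ospace \<Rightarrow> 'b::ab_group_add ospace \<Rightarrow> ('a, 'b) tens ospace" where
  "odot_ten \<theta> E F = \<lparr>osc = tsc, ocar = tspace E F, onorm = odot_norm \<theta> E F\<rparr>"

definition kron :: "'a::ab_group_add ospace \<Rightarrow> 'b::ab_group_add ospace \<Rightarrow> nat \<Rightarrow> nat
    \<Rightarrow> 'a mat \<Rightarrow> 'b mat \<Rightarrow> ('a, 'b) tens mat" where
  "kron E F p q x y = (\<lambda>I J. if I < p * q \<and> J < p * q then
      ten E F (x (I div q) (J div q)) (y (I mod q) (J mod q)) else 0)"

definition proj_norm :: "'a::ab_group_add ospace \<Rightarrow> 'b::ab_group_add ospace \<Rightarrow> nat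
    \<Rightarrow> ('a, 'b) tens mat \<Rightarrow> real" where
  "proj_norm E F n u = Inf {cmnorm n (p * q) a * onorm E p x * onorm F q y * cmnorm (p * q) n b
      | p q a x y b. 1 \<le> p \<and> 1 \<le> q \<and> x \<in> matset p p (ocar E) \<and> y \<in> matset q q (ocar F) \<and>
          u = mmul tsc n (p * q) a (kron E F p q x y) b}"

definition proj_ten :: "'a::ab_group_add ospace \<Rightarrow> 'b::ab_group_add ospace \<Rightarrow> ('a, 'b) tens ospace" where
  "proj_ten E F = \<lparr>osc = tsc, ocar = tspace E F, onorm = proj_norm E F\<rparr>"

text \<open>f (x) g : E (x) F -> M_p (x) M_q = M_{pq} for f : E -> M_p, g : F -> M_q;
  entry ((a,c),(b,d)) is t applied to the linear functionals x |-> f(x)_{ab}, y |-> g(y)_{cd}.\<close>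
definition tfg :: "nat \<Rightarrow> nat \<Rightarrow> ('a \<Rightarrow> complex mat) \<Rightarrow> ('b \<Rightarrow> complex mat)
    \<Rightarrow> ('a, 'b) tens \<Rightarrow> complex mat" where
  "tfg p q f g t = (\<lambda>I J. if I < p * q \<and> J < p * q then
      t (\<lambda>x. f x (I div q) (J div q)) (\<lambda>y. g y (I mod q) (J mod q)) else 0)"

text \<open>min_n(u) = sup over f in Ball(M_p(E')) = {f in CB(E,M_p), ||f||_cb <= 1}, likewise g,
  of ||(f (x) g)_n(u)|| in M_n(M_{pq}).\<close>
definition min_norm :: "'a::ab_group_add ospace \<Rightarrow> 'b::ab_group_add ospace \<Rightarrow> nat
    \<Rightarrow> ('a, 'b) tens mat \<Rightarrow> real" where
  "min_norm E F n u = Sup {onorm (Mspace (p * q)) n (amp n (tfg p q f g) u)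
      | p q f g. 1 \<le> p \<and> 1 \<le> q \<and>
          completely_bounded E (Mspace p) f \<and> cb_norm E (Mspace p) f \<le> 1 \<and>
          completely_bounded F (Mspace q) g \<and> cb_norm F (Mspace q) g \<le> 1}"

definition min_ten :: "'a::ab_group_add ospace \<Rightarrow> 'b::ab_group_add ospace \<Rightarrow> ('a, 'b) tens ospace" where
  "min_ten E F = \<lparr>osc = tsc, ocar = tspace E F, onorm = min_norm E F\<rparr>"

definition tensmap :: "'c::ab_group_add ospace \<Rightarrow> 'd::ab_group_add ospace \<Rightarrow> ('a \<Rightarrow> 'c) \<Rightarrow> ('b \<Rightarrow> 'd)
    \<Rightarrow> ('a, 'b) tens \<Rightarrow> ('c, 'd) tens" where
  "tensmap E2 F2 S T t = (\<lambda>\<phi> \<psi>. if lfun E2 \<phi> \<and> lfun F2 \<psi> then t (\<phi> \<circ> S) (\<psi> \<circ> T) else 0)"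

end

theory Submission
  imports Defs "HOL-Analysis.L2_Norm"
begin

text \<open>A decomposition of \<open>u\<close> can be rescaled so that \<open>\<parallel>v\<^sub>1\<parallel>, \<parallel>v\<^sub>2\<parallel> \<le> 1\<close> and \<open>\<parallel>a\<parallel> = \<parallel>b\<parallel>\<close>;
  direct sums and compressions of such decompositions give Ruan's axioms. The identity
  \<open>x \<otimes> y = (x \<otimes> 1) \<odot> (1 \<otimes> y)\<close>, in which the two factors commute, gives the comparison with the
  projective norm for every \<open>\<theta>\<close>. Conversely \<open>f \<otimes> g\<close> maps \<open>v\<^sub>1 \<odot> v\<^sub>2\<close> to a convex combination of
  the products \<open>XY\<close> and \<open>YX\<close> of \<open>X = f(v\<^sub>1) \<otimes> 1\<close> and \<open>Y = g(v\<^sub>2) \<otimes> 1\<close>, which bounds the minimal norm.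
  The same estimate for bounded functionals, which separate points by Hahn--Banach,
  shows that the norms are definite.\<close>

section \<open>Operator norms of complex matrices\<close>

text \<open>Because the norm is an infimum, one decomposition suffices for an upper bound, whereas
  definiteness and the comparison with the minimal norm need a lower bound that holds for all
  decompositions at once. Both lower bounds are \<open>odot_norm_functional_bound\<close>:
  matrix-valued maps for the minimal norm, scalar functionals for definiteness. The range of
  \<theta> enters there, through |1 - \<theta>| + |\<theta>| = 1. Separation is an issue because a
  tensor is modelled as a form on all algebraic functionals, while the norms control only bounded
  ones. The rescaling is dictated by direct sums: norms of direct sums are maxima, and a product of
  four maxima need not be the maximum of the two products unless the factors have common bounds.
  Tensor legs are flattened to natural numbers and decoded by div and mod; a matrix X \<otimes> 1,
  on whichever legs, is then described by two index maps, and a single estimate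
  (\<open>cmnorm_ampl_le\<close>, with \<open>opspace_ampl_le\<close> as its abstract counterpart)
  bounds its norm.\<close>

lemma vnorm2_L2_set: "vnorm2 n x = L2_set (\<lambda>i. cmod (x i)) {..<n}"
  by (simp add: vnorm2_def L2_set_def)

lemma vnorm2_nonneg [simp]: "0 \<le> vnorm2 n x"
  by (simp add: vnorm2_def sum_nonneg)

lemma vnorm2_power2: "(vnorm2 n x)\<^sup>2 = (\<Sum>i<n. (cmod (x i))\<^sup>2)"
  by (simp add: vnorm2_def sum_nonneg)

lemma vnorm2_cong: "(\<And>i. i < n \<Longrightarrow> x i = y i) \<Longrightarrow> vnorm2 n x = vnorm2 n y"
  by (simp add: vnorm2_def)

lemma vnorm2_0 [simp]: "vnorm2 n (\<lambda>i. 0) = 0"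
  by (simp add: vnorm2_def)

lemma vnorm2_scale: "vnorm2 n (\<lambda>i. c * x i) = cmod c * vnorm2 n x"
  by (simp add: vnorm2_def norm_mult power_mult_distrib sum_distrib_left [symmetric] real_sqrt_mult)

lemma vnorm2_add: "vnorm2 n (\<lambda>i. x i + y i) \<le> vnorm2 n x + vnorm2 n y"
proof -
  have "vnorm2 n (\<lambda>i. x i + y i) \<le> L2_set (\<lambda>i. cmod (x i) + cmod (y i)) {..<n}"
    unfolding vnorm2_L2_set by (intro L2_set_mono) (auto simp: norm_triangle_ineq)
  also have "\<dots> \<le> vnorm2 n x + vnorm2 n y"
    unfolding vnorm2_L2_set by (rule L2_set_triangle_ineq)
  finally show ?thesis .
qed

lemma cmod_le_vnorm2: "i < n \<Longrightarrow> cmod (x i) \<le> vnorm2 n x"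
  unfolding vnorm2_L2_set by (rule member_le_L2_set) auto

lemma vnorm2_le_sum: "vnorm2 n x \<le> (\<Sum>i<n. cmod (x i))"
  unfolding vnorm2_L2_set by (rule L2_set_le_sum) auto

lemma cmod_sum_mult_le: "cmod (\<Sum>i<n. x i * y i) \<le> vnorm2 n x * vnorm2 n y"
proof -
  have "cmod (\<Sum>i<n. x i * y i) \<le> (\<Sum>i<n. \<bar>cmod (x i)\<bar> * \<bar>cmod (y i)\<bar>)"
    by (rule order_trans [OF norm_sum]) (simp add: norm_mult)
  also have "\<dots> \<le> vnorm2 n x * vnorm2 n y"
    unfolding vnorm2_L2_set by (rule L2_set_mult_ineq)
  finally show ?thesis .
qed

lemma vnorm2_eq_0_iff: "vnorm2 n x = 0 \<longleftrightarrow> (\<forall>i<n. x i = 0)"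
  by (auto simp: vnorm2_L2_set L2_set_eq_0_iff)

definition cvmul :: "nat \<Rightarrow> complex mat \<Rightarrow> (nat \<Rightarrow> complex) \<Rightarrow> nat \<Rightarrow> complex" where
  "cvmul n A x = (\<lambda>i. \<Sum>j<n. A i j * x j)"

lemma cmnorm_cvmul: "cmnorm m n A = Sup {vnorm2 m (cvmul n A x) | x. vnorm2 n x \<le> 1}"
  by (simp add: cmnorm_def cvmul_def)

text \<open>The constant is crude; it serves to make the supremum in \<open>cmnorm\<close> finite,
  so that \<open>cSup_upper\<close> applies in \<open>cmnorm_bound\<close>.\<close>

lemma vnorm2_cvmul_crude:
  "vnorm2 m (cvmul n A x) \<le> (\<Sum>i<m. vnorm2 n (A i)) * vnorm2 n x"
proof -
  have "vnorm2 m (cvmul n A x) \<le> (\<Sum>i<m. cmod (cvmul n A x i))"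
    by (rule vnorm2_le_sum)
  also have "\<dots> \<le> (\<Sum>i<m. vnorm2 n (A i) * vnorm2 n x)"
    unfolding cvmul_def by (intro sum_mono cmod_sum_mult_le)
  finally show ?thesis by (simp add: sum_distrib_right)
qed

lemma cmnorm_bdd: "bdd_above {vnorm2 m (cvmul n A x) | x. vnorm2 n x \<le> 1}"
proof (rule bdd_aboveI)
  fix t assume "t \<in> {vnorm2 m (cvmul n A x) | x. vnorm2 n x \<le> 1}"
  then obtain x where x: "vnorm2 n x \<le> 1" and t: "t = vnorm2 m (cvmul n A x)" by blast
  have "t \<le> (\<Sum>i<m. vnorm2 n (A i)) * vnorm2 n x"
    unfolding t by (rule vnorm2_cvmul_crude)
  also have "\<dots> \<le> (\<Sum>i<m. vnorm2 n (A i)) * 1"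
    by (intro mult_left_mono x sum_nonneg) auto
  finally show "t \<le> (\<Sum>i<m. vnorm2 n (A i)) * 1" .
qed

lemma cmnorm_nonneg [simp]: "0 \<le> cmnorm m n A"
proof -
  have "vnorm2 m (cvmul n A (\<lambda>_. 0)) \<le> cmnorm m n A"
    unfolding cmnorm_cvmul by (rule cSup_upper [OF _ cmnorm_bdd]) force
  then show ?thesis by (meson order_trans vnorm2_nonneg)
qed

lemma cvmul_scale: "cvmul n A (\<lambda>i. c * x i) = (\<lambda>i. c * cvmul n A x i)"
  by (simp add: cvmul_def sum_distrib_left algebra_simps)

lemma cmnorm_bound: "vnorm2 m (cvmul n A x) \<le> cmnorm m n A * vnorm2 n x"
proof (cases "vnorm2 n x = 0")
  case True
  then have "cvmul n A x = (\<lambda>i. 0)"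
    by (auto simp: cvmul_def vnorm2_eq_0_iff)
  then show ?thesis by (simp add: True)
next
  case False
  define c where "c = vnorm2 n x"
  have c: "c > 0" using False vnorm2_nonneg [of n x] unfolding c_def by linarith
  define y where "y = (\<lambda>i. complex_of_real (1 / c) * x i)"
  have "vnorm2 n y = 1"
    unfolding y_def vnorm2_scale using c by (simp add: c_def norm_divide)
  then have "vnorm2 m (cvmul n A y) \<le> cmnorm m n A"
    unfolding cmnorm_cvmul by (intro cSup_upper [OF _ cmnorm_bdd]) auto
  moreover have "vnorm2 m (cvmul n A y) = 1 / c * vnorm2 m (cvmul n A x)"
    unfolding y_def cvmul_scale vnorm2_scale using c by (simp add: norm_divide)
  ultimately show ?thesis
    using c by (simp add: c_def [symmetric] field_simps)
qed

lemma cmnorm_le: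
  assumes "0 \<le> C" "\<And>x. vnorm2 m (cvmul n A x) \<le> C * vnorm2 n x"
  shows "cmnorm m n A \<le> C"
  unfolding cmnorm_cvmul
proof (rule cSup_least)
  have "vnorm2 n (\<lambda>_. 0) \<le> 1" by simp
  then show "{vnorm2 m (cvmul n A x) | x. vnorm2 n x \<le> 1} \<noteq> {}" by blast
  fix t assume "t \<in> {vnorm2 m (cvmul n A x) | x. vnorm2 n x \<le> 1}"
  then obtain x where x: "vnorm2 n x \<le> 1" and t: "t = vnorm2 m (cvmul n A x)" by blast
  have "t \<le> C * vnorm2 n x" unfolding t by (rule assms)
  also have "\<dots> \<le> C * 1" using x assms(1) by (rule mult_left_mono)
  finally show "t \<le> C" by simp
qed

lemma cmnorm_cong:
  assumes "\<And>i j. i < m \<Longrightarrow> j < n \<Longrightarrow> A i j = B i j"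
  shows "cmnorm m n A = cmnorm m n B"
proof -
  have "vnorm2 m (cvmul n A x) = vnorm2 m (cvmul n B x)" for x
    by (rule vnorm2_cong) (simp add: cvmul_def assms)
  then show ?thesis by (simp add: cmnorm_cvmul)
qed

lemma cmnorm_compose:
  "cmnorm k n (\<lambda>i l. \<Sum>p<m. A i p * B p l) \<le> cmnorm k m A * cmnorm m n B"
proof (rule cmnorm_le)
  fix x
  have "cvmul n (\<lambda>i l. \<Sum>p<m. A i p * B p l) x = cvmul m A (cvmul n B x)"
  proof
    fix i
    show "cvmul n (\<lambda>i l. \<Sum>p<m. A i p * B p l) x i = cvmul m A (cvmul n B x) i"
      unfolding cvmul_def sum_distrib_left sum_distrib_right
      by (subst sum.swap) (simp add: mult.assoc)
  qed
  then have "vnorm2 k (cvmul n (\<lambda>i l. \<Sum>p<m. A i p * B p l) x)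
      \<le> cmnorm k m A * vnorm2 m (cvmul n B x)"
    by (simp add: cmnorm_bound)
  also have "\<dots> \<le> cmnorm k m A * (cmnorm m n B * vnorm2 n x)"
    by (intro mult_left_mono cmnorm_bound) simp
  finally show "vnorm2 k (cvmul n (\<lambda>i l. \<Sum>p<m. A i p * B p l) x)
      \<le> cmnorm k m A * cmnorm m n B * vnorm2 n x" by (simp add: mult.assoc)
qed simp

lemma cmnorm_scale_le: "cmnorm m n (\<lambda>i j. c * A i j) \<le> cmod c * cmnorm m n A"
proof (rule cmnorm_le)
  fix x
  have "cvmul n (\<lambda>i j. c * A i j) x = (\<lambda>i. c * cvmul n A x i)"
    by (simp add: cvmul_def sum_distrib_left mult.assoc)
  then show "vnorm2 m (cvmul n (\<lambda>i j. c * A i j) x) \<le> cmod c * cmnorm m n A * vnorm2 n x"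
    by (simp add: vnorm2_scale mult.assoc mult_left_mono cmnorm_bound)
qed simp

lemma cmnorm_add_le: "cmnorm m n (\<lambda>i j. A i j + B i j) \<le> cmnorm m n A + cmnorm m n B"
proof (rule cmnorm_le)
  fix x
  have "cvmul n (\<lambda>i j. A i j + B i j) x = (\<lambda>i. cvmul n A x i + cvmul n B x i)"
    by (simp add: cvmul_def sum.distrib algebra_simps)
  then have "vnorm2 m (cvmul n (\<lambda>i j. A i j + B i j) x)
      \<le> vnorm2 m (cvmul n A x) + vnorm2 m (cvmul n B x)"
    by (simp add: vnorm2_add)
  also have "\<dots> \<le> cmnorm m n A * vnorm2 n x + cmnorm m n B * vnorm2 n x"
    by (intro add_mono cmnorm_bound)
  finally show "vnorm2 m (cvmul n (\<lambda>i j. A i j + B i j) x)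
      \<le> (cmnorm m n A + cmnorm m n B) * vnorm2 n x" by (simp add: algebra_simps)
qed simp

lemma cmod_entry_le_cmnorm:
  assumes "i < m" "j < n"
  shows "cmod (A i j) \<le> cmnorm m n A"
proof -
  let ?e = "\<lambda>l. if l = j then 1 else 0 :: complex"
  have e: "vnorm2 n ?e = 1"
    using assms(2) by (simp add: vnorm2_def if_distrib [of cmod] if_distrib [of "\<lambda>z. z ^ 2"] cong: if_cong)
  have "A i j = cvmul n A ?e i"
    using assms(2) by (simp add: cvmul_def if_distrib [of "(*) _"] cong: if_cong)
  then have "cmod (A i j) \<le> vnorm2 m (cvmul n A ?e)"
    using cmod_le_vnorm2 [OF assms(1), of "cvmul n A ?e"] by simp
  also have "\<dots> \<le> cmnorm m n A"
    using cmnorm_bound [of m n A ?e] e by simp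
  finally show ?thesis .
qed

lemma cmnorm_0 [simp]: "cmnorm m n (\<lambda>i j. 0) = 0"
  using cmnorm_le [of 0 m n "\<lambda>i j. 0"] cmnorm_nonneg [of m n "\<lambda>i j. 0"]
  by (simp add: cvmul_def)

lemma cmnorm_scale: "cmnorm m n (\<lambda>i j. c * A i j) = cmod c * cmnorm m n A"
proof (cases "c = 0")
  case False
  have "cmnorm m n (\<lambda>i j. (1 / c) * (c * A i j)) \<le> cmod (1 / c) * cmnorm m n (\<lambda>i j. c * A i j)"
    by (rule cmnorm_scale_le)
  then have "cmod c * cmnorm m n A \<le> cmnorm m n (\<lambda>i j. c * A i j)"
    using False by (simp add: norm_divide field_simps)
  then show ?thesis using cmnorm_scale_le [of m n c A] by simp
qed simp

text \<open>Cauchy-Schwarz. With the column version below, an expression z* v x becomes a two-sided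
  multiplication of v by a row and a column of controlled norm.\<close>

lemma cmnorm_row_le: "cmnorm 1 n (\<lambda>_. x) \<le> vnorm2 n x"
proof (rule cmnorm_le)
  fix y
  have "vnorm2 1 (cvmul n (\<lambda>_. x) y) = cmod (\<Sum>i<n. x i * y i)"
    by (simp add: vnorm2_def cvmul_def)
  then show "vnorm2 1 (cvmul n (\<lambda>_. x) y) \<le> vnorm2 n x * vnorm2 n y"
    by (simp add: cmod_sum_mult_le)
qed simp

lemma cmnorm_col_le: "cmnorm n 1 (\<lambda>i _. x i) \<le> vnorm2 n x"
proof (rule cmnorm_le)
  fix y :: "nat \<Rightarrow> complex"
  have "cvmul 1 (\<lambda>i _. x i) y = (\<lambda>i. y 0 * x i)"
    by (simp add: cvmul_def mult.commute)
  then show "vnorm2 n (cvmul 1 (\<lambda>i _. x i) y) \<le> vnorm2 n x * vnorm2 1 y"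
    by (simp add: vnorm2_scale) (simp add: vnorm2_def)
qed simp

text \<open>\<open>A\<close> is a corner of \<open>1 \<otimes> X\<close> up to reindexing: \<open>\<kappa>\<close> names the copy of \<open>X\<close> and \<open>\<iota>\<close> the row
  (or column) inside it.\<close>
lemma cmnorm_ampl_le:
  fixes \<kappa> \<kappa>' \<iota> \<iota>' :: "nat \<Rightarrow> nat"
  assumes inj1: "inj_on (\<lambda>I. (\<kappa> I, \<iota> I)) {..<N1}" and inj2: "inj_on (\<lambda>I. (\<kappa>' I, \<iota>' I)) {..<N2}"
    and r1: "\<And>I. I < N1 \<Longrightarrow> \<iota> I < M1" and r2: "\<And>I. I < N2 \<Longrightarrow> \<iota>' I < M2"
    and A: "\<And>I J. I < N1 \<Longrightarrow> J < N2 \<Longrightarrow> A I J = (if \<kappa> I = \<kappa>' J then X (\<iota> I) (\<iota>' J) else 0)"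
  shows "cmnorm N1 N2 A \<le> cmnorm M1 M2 X"
proof (rule cmnorm_le)
  fix x :: "nat \<Rightarrow> complex"
  define C where "C = \<kappa> ` {..<N1} \<union> \<kappa>' ` {..<N2}"
  have C [simp]: "finite C" by (simp add: C_def)
  \<comment> \<open>\<open>y c\<close> is the component of \<open>x\<close> in the copy labelled
    \<open>c\<close>. By \<open>inj2\<close> each of these sums has at most one term, so no cross
    terms appear when its square is taken in \<open>y2\<close>.\<close>
  define y where "y = (\<lambda>c m. \<Sum>J | J < N2 \<and> \<kappa>' J = c \<and> \<iota>' J = m. x J)"
  have fin [simp]: "finite {J. J < N \<and> P J}" for P and N :: nat
    by (rule finite_subset [of _ "{..<N}"]) auto
  have Ax: "cvmul N2 A x I = cvmul M2 X (y (\<kappa> I)) (\<iota> I)" if I: "I < N1" for I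
  proof -
    have "cvmul M2 X (y (\<kappa> I)) (\<iota> I)
        = (\<Sum>m<M2. \<Sum>J | J < N2 \<and> \<kappa>' J = \<kappa> I \<and> \<iota>' J = m. X (\<iota> I) (\<iota>' J) * x J)"
      by (simp add: cvmul_def y_def sum_distrib_left)
    also have "\<dots> = (\<Sum>m<M2. \<Sum>J | J \<in> {J. J < N2 \<and> \<kappa>' J = \<kappa> I} \<and> \<iota>' J = m. X (\<iota> I) (\<iota>' J) * x J)"
      by (intro sum.cong) auto
    also have "\<dots> = (\<Sum>J | J < N2 \<and> \<kappa>' J = \<kappa> I. X (\<iota> I) (\<iota>' J) * x J)"
      by (rule sum.group) (auto simp: r2)
    also have "\<dots> = (\<Sum>J<N2. if \<kappa>' J = \<kappa> I then X (\<iota> I) (\<iota>' J) * x J else 0)"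
      by (subst sum.inter_filter [symmetric]) (auto intro: sum.cong)
    also have "\<dots> = cvmul N2 A x I"
      unfolding cvmul_def by (intro sum.cong) (auto simp: A I)
    finally show ?thesis by simp
  qed
  have y2: "(cmod (y c m))\<^sup>2 = (\<Sum>J | J < N2 \<and> \<kappa>' J = c \<and> \<iota>' J = m. (cmod (x J))\<^sup>2)" for c m
  proof (cases "{J. J < N2 \<and> \<kappa>' J = c \<and> \<iota>' J = m} = {}")
    case True
    then show ?thesis by (simp only: y_def) simp
  next
    case False
    then obtain J where J: "J < N2" "\<kappa>' J = c" "\<iota>' J = m" by blast
    then have "{J. J < N2 \<and> \<kappa>' J = c \<and> \<iota>' J = m} = {J}"
      using inj2 by (auto simp: inj_on_def)
    then show ?thesis by (simp only: y_def) simp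
  qed
  have "(\<Sum>I<N1. (cmod (cvmul N2 A x I))\<^sup>2)
      = (\<Sum>c\<in>C. \<Sum>I | I \<in> {..<N1} \<and> \<kappa> I = c. (cmod (cvmul N2 A x I))\<^sup>2)"
    by (rule sum.group [symmetric]) (auto simp: C_def)
  \<comment> \<open>Within one label the rows of \<open>A\<close> are distinct rows of
    \<open>X\<close> applied to \<open>y c\<close>, by \<open>inj1\<close>; rows of \<open>X\<close>
    that do not occur only add nonnegative terms.\<close>
  also have "\<dots> \<le> (\<Sum>c\<in>C. \<Sum>m<M1. (cmod (cvmul M2 X (y c) m))\<^sup>2)"
  proof (rule sum_mono)
    fix c
    let ?S = "{I. I \<in> {..<N1} \<and> \<kappa> I = c}"
    have i: "inj_on \<iota> ?S" using inj1 by (auto simp: inj_on_def)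
    have "(\<Sum>I\<in>?S. (cmod (cvmul N2 A x I))\<^sup>2) = (\<Sum>I\<in>?S. (cmod (cvmul M2 X (y c) (\<iota> I)))\<^sup>2)"
      by (intro sum.cong) (auto simp: Ax)
    also have "\<dots> = (\<Sum>m\<in>\<iota> ` ?S. (cmod (cvmul M2 X (y c) m))\<^sup>2)"
      by (subst sum.reindex [OF i]) simp
    also have "\<dots> \<le> (\<Sum>m<M1. (cmod (cvmul M2 X (y c) m))\<^sup>2)"
      by (rule sum_mono2) (auto simp: r1)
    finally show "(\<Sum>I\<in>?S. (cmod (cvmul N2 A x I))\<^sup>2) \<le> (\<Sum>m<M1. (cmod (cvmul M2 X (y c) m))\<^sup>2)" .
  qed
  also have "\<dots> \<le> (\<Sum>c\<in>C. (cmnorm M1 M2 X)\<^sup>2 * (\<Sum>m<M2. (cmod (y c m))\<^sup>2))"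
    unfolding vnorm2_power2 [symmetric] power_mult_distrib [symmetric]
    by (intro sum_mono power_mono cmnorm_bound) simp
  also have "\<dots> = (cmnorm M1 M2 X)\<^sup>2 * (\<Sum>c\<in>C. \<Sum>m<M2. (cmod (y c m))\<^sup>2)"
    by (simp add: sum_distrib_left)
  also have "(\<Sum>c\<in>C. \<Sum>m<M2. (cmod (y c m))\<^sup>2)
      = (\<Sum>c\<in>C. \<Sum>m<M2. \<Sum>J | J \<in> {J. J \<in> {..<N2} \<and> \<kappa>' J = c} \<and> \<iota>' J = m. (cmod (x J))\<^sup>2)"
    unfolding y2 by (intro sum.cong) auto
  also have "\<dots> = (\<Sum>c\<in>C. \<Sum>J | J \<in> {..<N2} \<and> \<kappa>' J = c. (cmod (x J))\<^sup>2)"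
    by (intro sum.cong refl sum.group) (auto simp: r2)
  also have "\<dots> = (\<Sum>J<N2. (cmod (x J))\<^sup>2)"
    by (rule sum.group) (auto simp: C_def)
  finally have "(vnorm2 N1 (cvmul N2 A x))\<^sup>2 \<le> (cmnorm M1 M2 X * vnorm2 N2 x)\<^sup>2"
    by (simp add: vnorm2_power2 power_mult_distrib)
  then show "vnorm2 N1 (cvmul N2 A x) \<le> cmnorm M1 M2 X * vnorm2 N2 x"
    by (rule power2_le_imp_le) simp
qed simp

text \<open>Direct sum of coefficient matrices, which may be rectangular. Unlike \<open>dsum\<close>
  it is not cut off beyond the lower right block, since \<open>cmnorm\<close> and
  \<open>mmul\<close> never look there.\<close>

definition rdsum :: "nat \<Rightarrow> nat \<Rightarrow> complex mat \<Rightarrow> complex mat \<Rightarrow> complex mat" where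
  "rdsum k j a b = (\<lambda>i p. if i < k \<and> p < j then a i p
      else if k \<le> i \<and> j \<le> p then b (i - k) (p - j) else 0)"

lemma rdsum_simps:
  "i < k \<Longrightarrow> p < j \<Longrightarrow> rdsum k j a b i p = a i p"
  "i < k \<Longrightarrow> rdsum k j a b i (j + p) = 0"
  "p < j \<Longrightarrow> rdsum k j a b (k + i) p = 0"
  "rdsum k j a b (k + i) (j + p) = b i p"
  by (simp_all add: rdsum_def)

lemma sum_lessThan_add:
  fixes f :: "nat \<Rightarrow> 'a::comm_monoid_add"
  shows "(\<Sum>i<m+n. f i) = (\<Sum>i<m. f i) + (\<Sum>i<n. f (m + i))"
  by (induction n) (simp_all add: add.assoc)

text \<open>The two blocks act on complementary parts of the vector and their squared lengths add,
  whence a maximum instead of a sum.\<close>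

lemma cmnorm_rdsum_le:
  "cmnorm (k + k') (j + j') (rdsum k j a b) \<le> max (cmnorm k j a) (cmnorm k' j' b)"
proof (rule cmnorm_le)
  let ?M = "max (cmnorm k j a) (cmnorm k' j' b)"
  show M: "0 \<le> ?M" by (simp add: le_max_iff_disj)
  fix x
  let ?y = "cvmul (j + j') (rdsum k j a b) x"
  have 1: "?y i = cvmul j a x i" if "i < k" for i
    using that by (simp add: cvmul_def sum_lessThan_add rdsum_def)
  have 2: "?y (k + i) = cvmul j' b (\<lambda>p. x (j + p)) i" for i
    by (simp add: cvmul_def sum_lessThan_add rdsum_def)
  have "(vnorm2 (k + k') ?y)\<^sup>2 = (vnorm2 k (cvmul j a x))\<^sup>2 + (vnorm2 k' (cvmul j' b (\<lambda>p. x (j + p))))\<^sup>2"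
    by (simp add: vnorm2_power2 sum_lessThan_add 1 2)
  also have "\<dots> \<le> (?M * vnorm2 j x)\<^sup>2 + (?M * vnorm2 j' (\<lambda>p. x (j + p)))\<^sup>2"
    by (intro add_mono power_mono order_trans [OF cmnorm_bound] mult_right_mono) auto
  also have "\<dots> = (?M * vnorm2 (j + j') x)\<^sup>2"
    by (simp add: vnorm2_power2 sum_lessThan_add power_mult_distrib algebra_simps)
  finally show "vnorm2 (k + k') ?y \<le> ?M * vnorm2 (j + j') x"
    by (rule power2_le_imp_le) (use M in simp)
qed

section \<open>Separation of points by bounded functionals\<close>

locale cvec =
  fixes sc :: "complex \<Rightarrow> 'a::ab_group_add \<Rightarrow> 'a" and V :: "'a set"
  assumes zero_mem [simp]: "0 \<in> V"
    and add_mem [simp]: "x \<in> V \<Longrightarrow> y \<in> V \<Longrightarrow> x + y \<in> V"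
    and sc_mem [simp]: "x \<in> V \<Longrightarrow> sc c x \<in> V"
    and sc_add: "x \<in> V \<Longrightarrow> y \<in> V \<Longrightarrow> sc c (x + y) = sc c x + sc c y"
    and sc_add_left: "x \<in> V \<Longrightarrow> sc (c + d) x = sc c x + sc d x"
    and sc_mult: "x \<in> V \<Longrightarrow> sc (c * d) x = sc c (sc d x)"
    and sc_one [simp]: "x \<in> V \<Longrightarrow> sc 1 x = x"
begin

lemma sc_0_left [simp]: "x \<in> V \<Longrightarrow> sc 0 x = 0"
  using sc_add_left [of x 0 0] by simp

lemma sc_0_right [simp]: "sc c 0 = 0"
  using sc_add [of 0 0 c] by simp

lemma sc_minus_one: "x \<in> V \<Longrightarrow> sc (-1) x = - x"
  using sc_add_left [of x "-1" 1] by (simp add: eq_neg_iff_add_eq_0)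

lemma minus_mem [simp]: "x \<in> V \<Longrightarrow> - x \<in> V"
  using sc_mem [of x "-1"] by (simp add: sc_minus_one)

lemma sum_mem: "(\<And>i. i \<in> I \<Longrightarrow> f i \<in> V) \<Longrightarrow> sum f I \<in> V"
  by (induction I rule: infinite_finite_induct) auto

definition linfun :: "('a \<Rightarrow> complex) \<Rightarrow> bool" where
  "linfun \<phi> \<longleftrightarrow> (\<forall>x\<in>V. \<forall>y\<in>V. \<phi> (x + y) = \<phi> x + \<phi> y) \<and> (\<forall>c. \<forall>x\<in>V. \<phi> (sc c x) = c * \<phi> x)"

lemma linfun_0: "linfun \<phi> \<Longrightarrow> \<phi> 0 = 0"
  unfolding linfun_def by (metis add_cancel_right_left zero_mem)

lemma linfun_sum:
  assumes "linfun \<phi>"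
  shows "(\<And>i. i \<in> I \<Longrightarrow> f i \<in> V) \<Longrightarrow> \<phi> (sum f I) = (\<Sum>i\<in>I. \<phi> (f i))"
proof (induction I rule: infinite_finite_induct)
  case (insert a I)
  then have "\<phi> (f a + sum f I) = \<phi> (f a) + \<phi> (sum f I)"
    using assms unfolding linfun_def by (simp add: sum_mem)
  then show ?case using insert by simp
qed (auto simp: linfun_0 [OF assms])

section \<open>Sublinear functionals and the Hahn-Banach theorem\<close>

definition sublin :: "('a \<Rightarrow> real) \<Rightarrow> bool" where
  "sublin q \<longleftrightarrow> (\<forall>x\<in>V. \<forall>y\<in>V. q (x + y) \<le> q x + q y) \<and>
     (\<forall>t>0. \<forall>x\<in>V. q (sc (complex_of_real t) x) \<le> t * q x)"

lemma sc_real_inverse: "t > 0 \<Longrightarrow> x \<in> V \<Longrightarrow> sc (complex_of_real (1 / t)) (sc (complex_of_real t) x) = x"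
  by (simp add: sc_mult [symmetric])

lemma sublin_add: "sublin q \<Longrightarrow> x \<in> V \<Longrightarrow> y \<in> V \<Longrightarrow> q (x + y) \<le> q x + q y"
  by (simp add: sublin_def)

text \<open>Using the inequality for \<open>1 / t\<close> as well turns it into an equality. So
  \<open>sublin\<close> has to be checked in one direction only, the convenient one for infima. Only
  real scalars occur here; \<open>bounded_functional_nonzero\<close> restores the complex
  structure.\<close>

lemma sublin_scale:
  assumes "sublin q" "t > 0" "x \<in> V"
  shows "q (sc (complex_of_real t) x) = t * q x"
proof (rule antisym)
  show "q (sc (complex_of_real t) x) \<le> t * q x"
    using assms by (simp add: sublin_def)
  have "q (sc (complex_of_real (1 / t)) (sc (complex_of_real t) x))
      \<le> 1 / t * q (sc (complex_of_real t) x)"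
    using assms unfolding sublin_def by (meson divide_pos_pos sc_mem zero_less_one)
  then show "t * q x \<le> q (sc (complex_of_real t) x)"
    unfolding sc_real_inverse [OF assms(2,3)] using assms(2) by (simp add: field_simps)
qed

lemma sublin_0: "sublin q \<Longrightarrow> q 0 = 0"
  using sublin_scale [of q 2 0] by simp

lemma sublin_minus: "sublin q \<Longrightarrow> x \<in> V \<Longrightarrow> - q (- x) \<le> q x"
  using sublin_add [of q x "- x"] sublin_0 [of q] by simp

text \<open>For sublinear \<open>q\<close> and \<open>y \<in> V\<close> this is the largest
  sublinear functional on \<open>V\<close> that lies below \<open>q\<close> and is at most
  \<open>- q y\<close> at \<open>- y\<close>. The value 0 off \<open>V\<close> makes comparison on
  the whole type the same as comparison on \<open>V\<close>.\<close>

definition shift :: "('a \<Rightarrow> real) \<Rightarrow> 'a \<Rightarrow> 'a \<Rightarrow> real" where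
  "shift q y x = (if x \<in> V then (INF t\<in>{0..}. q (x + sc (complex_of_real t) y) - t * q y) else 0)"

lemma sublin_scale0:
  assumes "sublin q" "0 \<le> t" "x \<in> V"
  shows "q (sc (complex_of_real t) x) = t * q x"
  using assms sublin_scale [of q t x] sublin_0 [of q] by (cases "t = 0") auto

lemma shift_le:
  assumes q: "sublin q" and y: "y \<in> V" and x: "x \<in> V" and t: "0 \<le> t"
  shows "shift q y x \<le> q (x + sc (complex_of_real t) y) - t * q y"
proof -
  have "bdd_below ((\<lambda>t. q (x + sc (complex_of_real t) y) - t * q y) ` {0..})"
  proof (rule bdd_belowI2)
    fix s :: real assume "s \<in> {0..}"
    then have s: "0 \<le> s" by simp
    \<comment> \<open>Writing s y = (x + s y) + (- x) gives the lower bound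
      \<open>- q (- x)\<close>, uniform in \<open>s\<close>.\<close>
    have "q ((x + sc (complex_of_real s) y) + (- x)) \<le> q (x + sc (complex_of_real s) y) + q (- x)"
      using q x y by (intro sublin_add) auto
    then show "- q (- x) \<le> q (x + sc (complex_of_real s) y) - s * q y"
      using sublin_scale0 [OF q s y] by simp
  qed
  then show ?thesis
    unfolding shift_def using x t by (auto intro: cINF_lower)
qed

lemma shift_greatest:
  assumes "x \<in> V" "\<And>t. 0 \<le> t \<Longrightarrow> c \<le> q (x + sc (complex_of_real t) y) - t * q y"
  shows "c \<le> shift q y x"
  unfolding shift_def using assms by (auto intro!: cINF_greatest)

lemma sublin_shift:
  assumes q: "sublin q" and y: "y \<in> V"
  shows "sublin (shift q y)"
  unfolding sublin_def
proof (intro conjI ballI allI impI)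
  fix x x' assume x: "x \<in> V" and x': "x' \<in> V"
  have "shift q y (x + x') - shift q y x \<le> shift q y x'"
  proof (rule shift_greatest [OF x'])
    fix t' :: real assume t': "0 \<le> t'"
    have "shift q y (x + x') - (q (x' + sc (complex_of_real t') y) - t' * q y) \<le> shift q y x"
    proof (rule shift_greatest [OF x])
      fix t :: real assume t: "0 \<le> t"
      \<comment> \<open>The ray parameters add: independent choices \<open>t\<close> for
        \<open>x\<close> and \<open>t'\<close> for \<open>x'\<close> are compared with
        \<open>t + t'\<close> for the sum.\<close>
      have "x + x' + sc (complex_of_real (t + t')) y
          = (x + sc (complex_of_real t) y) + (x' + sc (complex_of_real t') y)"
        using y by (simp add: sc_add_left algebra_simps)
      then have "q (x + x' + sc (complex_of_real (t + t')) y)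
          \<le> q (x + sc (complex_of_real t) y) + q (x' + sc (complex_of_real t') y)"
        using sublin_add [OF q] x x' y by (metis add_mem sc_mem)
      moreover have "shift q y (x + x') \<le> q (x + x' + sc (complex_of_real (t + t')) y) - (t + t') * q y"
        using x x' t t' by (intro shift_le q y) auto
      ultimately show "shift q y (x + x') - (q (x' + sc (complex_of_real t') y) - t' * q y)
          \<le> q (x + sc (complex_of_real t) y) - t * q y"
        by (simp add: algebra_simps)
    qed
    then show "shift q y (x + x') - shift q y x \<le> q (x' + sc (complex_of_real t') y) - t' * q y"
      by simp
  qed
  then show "shift q y (x + x') \<le> shift q y x + shift q y x'" by simp
next
  fix c :: real and x assume c: "0 < c" and x: "x \<in> V"
  have "shift q y (sc (complex_of_real c) x) / c \<le> shift q y x"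
  proof (rule shift_greatest [OF x])
    fix t :: real assume t: "0 \<le> t"
    \<comment> \<open>The parameter is rescaled together with \<open>x\<close>, so that
      \<open>c * t\<close> at c x corresponds to \<open>t\<close> at \<open>x\<close>.\<close>
    have "sc (complex_of_real c) x + sc (complex_of_real (c * t)) y
        = sc (complex_of_real c) (x + sc (complex_of_real t) y)"
      using x y by (simp add: sc_add sc_mult)
    then have "q (sc (complex_of_real c) x + sc (complex_of_real (c * t)) y)
        = c * q (x + sc (complex_of_real t) y)"
      using sublin_scale [OF q c] x y by simp
    moreover have "shift q y (sc (complex_of_real c) x)
        \<le> q (sc (complex_of_real c) x + sc (complex_of_real (c * t)) y) - (c * t) * q y"
      using x c t by (intro shift_le q y) auto
    ultimately show "shift q y (sc (complex_of_real c) x) / c \<le> q (x + sc (complex_of_real t) y) - t * q y"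
      using c by (simp add: field_simps)
  qed
  then show "shift q y (sc (complex_of_real c) x) \<le> c * shift q y x"
    using c by (simp add: field_simps)
qed

text \<open>Subadditivity is where the chain matters: bounds at \<open>x\<close> and
  \<open>y\<close> that come from different members \<open>q\<close> and \<open>r\<close> are both
  met by the smaller of the two. The common majorant \<open>p\<close> bounds the infimum from below,
  by \<open>- p (- x)\<close>.\<close>

lemma sublin_chain_Inf:
  assumes ne: "C \<noteq> {}" and sub: "\<And>q. q \<in> C \<Longrightarrow> sublin q"
    and chain: "\<And>q r. q \<in> C \<Longrightarrow> r \<in> C \<Longrightarrow> q \<le> r \<or> r \<le> q"
    and bd: "\<forall>q\<in>C. \<forall>x\<in>V. q x \<le> p x"
  shows "sublin (\<lambda>x. if x \<in> V then (INF q\<in>C. q x) else 0)"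
    and "x \<in> V \<Longrightarrow> q \<in> C \<Longrightarrow> (INF q\<in>C. q x) \<le> q x"
proof -
  have low: "(INF q\<in>C. q x) \<le> q x" if "q \<in> C" "x \<in> V" for q x
  proof (rule cINF_lower [OF _ that(1)])
    show "bdd_below ((\<lambda>q. q x) ` C)"
    proof (rule bdd_belowI2)
      fix r assume r: "r \<in> C"
      show "- p (- x) \<le> r x"
        using sublin_minus [OF sub [OF r] that(2)] bspec [OF bspec [OF bd r], of "- x"] that(2) by simp
    qed
  qed
  then show "x \<in> V \<Longrightarrow> q \<in> C \<Longrightarrow> (INF q\<in>C. q x) \<le> q x" .
  let ?u = "\<lambda>x. INF q\<in>C. q x"
  have great: "c \<le> ?u x" if "\<And>q. q \<in> C \<Longrightarrow> c \<le> q x" for c x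
    using that ne by (intro cINF_greatest)
  have add: "?u (x + y) \<le> ?u x + ?u y" if x: "x \<in> V" and y: "y \<in> V" for x y
  proof -
    have "?u (x + y) - ?u y \<le> ?u x"
    proof (rule great)
      fix q assume q: "q \<in> C"
      have "?u (x + y) - q x \<le> ?u y"
      proof (rule great)
        fix r assume r: "r \<in> C"
        obtain w where w: "w \<in> C" "w \<le> q" "w \<le> r"
          using chain [OF q r] q r by blast
        have "?u (x + y) \<le> w (x + y)" using w x y by (intro low) auto
        also have "\<dots> \<le> w x + w y" using sub w x y by (intro sublin_add) auto
        also have "\<dots> \<le> q x + r y" using w by (intro add_mono) (auto simp: le_fun_def)
        finally show "?u (x + y) - q x \<le> r y" by simp
      qed
      then show "?u (x + y) - ?u y \<le> q x" by simp
    qed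
    then show ?thesis by simp
  qed
  have scale: "?u (sc (complex_of_real t) x) \<le> t * ?u x" if t: "0 < t" and x: "x \<in> V" for t x
  proof -
    have "?u (sc (complex_of_real t) x) / t \<le> ?u x"
    proof (rule great)
      fix q assume q: "q \<in> C"
      have "?u (sc (complex_of_real t) x) \<le> q (sc (complex_of_real t) x)"
        using q x by (intro low) auto
      also have "\<dots> = t * q x" using sublin_scale [OF sub [OF q] t x] .
      finally show "?u (sc (complex_of_real t) x) / t \<le> q x" using t by (simp add: field_simps)
    qed
    then show ?thesis using t by (simp add: field_simps)
  qed
  show "sublin (\<lambda>x. if x \<in> V then ?u x else 0)"
    unfolding sublin_def using add scale by auto
qed

text \<open>A minimal sublinear functional below \<open>p\<close> is additive, because its shifts are
  sublinear functionals below it.\<close>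
lemma exists_additive_below_sublin:
  assumes p: "sublin p"
  obtains q where "sublin q" "\<And>x. x \<in> V \<Longrightarrow> q x \<le> p x"
    "\<And>x y. x \<in> V \<Longrightarrow> y \<in> V \<Longrightarrow> q (x + y) = q x + q y"
proof -
  define Q where "Q = {q. sublin q \<and> (\<forall>x\<in>V. q x \<le> p x) \<and> (\<forall>x. x \<notin> V \<longrightarrow> q x = 0)}"
  \<comment> \<open>The order is reversed because \<open>predicate_Zorn\<close> yields maximal
    elements and a minimal functional is wanted.\<close>
  define R where "R = (\<lambda>q r :: 'a \<Rightarrow> real. r \<le> q)"
  have "\<exists>m\<in>Q. \<forall>q\<in>Q. R m q \<longrightarrow> q = m"
  proof (rule predicate_Zorn)
    show "partial_order_on Q (relation_of R Q)"
      by (rule partial_order_on_relation_ofI) (auto simp: R_def)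
    fix C assume C: "C \<in> Chains (relation_of R Q)"
    then have CQ: "C \<subseteq> Q" by (auto simp: Chains_def relation_of_def)
    show "\<exists>u\<in>Q. \<forall>a\<in>C. R a u"
    proof (cases "C = {}")
      case True
      have "(\<lambda>x. if x \<in> V then p x else 0) \<in> Q"
        using p by (auto simp: Q_def sublin_def)
      then show ?thesis using True by blast
    next
      case False
      have ch: "\<And>q r. q \<in> C \<Longrightarrow> r \<in> C \<Longrightarrow> q \<le> r \<or> r \<le> q"
        using C by (auto simp: Chains_def relation_of_def R_def)
      have su: "\<And>q. q \<in> C \<Longrightarrow> sublin q" and bd: "\<forall>q\<in>C. \<forall>x\<in>V. q x \<le> p x"
        using CQ by (auto simp: Q_def)
      let ?u = "\<lambda>x. if x \<in> V then (INF q\<in>C. q x) else 0"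
      have *: "sublin ?u" "\<And>x q. x \<in> V \<Longrightarrow> q \<in> C \<Longrightarrow> (INF q\<in>C. q x) \<le> q x"
        using sublin_chain_Inf [OF False su ch bd] by blast+
      obtain q0 where q0: "q0 \<in> C" using False by blast
      have "?u \<in> Q"
        using *(1) order_trans [OF *(2) [OF _ q0]] bd q0 by (auto simp: Q_def)
      moreover have "R a ?u" if "a \<in> C" for a
        using *(2) [OF _ that] that CQ by (auto simp: R_def le_fun_def Q_def)
      ultimately show ?thesis by blast
    qed
  qed
  then obtain q where q: "q \<in> Q" and min: "\<And>r. r \<in> Q \<Longrightarrow> r \<le> q \<Longrightarrow> r = q"
    by (auto simp: R_def)
  have sq: "sublin q" and qp: "\<And>x. x \<in> V \<Longrightarrow> q x \<le> p x" using q by (auto simp: Q_def)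
  have add: "q (x + y) = q x + q y" if x: "x \<in> V" and y: "y \<in> V" for x y
  proof -
    have le: "shift q y z \<le> q z" if "z \<in> V" for z
      using shift_le [OF sq y that, of 0] y by simp
    have "shift q y \<in> Q"
      using sublin_shift [OF sq y] order_trans [OF le qp] by (auto simp: Q_def shift_def)
    moreover have "shift q y \<le> q"
      using le q by (auto simp: le_fun_def shift_def Q_def)
    ultimately have "shift q y = q" by (rule min)
    \<comment> \<open>The shift equals \<open>q\<close> itself, and its bound at parameter 1 is the
      missing superadditivity.\<close>
    then have "q x \<le> q (x + y) - q y"
      using shift_le [OF sq y x, of 1] y by simp
    then show ?thesis using sublin_add [OF sq x y] by simp
  qed
  show thesis using that sq qp add by blast
qed

text \<open>The additive minorant is taken below \<open>shift p x0\<close> instead of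
  \<open>p\<close>. This builds in the value at \<open>x0\<close> without extending anything from a
  subspace: at parameter 1 the shift is at most \<open>- p x0\<close> at \<open>- x0\<close>, and
  additivity turns this into a lower bound at \<open>x0\<close>.\<close>

lemma real_functional_attaining:
  assumes p: "sublin p" and x0: "x0 \<in> V"
  obtains f where "sublin f" "\<And>x. x \<in> V \<Longrightarrow> f x \<le> p x"
    "\<And>x y. x \<in> V \<Longrightarrow> y \<in> V \<Longrightarrow> f (x + y) = f x + f y" "p x0 \<le> f x0"
proof -
  obtain f where f: "sublin f" "\<And>x. x \<in> V \<Longrightarrow> f x \<le> shift p x0 x"
      "\<And>x y. x \<in> V \<Longrightarrow> y \<in> V \<Longrightarrow> f (x + y) = f x + f y"
    using exists_additive_below_sublin [OF sublin_shift [OF p x0]] by blast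
  have "f x \<le> p x" if "x \<in> V" for x
    using f(2) [OF that] shift_le [OF p x0 that, of 0] x0 by simp
  moreover have "f (- x0) \<le> - p x0"
    using f(2) [of "- x0"] shift_le [OF p x0, of "- x0" 1] x0 sublin_0 [OF p] by simp
  then have "p x0 \<le> f x0"
    using f(3) [of x0 "- x0"] x0 sublin_0 [OF f(1)] by simp
  ultimately show thesis using that f by blast
qed

text \<open>The constant 2 comes from bounding the real and imaginary parts separately by
  \<open>p\<close>; for separating points any finite constant will do.\<close>

theorem bounded_functional_nonzero:
  assumes tri: "\<And>x y. x \<in> V \<Longrightarrow> y \<in> V \<Longrightarrow> p (x + y) \<le> p x + p y"
    and hom: "\<And>c x. x \<in> V \<Longrightarrow> p (sc c x) = cmod c * p x"
    and x0: "x0 \<in> V" "p x0 > 0"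
  obtains \<phi> where "linfun \<phi>" "\<And>x. x \<in> V \<Longrightarrow> cmod (\<phi> x) \<le> 2 * p x" "\<phi> x0 \<noteq> 0"
proof -
  have p: "sublin p" unfolding sublin_def by (simp add: tri hom)
  obtain f where f: "sublin f" and fp: "\<And>x. x \<in> V \<Longrightarrow> f x \<le> p x"
    and fadd: "\<And>x y. x \<in> V \<Longrightarrow> y \<in> V \<Longrightarrow> f (x + y) = f x + f y" and fx0: "p x0 \<le> f x0"
    using real_functional_attaining [OF p x0(1)] by blast
  have fneg: "f (- x) = - f x" if "x \<in> V" for x
    using fadd [of x "- x"] that sublin_0 [OF f] by simp
  have fsc: "f (sc (complex_of_real t) x) = t * f x" if "x \<in> V" for t x
  proof (cases "0 \<le> t")
    case True
    then show ?thesis using sublin_scale0 [OF f _ that] by blast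
  next
    case False
    have "sc (complex_of_real t) x = - sc (complex_of_real (- t)) x"
      using that by (simp add: sc_minus_one [symmetric] sc_mult [symmetric])
    then show ?thesis
      using False fneg [of "sc (complex_of_real (- t)) x"] sublin_scale0 [OF f, of "- t" x] that by simp
  qed
  have fabs: "\<bar>f x\<bar> \<le> p x" if "x \<in> V" for x
    using fp [OF that] fp [of "- x"] fneg [OF that] hom [OF that, of "-1"] that
    by (simp add: sc_minus_one)
  \<comment> \<open>The usual complexification f(x) - i f(ix) of a real-linear functional, which is
    complex-linear and has real part \<open>f\<close>.\<close>
  define \<phi> where "\<phi> = (\<lambda>x. Complex (f x) (- f (sc \<i> x)))"
  have add: "\<phi> (x + y) = \<phi> x + \<phi> y" if "x \<in> V" "y \<in> V" for x y
    using that by (simp add: \<phi>_def complex_eq_iff fadd sc_add)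
  have scr: "\<phi> (sc c x) = c * \<phi> x" if x: "x \<in> V" for c x
  proof -
    have c: "c = complex_of_real (Re c) + complex_of_real (Im c) * \<i>"
      by (simp add: complex_eq_iff)
    have 1: "sc c x = sc (complex_of_real (Re c)) x + sc (complex_of_real (Im c)) (sc \<i> x)"
      by (subst c) (simp add: sc_add_left sc_mult x)
    have ic: "\<i> * c = complex_of_real (- Im c) + complex_of_real (Re c) * \<i>"
      by (simp add: complex_eq_iff)
    have 2: "sc \<i> (sc c x) = sc (complex_of_real (- Im c)) x + sc (complex_of_real (Re c)) (sc \<i> x)"
      unfolding sc_mult [OF x, symmetric] ic by (simp only: sc_add_left [OF x] sc_mult [OF x])
    show ?thesis
      unfolding \<phi>_def 2 unfolding 1 by (simp add: complex_eq_iff fadd fsc x del: of_real_minus)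
  qed
  have "cmod (\<phi> x) \<le> 2 * p x" if x: "x \<in> V" for x
  proof -
    have "cmod (\<phi> x) \<le> \<bar>f x\<bar> + \<bar>f (sc \<i> x)\<bar>"
      using cmod_le [of "\<phi> x"] by (simp add: \<phi>_def)
    also have "\<dots> \<le> p x + p (sc \<i> x)" using x by (intro add_mono fabs) auto
    finally show ?thesis using hom [OF x, of \<i>] by simp
  qed
  moreover have "\<phi> x0 \<noteq> 0" using fx0 x0 by (simp add: \<phi>_def complex_eq_iff)
  moreover have "linfun \<phi>" using add scr by (simp add: linfun_def)
  ultimately show thesis using that by blast
qed

end

section \<open>Ruan's axioms\<close>

lemma opspace_cvec:
  assumes "opspace E"
  shows "cvec (osc E) (ocar E)"
  using assms unfolding opspace_def Let_def by unfold_locales auto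

lemma opspace_nonneg: "opspace E \<Longrightarrow> 1 \<le> n \<Longrightarrow> v \<in> matset n n (ocar E) \<Longrightarrow> 0 \<le> onorm E n v"
  unfolding opspace_def Let_def by blast

lemma opspace_eq_0_iff:
  "opspace E \<Longrightarrow> 1 \<le> n \<Longrightarrow> v \<in> matset n n (ocar E) \<Longrightarrow> onorm E n v = 0 \<longleftrightarrow> v = 0"
  unfolding opspace_def Let_def by blast

lemma opspace_scale:
  "opspace E \<Longrightarrow> 1 \<le> n \<Longrightarrow> v \<in> matset n n (ocar E) \<Longrightarrow>
    onorm E n (\<lambda>i j. osc E c (v i j)) = cmod c * onorm E n v"
  unfolding opspace_def Let_def by blast

lemma opspace_add:
  "opspace E \<Longrightarrow> 1 \<le> n \<Longrightarrow> v \<in> matset n n (ocar E) \<Longrightarrow> w \<in> matset n n (ocar E) \<Longrightarrow>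
    onorm E n (v + w) \<le> onorm E n v + onorm E n w"
  unfolding opspace_def Let_def by blast

lemma opspace_dsum:
  "opspace E \<Longrightarrow> 1 \<le> n \<Longrightarrow> 1 \<le> m \<Longrightarrow> v \<in> matset n n (ocar E) \<Longrightarrow> w \<in> matset m m (ocar E) \<Longrightarrow>
    onorm E (n + m) (dsum n m v w) = max (onorm E n v) (onorm E m w)"
  unfolding opspace_def Let_def by blast

lemma opspace_mmul:
  "opspace E \<Longrightarrow> 1 \<le> n \<Longrightarrow> 1 \<le> k \<Longrightarrow> v \<in> matset n n (ocar E) \<Longrightarrow>
    onorm E k (mmul (osc E) k n a v b) \<le> cmnorm k n a * onorm E n v * cmnorm n k b"
  unfolding opspace_def Let_def by blast

lemma matset_mem: "v \<in> matset m n V \<Longrightarrow> i < m \<Longrightarrow> j < n \<Longrightarrow> v i j \<in> V"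
  by (simp add: matset_def)

lemma matset_outside: "v \<in> matset m n V \<Longrightarrow> \<not> (i < m \<and> j < n) \<Longrightarrow> v i j = 0"
  unfolding matset_def by blast

lemma matset_mem': "v \<in> matset m n V \<Longrightarrow> 0 \<in> V \<Longrightarrow> v i j \<in> V"
  by (cases "i < m \<and> j < n") (auto simp: matset_mem matset_outside)

lemma matset_eqI:
  "v \<in> matset m n V \<Longrightarrow> w \<in> matset m n V \<Longrightarrow> (\<And>i j. i < m \<Longrightarrow> j < n \<Longrightarrow> v i j = w i j) \<Longrightarrow> v = w"
  by (intro ext) (metis matset_outside)

lemma dsum_simps:
  "i < n \<Longrightarrow> p < n \<Longrightarrow> dsum n m v w i p = v i p"
  "i < n \<Longrightarrow> dsum n m v w i (n + p) = 0"
  "p < n \<Longrightarrow> dsum n m v w (n + i) p = 0"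
  "i < m \<Longrightarrow> p < m \<Longrightarrow> dsum n m v w (n + i) (n + p) = w i p"
  by (simp_all add: dsum_def)

lemma dsum_matset:
  assumes "v \<in> matset n n V" "w \<in> matset m m V" "0 \<in> V"
  shows "dsum n m v w \<in> matset (n + m) (n + m) V"
proof -
  have "i - n < m \<longleftrightarrow> i < n + m" if "n \<le> i" for i using that by linarith
  then show ?thesis using assms by (auto simp: matset_def dsum_def)
qed

lemma (in cvec) mmul_matset: "v \<in> matset n n V \<Longrightarrow> mmul sc k n a v b \<in> matset k k V"
  by (auto simp: matset_def mmul_def intro!: sum_mem)

lemma (in cvec) scale_matset: "v \<in> matset n m V \<Longrightarrow> (\<lambda>i j. sc c (v i j)) \<in> matset n m V"
  by (auto simp: matset_def)

lemma (in cvec) add_matset: "v \<in> matset n m V \<Longrightarrow> w \<in> matset n m V \<Longrightarrow> v + w \<in> matset n m V"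
  by (auto simp: matset_def)

lemma (in cvec) zero_matset: "0 \<in> matset n m V"
  by (auto simp: matset_def)

text \<open>A coordinate selection consists of copies of the 1 by 1 matrix 1, one for each value of
  \<pi>; injectivity keeps the copies disjoint.\<close>

lemma cmnorm_01_le:
  assumes "inj_on \<pi> {..<N}"
  shows "cmnorm N M (\<lambda>I L. if L = \<pi> I then 1 else 0) \<le> 1"
    "cmnorm M N (\<lambda>L I. if L = \<pi> I then 1 else 0) \<le> 1"
proof -
  have 1: "cmnorm 1 1 (\<lambda>i j. 1) \<le> 1"
    using cmnorm_row_le [of 1 "\<lambda>_. 1"] by (simp add: vnorm2_def)
  have "cmnorm N M (\<lambda>I L. if L = \<pi> I then 1 else 0) \<le> cmnorm 1 1 (\<lambda>i j. 1)"
    by (rule cmnorm_ampl_le [where \<kappa> = \<pi> and \<kappa>' = "\<lambda>L. L" and \<iota> = "\<lambda>_. 0" and \<iota>' = "\<lambda>_. 0"])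
      (use assms in \<open>auto simp: inj_on_def\<close>)
  with 1 show "cmnorm N M (\<lambda>I L. if L = \<pi> I then 1 else 0) \<le> 1" by simp
  have "cmnorm M N (\<lambda>L I. if L = \<pi> I then 1 else 0) \<le> cmnorm 1 1 (\<lambda>i j. 1)"
    by (rule cmnorm_ampl_le [where \<kappa>' = \<pi> and \<kappa> = "\<lambda>L. L" and \<iota> = "\<lambda>_. 0" and \<iota>' = "\<lambda>_. 0"])
      (use assms in \<open>auto simp: inj_on_def\<close>)
  with 1 show "cmnorm M N (\<lambda>L I. if L = \<pi> I then 1 else 0) \<le> 1" by simp
qed

lemma (in cvec) sum_delta_sc:
  assumes "v \<in> matset n n V" "i0 < n" "j0 < n"
    and "\<And>p q. p < n \<Longrightarrow> q < n \<Longrightarrow> a p q = (if p = i0 \<and> q = j0 then c else 0)"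
  shows "(\<Sum>p<n. \<Sum>q<n. sc (a p q) (v p q)) = sc c (v i0 j0)"
proof -
  have "(\<Sum>p<n. \<Sum>q<n. sc (a p q) (v p q)) = (\<Sum>p<n. \<Sum>q<n. if p = i0 \<and> q = j0 then sc c (v i0 j0) else 0)"
    using assms by (intro sum.cong) (auto simp: matset_def)
  also have "\<dots> = (\<Sum>p<n. if p = i0 then (\<Sum>q<n. if q = j0 then sc c (v i0 j0) else 0) else 0)"
    by (intro sum.cong) auto
  also have "\<dots> = sc c (v i0 j0)" using assms by simp
  finally show ?thesis .
qed

text \<open>Corners and relabellings of a matrix are thereby two-sided multiplications, hence within
  reach of the bimodule inequality.\<close>

lemma (in cvec) mmul_select:
  assumes "v \<in> matset n n V" "\<And>i. i < k \<Longrightarrow> \<pi> i < n"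
  shows "mmul sc k n (\<lambda>i p. if p = \<pi> i then 1 else 0) v (\<lambda>p i. if p = \<pi> i then 1 else 0)
    = (\<lambda>i j. if i < k \<and> j < k then v (\<pi> i) (\<pi> j) else 0)"
proof (intro ext)
  fix i j
  show "mmul sc k n (\<lambda>i p. if p = \<pi> i then 1 else 0) v (\<lambda>p i. if p = \<pi> i then 1 else 0) i j
      = (if i < k \<and> j < k then v (\<pi> i) (\<pi> j) else 0)"
  proof (cases "i < k \<and> j < k")
    case True
    then have "(\<Sum>p<n. \<Sum>q<n. sc ((if p = \<pi> i then 1 else 0) * (if q = \<pi> j then 1 else 0)) (v p q))
        = sc 1 (v (\<pi> i) (\<pi> j))"
      using assms by (intro sum_delta_sc) auto
    then show ?thesis using True assms by (simp add: mmul_def matset_def)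
  qed (auto simp: mmul_def)
qed

text \<open>Homogeneity, the triangle inequality and \<open>N u \<le> N (u \<oplus> w)\<close> are all instances of
  the bimodule inequality: write \<open>v + w\<close> as the compression of \<open>v/s \<oplus> w/t\<close>
  by the row \<open>(\<surd>s, \<surd>t)\<close> and its transpose.\<close>
lemma opspace_Ruan:
  fixes E :: "'a::ab_group_add ospace"
  assumes cv: "cvec (osc E) (ocar E)"
    and nonneg: "\<And>n v. 1 \<le> n \<Longrightarrow> v \<in> matset n n (ocar E) \<Longrightarrow> 0 \<le> onorm E n v"
    and definite: "\<And>n v. 1 \<le> n \<Longrightarrow> v \<in> matset n n (ocar E) \<Longrightarrow> onorm E n v = 0 \<Longrightarrow> v = 0"
    and R1: "\<And>n m v w. 1 \<le> n \<Longrightarrow> 1 \<le> m \<Longrightarrow> v \<in> matset n n (ocar E) \<Longrightarrow> w \<in> matset m m (ocar E) \<Longrightarrow>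
      onorm E (n + m) (dsum n m v w) \<le> max (onorm E n v) (onorm E m w)"
    and R2: "\<And>n k v a b. 1 \<le> n \<Longrightarrow> 1 \<le> k \<Longrightarrow> v \<in> matset n n (ocar E) \<Longrightarrow>
      onorm E k (mmul (osc E) k n a v b) \<le> cmnorm k n a * onorm E n v * cmnorm n k b"
  shows "opspace E"
proof -
  interpret cvec "osc E" "ocar E" by (rule cv)
  let ?N = "onorm E"
  have R2': "?N k (mmul (osc E) k n a v b) \<le> \<alpha> * ?N n v * \<beta>"
    if "1 \<le> n" "1 \<le> k" "v \<in> matset n n (ocar E)" "cmnorm k n a \<le> \<alpha>" "cmnorm n k b \<le> \<beta>"
    for n k v a b \<alpha> \<beta>
  proof -
    have "0 \<le> \<alpha>" using that(4) cmnorm_nonneg order_trans by blast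
    have "?N k (mmul (osc E) k n a v b) \<le> cmnorm k n a * ?N n v * cmnorm n k b"
      using that by (intro R2)
    also have "\<dots> \<le> \<alpha> * ?N n v * \<beta>"
      using that nonneg \<open>0 \<le> \<alpha>\<close> by (intro mult_mono mult_right_mono mult_nonneg_nonneg) auto
    finally show ?thesis .
  qed
  have hom_le: "?N n (\<lambda>i j. osc E c (v i j)) \<le> cmod c * ?N n v"
    if n: "1 \<le> n" and v: "v \<in> matset n n (ocar E)" for n v c
  proof -
    let ?a = "\<lambda>i p. c * (if p = i then 1 else 0)" and ?b = "\<lambda>p i. if p = i then 1 else 0"
    have "mmul (osc E) n n ?a v ?b = (\<lambda>i j. osc E c (v i j))"
    proof (rule matset_eqI [OF mmul_matset [OF v] scale_matset [OF v]])
      fix i j assume ij: "i < n" "j < n"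
      then have "(\<Sum>p<n. \<Sum>q<n. osc E (?a i p * ?b q j) (v p q)) = osc E c (v i j)"
        by (intro sum_delta_sc v) auto
      then show "mmul (osc E) n n ?a v ?b i j = osc E c (v i j)"
        using ij by (simp add: mmul_def)
    qed
    moreover have "cmnorm n n ?a \<le> cmod c * 1"
      by (rule order_trans [OF cmnorm_scale_le mult_left_mono [OF cmnorm_01_le(1)]]) auto
    moreover have "cmnorm n n ?b \<le> 1" by (rule cmnorm_01_le(2)) simp
    ultimately show ?thesis using R2' [OF n n v, of ?a "cmod c * 1" ?b 1] by simp
  qed
  have N0: "?N n 0 = 0" if "1 \<le> n" for n
  proof -
    have "?N n (\<lambda>i j. osc E 0 ((0 :: 'a mat) i j)) \<le> cmod 0 * ?N n 0"
      by (rule hom_le [OF that zero_matset])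
    moreover have "(\<lambda>i j. osc E 0 ((0 :: 'a mat) i j)) = 0" by (simp add: fun_eq_iff)
    ultimately have "?N n 0 \<le> 0" by simp
    then show ?thesis using nonneg [OF that zero_matset] by simp
  qed
  have hom: "?N n (\<lambda>i j. osc E c (v i j)) = cmod c * ?N n v"
    if n: "1 \<le> n" and v: "v \<in> matset n n (ocar E)" for n v c
  proof (cases "c = 0")
    case True
    have "(\<lambda>i j. osc E c (v i j)) = 0" using matset_mem' [OF v] True by (simp add: fun_eq_iff)
    then show ?thesis using True N0 [OF n] by simp
  next
    case False
    let ?w = "\<lambda>i j. osc E c (v i j)"
    have "(\<lambda>i j. osc E (1 / c) (?w i j)) = v"
      using False matset_mem' [OF v] by (simp add: sc_mult [symmetric] fun_eq_iff)
    then have "?N n v \<le> cmod (1 / c) * ?N n ?w"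
      using hom_le [OF n scale_matset [OF v, of c], of "1 / c"] by simp
    then have "cmod c * ?N n v \<le> ?N n ?w" using False by (simp add: norm_divide field_simps)
    then show ?thesis using hom_le [OF n v, of c] by simp
  qed
  have dsum: "?N (n + m) (dsum n m v w) = max (?N n v) (?N m w)"
    if n: "1 \<le> n" and m: "1 \<le> m" and v: "v \<in> matset n n (ocar E)" and w: "w \<in> matset m m (ocar E)"
    for n m v w
  proof (rule antisym [OF R1 [OF n m v w]])
    have d: "dsum n m v w \<in> matset (n + m) (n + m) (ocar E)" using v w by (rule dsum_matset) simp
    have nm: "1 \<le> n + m" using n by simp
    have "(\<lambda>i j. if i < n \<and> j < n then dsum n m v w i j else 0) = v"
      by (intro ext) (auto simp: dsum_def matset_outside [OF v])
    then have 1: "mmul (osc E) n (n + m) (\<lambda>i p. if p = i then 1 else 0) (dsum n m v w)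
        (\<lambda>p i. if p = i then 1 else 0) = v"
      using mmul_select [OF d, of n "\<lambda>i. i"] by simp
    have "(\<lambda>i j. if i < m \<and> j < m then dsum n m v w (n + i) (n + j) else 0) = w"
      by (intro ext) (auto simp: dsum_def matset_outside [OF w])
    then have 2: "mmul (osc E) m (n + m) (\<lambda>i p. if p = n + i then 1 else 0) (dsum n m v w)
        (\<lambda>p i. if p = n + i then 1 else 0) = w"
      using mmul_select [OF d, of m "\<lambda>i. n + i"] by simp
    have "?N n v \<le> 1 * ?N (n + m) (dsum n m v w) * 1"
      by (subst 1 [symmetric]) (intro R2' nm n d cmnorm_01_le, auto)
    moreover have "?N m w \<le> 1 * ?N (n + m) (dsum n m v w) * 1"
      by (subst 2 [symmetric]) (intro R2' nm m d cmnorm_01_le, auto simp: inj_on_def)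
    ultimately show "max (?N n v) (?N m w) \<le> ?N (n + m) (dsum n m v w)" by simp
  qed
  have tri: "?N n (v + w) \<le> ?N n v + ?N n w"
    if n: "1 \<le> n" and v: "v \<in> matset n n (ocar E)" and w: "w \<in> matset n n (ocar E)" for n v w
  proof -
    \<comment> \<open>Strict upper bounds \<open>s\<close> and \<open>t\<close> replace the norms:
      they are positive even where a norm vanishes, so one may divide by them.\<close>
    have st: "?N n (v + w) \<le> s + t" if s: "?N n v < s" and t: "?N n w < t" for s t
    proof -
      have s0: "0 < s" and t0: "0 < t" using nonneg [OF n v] nonneg [OF n w] s t by linarith+
      define v' where "v' = (\<lambda>i j. osc E (complex_of_real (1 / s)) (v i j))"
      define w' where "w' = (\<lambda>i j. osc E (complex_of_real (1 / t)) (w i j))"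
      have v': "v' \<in> matset n n (ocar E)" and w': "w' \<in> matset n n (ocar E)"
        unfolding v'_def w'_def using v w by (auto intro: scale_matset)
      have "?N n v' = 1 / s * ?N n v" "?N n w' = 1 / t * ?N n w"
        unfolding v'_def w'_def hom [OF n v] hom [OF n w] using s0 t0 by (simp_all add: norm_divide)
      then have "?N n v' \<le> 1" "?N n w' \<le> 1" using s t s0 t0 by simp_all
      then have d1: "?N (n + n) (dsum n n v' w') \<le> 1" using dsum [OF n n v' w'] by simp
      have d: "dsum n n v' w' \<in> matset (n + n) (n + n) (ocar E)"
        using v' w' by (rule dsum_matset) simp
      define a where "a = (\<lambda>i p. if p = i then complex_of_real (sqrt s)
        else if p = n + i then complex_of_real (sqrt t) else 0)"
      define X where "X = (\<lambda>m::nat. if m = 0 then complex_of_real (sqrt s) else complex_of_real (sqrt t))"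
      have X: "vnorm2 2 X = sqrt (s + t)"
        using s0 t0 by (simp add: vnorm2_def X_def numeral_2_eq_2)
      have modinj: "inj_on (\<lambda>p. (p mod n, p div n)) A" for A
        by (rule inj_onI) (metis Pair_inject div_mult_mod_eq)
      have div: "p div n < 2" if "p < n + n" for p
        using that n by (simp add: div_less_iff_less_mult)
      \<comment> \<open>Column \<open>p\<close> of \<open>a\<close> lies in block
        \<open>p div n\<close> at place \<open>p mod n\<close>. This exhibits \<open>a\<close> as
        the row \<open>X\<close> of length 2 tensored with the identity of size \<open>n\<close>, so
        its norm is at most that of \<open>X\<close>.\<close>
      have aX: "a i p = (if i = p mod n then X (p div n) else 0)" if "i < n" "p < n + n" for i p
      proof (cases "p < n")
        case False
        then obtain q where "p = n + q" by (metis le_add_diff_inverse not_le)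
        then show ?thesis using that n by (auto simp: a_def X_def)
      qed (use that in \<open>auto simp: a_def X_def\<close>)
      have a: "cmnorm n (n + n) a \<le> sqrt (s + t)"
      proof -
        have "cmnorm n (n + n) a \<le> cmnorm 1 2 (\<lambda>_. X)"
          by (rule cmnorm_ampl_le [where \<kappa> = "\<lambda>i. i" and \<kappa>' = "\<lambda>p. p mod n"
                and \<iota> = "\<lambda>_. 0" and \<iota>' = "\<lambda>p. p div n"])
            (use modinj in \<open>auto simp: aX div inj_on_def\<close>)
        also have "\<dots> \<le> sqrt (s + t)" using cmnorm_row_le [of 2 X] X by simp
        finally show ?thesis .
      qed
      have b: "cmnorm (n + n) n (\<lambda>q l. a l q) \<le> sqrt (s + t)"
      proof -
        have "cmnorm (n + n) n (\<lambda>q l. a l q) \<le> cmnorm 2 1 (\<lambda>m _. X m)"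
          by (rule cmnorm_ampl_le [where \<kappa>' = "\<lambda>i. i" and \<kappa> = "\<lambda>p. p mod n"
                and \<iota>' = "\<lambda>_. 0" and \<iota> = "\<lambda>p. p div n"])
            (use modinj in \<open>auto simp: aX div inj_on_def\<close>)
        also have "\<dots> \<le> sqrt (s + t)" using cmnorm_col_le [of 2 X] X by simp
        finally show ?thesis .
      qed
      have "mmul (osc E) n (n + n) a (dsum n n v' w') (\<lambda>q l. a l q) = v + w"
      proof (rule matset_eqI [OF mmul_matset [OF d] add_matset [OF v w]])
        fix i l assume il: "i < n" "l < n"
        have "(\<Sum>p<n. \<Sum>q<n. osc E (a i p * a l q) (v' p q)) = osc E (complex_of_real s) (v' i l)"
          using il s0 by (intro sum_delta_sc v') (auto simp: a_def of_real_mult [symmetric] simp del: of_real_mult)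
        also have "\<dots> = v i l"
          using s0 matset_mem [OF v il] by (simp add: v'_def sc_mult [symmetric])
        finally have 1: "(\<Sum>p<n. \<Sum>q<n. osc E (a i p * a l q) (v' p q)) = v i l" .
        have "(\<Sum>p<n. \<Sum>q<n. osc E (a i (n + p) * a l (n + q)) (w' p q)) = osc E (complex_of_real t) (w' i l)"
          using il t0 by (intro sum_delta_sc w') (auto simp: a_def of_real_mult [symmetric] simp del: of_real_mult)
        also have "\<dots> = w i l"
          using t0 matset_mem [OF w il] by (simp add: w'_def sc_mult [symmetric])
        finally have 2: "(\<Sum>p<n. \<Sum>q<n. osc E (a i (n + p) * a l (n + q)) (w' p q)) = w i l" .
        show "mmul (osc E) n (n + n) a (dsum n n v' w') (\<lambda>q l. a l q) i l = (v + w) i l"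
          using il by (simp add: mmul_def sum_lessThan_add dsum_def 1 2)
      qed
      then have "?N n (v + w) \<le> sqrt (s + t) * ?N (n + n) (dsum n n v' w') * sqrt (s + t)"
        using R2' [OF _ n d a b] n by simp
      also have "\<dots> = (s + t) * ?N (n + n) (dsum n n v' w')"
        using s0 t0 by simp
      also have "\<dots> \<le> (s + t) * 1" using s0 t0 d1 by (intro mult_left_mono) auto
      finally show ?thesis by simp
    qed
    show ?thesis
    proof (rule field_le_epsilon)
      fix e :: real assume "0 < e"
      then show "?N n (v + w) \<le> ?N n v + ?N n w + e"
        using st [of "?N n v + e / 2" "?N n w + e / 2"] by simp
    qed
  qed
  show ?thesis
    unfolding opspace_def Let_def
  proof (intro conjI ballI allI impI)
    fix n :: nat and v :: "'a mat" assume n: "1 \<le> n" and v: "v \<in> matset n n (ocar E)"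
    show "onorm E n v = 0 \<longleftrightarrow> v = 0" using definite [OF n v] N0 [OF n] by blast
  qed (simp_all only: nonneg hom tri dsum R2 sc_add sc_add_left sc_mult sc_one zero_mem add_mem sc_mem)
qed

section \<open>The algebraic tensor product\<close>

lemma lfun_iff_linfun: "opspace E \<Longrightarrow> lfun E \<phi> \<longleftrightarrow> cvec.linfun (osc E) (ocar E) \<phi>"
  by (simp add: lfun_def cvec.linfun_def [OF opspace_cvec])

lemma sum_apply2: "(sum f I) \<phi> \<psi> = (\<Sum>i\<in>I. f i \<phi> \<psi>)"
  by (induction I rule: infinite_finite_induct) auto

lemma tsc_apply [simp]: "tsc c t \<phi> \<psi> = c * t \<phi> \<psi>"
  by (simp add: tsc_def)

lemma ten_apply: "ten E F x y \<phi> \<psi> = (if lfun E \<phi> \<and> lfun F \<psi> then \<phi> x * \<psi> y else 0)"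
  by (simp add: ten_def)

lemma ten_scale_left: "x \<in> ocar E \<Longrightarrow> ten E F (osc E c x) y = tsc c (ten E F x y)"
  by (intro ext) (simp add: ten_apply lfun_def)

lemma ten_zero_left: "opspace E \<Longrightarrow> ten E F 0 y = 0"
  by (intro ext) (simp add: ten_apply lfun_iff_linfun cvec.linfun_0 [OF opspace_cvec])

lemma ten_zero_right: "opspace F \<Longrightarrow> ten E F x 0 = 0"
  by (intro ext) (simp add: ten_apply lfun_iff_linfun cvec.linfun_0 [OF opspace_cvec])

lemma tspace_I:
  fixes m :: nat
  shows "\<forall>i<m. x i \<in> ocar E \<and> y i \<in> ocar F \<Longrightarrow> (\<Sum>i<m. ten E F (x i) (y i)) \<in> tspace E F"
  unfolding tspace_def by blast

lemma tspace_E: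
  assumes "t \<in> tspace E F"
  obtains m :: nat and x y where "t = (\<Sum>i<m. ten E F (x i) (y i))" "\<forall>i<m. x i \<in> ocar E \<and> y i \<in> ocar F"
  using assms unfolding tspace_def by blast

lemma tspace_cvec:
  assumes "opspace E" "opspace F"
  shows "cvec tsc (tspace E F)"
proof
  interpret E: cvec "osc E" "ocar E" by (rule opspace_cvec [OF assms(1)])
  show "0 \<in> tspace E F"
    using tspace_I [of 0 "\<lambda>_. 0" E "\<lambda>_. 0" F] by simp
  fix s assume "s \<in> tspace E F"
  then obtain m :: nat and x y where s: "s = (\<Sum>i<m. ten E F (x i) (y i))"
    and xy: "\<forall>i<m. x i \<in> ocar E \<and> y i \<in> ocar F"
    by (rule tspace_E)
  show "tsc c s \<in> tspace E F" for c
  proof -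
    \<comment> \<open>The scalar is absorbed by the left factors; this is why sums without
      coefficients already form a subspace.\<close>
    have "tsc c s = (\<Sum>i<m. ten E F (osc E c (x i)) (y i))"
      using xy by (intro ext) (simp add: s sum_apply2 ten_scale_left sum_distrib_left)
    then show ?thesis using xy by (simp add: tspace_I)
  qed
  fix t assume "t \<in> tspace E F"
  then obtain m' :: nat and x' y' where t: "t = (\<Sum>i<m'. ten E F (x' i) (y' i))"
    and xy': "\<forall>i<m'. x' i \<in> ocar E \<and> y' i \<in> ocar F"
    by (rule tspace_E)
  let ?x = "\<lambda>i. if i < m then x i else x' (i - m)" and ?y = "\<lambda>i. if i < m then y i else y' (i - m)"
  have "s + t = (\<Sum>i<m+m'. ten E F (?x i) (?y i))"
    by (simp add: sum_lessThan_add s t)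
  also have "\<dots> \<in> tspace E F"
    using xy xy' by (intro tspace_I) (auto simp: less_diff_conv2)
  finally show "s + t \<in> tspace E F" .
qed (auto simp: fun_eq_iff algebra_simps)

text \<open>The entries are sums of different lengths. Padding with zero tensors gives them one
  common positive length \<open>M\<close>, so that an entry and a summand can later be coded
  together in a single index.\<close>

lemma tspace_matrix_rep:
  assumes "opspace E" "opspace F" "u \<in> matset n n (tspace E F)"
  shows "\<exists>(M::nat) x y. 1 \<le> M \<and> (\<forall>i l r. x i l r \<in> ocar E \<and> y i l r \<in> ocar F) \<and>
    (\<forall>i<n. \<forall>l<n. u i l = (\<Sum>r<M. ten E F (x i l r) (y i l r)))"
proof -
  interpret E: cvec "osc E" "ocar E" by (rule opspace_cvec [OF assms(1)])
  interpret F: cvec "osc F" "ocar F" by (rule opspace_cvec [OF assms(2)])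
  define Q where "Q = (\<lambda>i l (m, x, y). i < n \<longrightarrow> l < n \<longrightarrow>
      u i l = (\<Sum>r<m::nat. ten E F (x r) (y r)) \<and> (\<forall>r<m. x r \<in> ocar E \<and> y r \<in> ocar F))"
  have "\<exists>z. Q i l z" for i l
  proof (cases "i < n \<and> l < n")
    case True
    then have "u i l \<in> tspace E F" using matset_mem [OF assms(3)] by simp
    then obtain m :: nat and x y where "u i l = (\<Sum>r<m. ten E F (x r) (y r))"
        "\<forall>r<m. x r \<in> ocar E \<and> y r \<in> ocar F"
      by (rule tspace_E)
    then have "Q i l (m, x, y)" by (simp add: Q_def)
    then show ?thesis ..
  qed (auto simp: Q_def)
  then obtain z where z: "\<And>i l. Q i l (z i l)" by metis
  define m where "m = (\<lambda>i l. fst (z i l))"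
  define x where "x = (\<lambda>i l. fst (snd (z i l)))"
  define y where "y = (\<lambda>i l. snd (snd (z i l)))"
  have mxy: "u i l = (\<Sum>r<m i l. ten E F (x i l r) (y i l r)) \<and>
      (\<forall>r<m i l. x i l r \<in> ocar E \<and> y i l r \<in> ocar F)" if "i < n" "l < n" for i l
    using z [of i l] that by (simp add: Q_def m_def x_def y_def case_prod_beta)
  define M where "M = Suc (\<Sum>i<n. \<Sum>l<n. m i l)"
  define in_range where "in_range = (\<lambda>i l r. i < n \<and> l < n \<and> r < m i l)"
  define x' where "x' = (\<lambda>i l r. if in_range i l r then x i l r else 0)"
  define y' where "y' = (\<lambda>i l r. if in_range i l r then y i l r else 0)"
  show ?thesis
  proof (intro exI conjI allI impI)
    show "1 \<le> M" by (simp add: M_def)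
    show "x' i l r \<in> ocar E" "y' i l r \<in> ocar F" for i l r
      using mxy by (auto simp: x'_def y'_def in_range_def)
    fix i l assume il: "i < n" "l < n"
    have "m i l \<le> (\<Sum>l<n. m i l)" using il by (intro member_le_sum) auto
    also have "\<dots> \<le> (\<Sum>i<n. \<Sum>l<n. m i l)" using il by (intro member_le_sum) auto
    finally have le: "m i l \<le> M" by (simp add: M_def)
    have "u i l = (\<Sum>r<m i l. ten E F (x' i l r) (y' i l r))"
      using mxy [OF il] il by (auto simp: x'_def y'_def in_range_def)
    also have "\<dots> = (\<Sum>r<M. ten E F (x' i l r) (y' i l r))"
      using le by (intro sum.mono_neutral_left)
        (auto simp: x'_def in_range_def ten_zero_left assms)
    finally show "u i l = (\<Sum>r<M. ten E F (x' i l r) (y' i l r))" .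
  qed
qed

text \<open>The change of index behind every Kronecker product below: a pair (a, b) with b < q is
  coded as a q + b.\<close>

lemma sum_div_mod:
  fixes f :: "nat \<Rightarrow> nat \<Rightarrow> 'a::comm_monoid_add"
  shows "(\<Sum>I<p*q. f (I div q) (I mod q)) = (\<Sum>a<p. \<Sum>b<q. f a b)"
proof (induction p)
  case (Suc p)
  have "(\<Sum>I<Suc p * q. f (I div q) (I mod q)) = (\<Sum>I<p * q + q. f (I div q) (I mod q))"
    by (simp add: add.commute)
  also have "\<dots> = (\<Sum>a<p. \<Sum>b<q. f a b) + (\<Sum>b<q. f p b)"
    unfolding sum_lessThan_add Suc.IH by (intro arg_cong2 [where f = "(+)"] sum.cong) auto
  finally show ?case by simp
qed simp

lemma div_less_of_less_mult: "I < p * q \<Longrightarrow> I div q < (p::nat)"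
  by (simp add: less_mult_imp_div_less)

lemma mod_less_of_less_mult: "I < p * q \<Longrightarrow> I mod q < (q::nat)"
  by (metis mod_less_divisor mult_0_right not_less0 not_gr_zero)

lemma sum_if_and:
  fixes f :: "nat \<Rightarrow> nat \<Rightarrow> 'a::comm_monoid_add"
  assumes "a0 < p" "b0 < q"
  shows "(\<Sum>a<p. \<Sum>b<q. if a = a0 \<and> b = b0 then f a b else 0) = f a0 b0"
proof -
  have "(\<Sum>a<p. \<Sum>b<q. if a = a0 \<and> b = b0 then f a b else 0)
      = (\<Sum>a<p. if a = a0 then (\<Sum>b<q. if b = b0 then f a b else 0) else 0)"
    by (intro sum.cong) auto
  also have "\<dots> = f a0 b0" using assms by simp
  finally show ?thesis .
qed

text \<open>All elementary tensors that occur in the entries of \<open>u\<close> are lined up on the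
  diagonals of \<open>X\<close> and \<open>Y\<close>. Their Kronecker product contains every mixed
  tensor; \<open>a\<close> and \<open>b\<close> keep only those with equal positions h = k and send
  them to the right row and column.\<close>

lemma proj_decomposition_exists:
  assumes E: "opspace E" and F: "opspace F" and u: "u \<in> matset n n (tspace E F)" and n: "1 \<le> n"
  obtains p q a x y b where "1 \<le> p" "1 \<le> q" "x \<in> matset p p (ocar E)" "y \<in> matset q q (ocar F)"
    "u = mmul tsc n (p * q) a (kron E F p q x y) b"
proof -
  interpret EC: cvec "osc E" "ocar E" by (rule opspace_cvec [OF E])
  interpret FC: cvec "osc F" "ocar F" by (rule opspace_cvec [OF F])
  from tspace_matrix_rep [OF E F u] obtain M :: nat and x y where
    Mxy: "1 \<le> M \<and> (\<forall>i l r. x i l r \<in> ocar E \<and> y i l r \<in> ocar F) \<and>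
      (\<forall>i<n. \<forall>l<n. u i l = (\<Sum>r<M. ten E F (x i l r) (y i l r)))"
    by (elim exE)
  then have M: "1 \<le> M" and x: "\<And>i l r. x i l r \<in> ocar E" and y: "\<And>i l r. y i l r \<in> ocar F"
    and uxy: "\<And>i l. i < n \<Longrightarrow> l < n \<Longrightarrow> u i l = (\<Sum>r<M. ten E F (x i l r) (y i l r))"
    by simp_all
  \<comment> \<open>A position h < n n M codes a triple (i, l, r): \<open>h div M div n\<close> is
    the row, \<open>h div M mod n\<close> the column and \<open>h mod M\<close> the summand.\<close>
  define R where "R = n * n * M"
  define x' where "x' = (\<lambda>h. x (h div M div n) (h div M mod n) (h mod M))"
  define y' where "y' = (\<lambda>h. y (h div M div n) (h div M mod n) (h mod M))"
  define X where "X = (\<lambda>h k. if h < R \<and> k < R \<and> h = k then x' h else 0)"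
  define Y where "Y = (\<lambda>h k. if h < R \<and> k < R \<and> h = k then y' h else 0)"
  define a where "a = (\<lambda>i H. if H div R = H mod R \<and> H div R div M div n = i then 1 else 0 :: complex)"
  define b where "b = (\<lambda>H l. if H div R = H mod R \<and> H div R div M mod n = l then 1 else 0 :: complex)"
  have R: "1 \<le> R" using n M by (simp add: R_def)
  show thesis
  proof (rule that)
    show "1 \<le> R" "1 \<le> R" by (rule R)+
    show "X \<in> matset R R (ocar E)" "Y \<in> matset R R (ocar F)"
      by (auto simp: matset_def X_def Y_def x'_def y'_def x y)
    show "u = mmul tsc n (R * R) a (kron E F R R X Y) b"
    proof (intro ext)
      fix i l \<phi> \<psi>
      show "u i l \<phi> \<psi> = mmul tsc n (R * R) a (kron E F R R X Y) b i l \<phi> \<psi>"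
      proof (cases "i < n \<and> l < n")
        case False
        then show ?thesis using matset_outside [OF u False] by (auto simp: mmul_def)
      next
        case True
        have k: "kron E F R R X Y P Q = (if P = Q then ten E F (x' (P div R)) (y' (P mod R)) else 0)"
          if "P < R * R" "Q < R * R" for P Q
        proof -
          have "P = Q \<longleftrightarrow> P div R = Q div R \<and> P mod R = Q mod R"
            by (metis div_mult_mod_eq)
          then show ?thesis
            using that div_less_of_less_mult [of P R R] mod_less_of_less_mult [of P R R]
              div_less_of_less_mult [of Q R R] mod_less_of_less_mult [of Q R R]
            by (auto simp: kron_def X_def Y_def ten_zero_left [OF E] ten_zero_right [OF F])
        qed
        have "mmul tsc n (R * R) a (kron E F R R X Y) b i l
            = (\<Sum>P<R*R. \<Sum>Q<R*R. tsc (a i P * b Q l) (kron E F R R X Y P Q))"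
          using True by (simp add: mmul_def)
        also have "\<dots> = (\<Sum>P<R*R. \<Sum>Q<R*R. if P = Q then tsc (a i P * b Q l) (ten E F (x' (P div R)) (y' (P mod R))) else 0)"
          by (intro sum.cong) (auto simp: k fun_eq_iff)
        also have "\<dots> = (\<Sum>P<R*R. tsc (a i P * b P l) (ten E F (x' (P div R)) (y' (P mod R))))"
          by (intro sum.cong) auto
        also have "\<dots> = (\<Sum>P<R*R. if P div R = P mod R then
             (if P div R div M div n = i \<and> P div R div M mod n = l
              then ten E F (x' (P div R)) (y' (P div R)) else 0) else 0)"
          by (intro sum.cong) (auto simp: a_def b_def fun_eq_iff)
        also have "\<dots> = (\<Sum>h<R. \<Sum>k<R. if h = k then
             (if h div M div n = i \<and> h div M mod n = l then ten E F (x' h) (y' h) else 0) else 0)"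
          by (rule sum_div_mod)
        also have "\<dots> = (\<Sum>h<R. if h div M div n = i \<and> h div M mod n = l then ten E F (x' h) (y' h) else 0)"
          by (intro sum.cong) auto
        also have "\<dots> = (\<Sum>c<n*n. \<Sum>r<M. if c div n = i \<and> c mod n = l
            then ten E F (x (c div n) (c mod n) r) (y (c div n) (c mod n) r) else 0)"
          unfolding R_def x'_def y'_def
          by (rule sum_div_mod [where f = "\<lambda>c r. if c div n = i \<and> c mod n = l
            then ten E F (x (c div n) (c mod n) r) (y (c div n) (c mod n) r) else 0"])
        also have "\<dots> = (\<Sum>\<alpha><n. \<Sum>\<beta><n. \<Sum>r<M. if \<alpha> = i \<and> \<beta> = l
            then ten E F (x \<alpha> \<beta> r) (y \<alpha> \<beta> r) else 0)"
          by (rule sum_div_mod)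
        also have "\<dots> = (\<Sum>\<alpha><n. \<Sum>\<beta><n. if \<alpha> = i \<and> \<beta> = l
            then \<Sum>r<M. ten E F (x \<alpha> \<beta> r) (y \<alpha> \<beta> r) else 0)"
          by (intro sum.cong) auto
        also have "\<dots> = u i l" using True by (simp add: sum_if_and uxy)
        finally show ?thesis by simp
      qed
    qed
  qed
qed

section \<open>Amplifications in an abstract operator space\<close>

lemma opspace_blockdiag_le:
  fixes M C :: nat
  assumes E: "opspace E" and x: "x \<in> matset M M (ocar E)" and M: "1 \<le> M" and C: "1 \<le> C"
  defines "D \<equiv> (\<lambda>C I J. if I < C * M \<and> J < C * M \<and> I div M = J div M then x (I mod M) (J mod M) else 0)"
  shows "D C \<in> matset (C * M) (C * M) (ocar E) \<and> onorm E (C * M) (D C) \<le> onorm E M x"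
proof -
  interpret EC: cvec "osc E" "ocar E" by (rule opspace_cvec [OF E])
  have mem: "D C \<in> matset (C * M) (C * M) (ocar E)" for C
    using matset_mem' [OF x] by (auto simp: matset_def D_def)
  have "onorm E (C * M) (D C) \<le> onorm E M x"
    using C
  proof (induction C rule: dec_induct)
    case base
    have "D 1 = x" by (intro ext) (auto simp: D_def matset_outside [OF x])
    then show ?case by simp
  next
    case (step C)
    \<comment> \<open>One more diagonal copy is one more direct summand, and a maximum of equal
      bounds does not grow.\<close>
    have "D (Suc C) = dsum (C * M) M (D C) x"
    proof (intro ext)
      fix I J
      have lo: "I div M < C \<longleftrightarrow> I < C * M" for I
        using M by (simp add: div_less_iff_less_mult)
      have hi: "I div M = C" "I mod M = I - C * M" if I: "C * M \<le> I" "I < C * M + M" for I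
      proof -
        obtain d where d: "I = C * M + d" using le_Suc_ex [OF I(1)] by blast
        then have "d < M" using I(2) by simp
        then show "I div M = C" "I mod M = I - C * M" using d by auto
      qed
      show "D (Suc C) I J = dsum (C * M) M (D C) x I J"
      proof (cases "I < C * M + M \<and> J < C * M + M")
        case True
        then show ?thesis
          using lo [of I] lo [of J] hi [of I] hi [of J]
          by (cases "I < C * M"; cases "J < C * M") (simp_all add: D_def dsum_def add.commute [of M])
      qed (auto simp: D_def dsum_def add.commute [of M])
    qed
    then have "onorm E (Suc C * M) (D (Suc C)) = onorm E (C * M + M) (dsum (C * M) M (D C) x)"
      by (simp add: add.commute)
    also have "\<dots> = max (onorm E (C * M) (D C)) (onorm E M x)"
      using step M by (intro opspace_dsum E mem x) (auto simp: Suc_leI)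
    finally show ?case using step by simp
  qed
  then show ?thesis using mem by blast
qed

text \<open>Counterpart of \<open>cmnorm_ampl_le\<close> where no vectors are available, only the
  axioms: \<pi> embeds the indices into \<open>C\<close> diagonal copies of \<open>x\<close>, and
  the wanted matrix is a corner of these. It treats x \<otimes> 1 and 1 \<otimes> y alike, although
  their copies are interleaved differently.\<close>

lemma opspace_ampl_le:
  fixes M C :: nat
  assumes E: "opspace E" and x: "x \<in> matset M M (ocar E)" and M: "1 \<le> M" and N: "1 \<le> N" and C: "1 \<le> C"
    and inj: "inj_on (\<lambda>I. (\<kappa> I, \<iota> I)) {..<N}"
    and r: "\<And>I. I < N \<Longrightarrow> \<iota> I < M" "\<And>I. I < N \<Longrightarrow> \<kappa> I < C"
  shows "onorm E N (\<lambda>I J. if I < N \<and> J < N \<and> \<kappa> I = \<kappa> J then x (\<iota> I) (\<iota> J) else 0) \<le> onorm E M x"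
proof -
  interpret EC: cvec "osc E" "ocar E" by (rule opspace_cvec [OF E])
  define D where "D = (\<lambda>I J. if I < C * M \<and> J < C * M \<and> I div M = J div M then x (I mod M) (J mod M) else 0)"
  have D: "D \<in> matset (C * M) (C * M) (ocar E)" "onorm E (C * M) D \<le> onorm E M x"
    using opspace_blockdiag_le [OF E x M C] by (simp_all add: D_def)
  define \<pi> where "\<pi> = (\<lambda>I. \<kappa> I * M + \<iota> I)"
  have pd: "\<pi> I div M = \<kappa> I" "\<pi> I mod M = \<iota> I" if "I < N" for I
    using r(1) [OF that] by (auto simp: \<pi>_def)
  have pl: "\<pi> I < C * M" if "I < N" for I
  proof -
    have "\<pi> I < (\<kappa> I + 1) * M" using r(1) [OF that] by (simp add: \<pi>_def)
    also have "\<dots> \<le> C * M" using r(2) [OF that] by (intro mult_le_mono1) simp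
    finally show ?thesis .
  qed
  have pinj: "inj_on \<pi> {..<N}"
    using inj pd by (intro inj_onI) (metis (mono_tags, lifting) inj_onD lessThan_iff)
  have "(\<lambda>I J. if I < N \<and> J < N \<and> \<kappa> I = \<kappa> J then x (\<iota> I) (\<iota> J) else 0)
      = (\<lambda>I J. if I < N \<and> J < N then D (\<pi> I) (\<pi> J) else 0)"
    by (auto simp: fun_eq_iff D_def pd pl)
  also have "\<dots> = mmul (osc E) N (C * M) (\<lambda>I p. if p = \<pi> I then 1 else 0) D (\<lambda>p I. if p = \<pi> I then 1 else 0)"
    using EC.mmul_select [OF D(1), of N \<pi>] pl by simp
  finally have "onorm E N (\<lambda>I J. if I < N \<and> J < N \<and> \<kappa> I = \<kappa> J then x (\<iota> I) (\<iota> J) else 0)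
      \<le> cmnorm N (C * M) (\<lambda>I p. if p = \<pi> I then 1 else 0) * onorm E (C * M) D
        * cmnorm (C * M) N (\<lambda>p I. if p = \<pi> I then 1 else 0)"
    using opspace_mmul [OF E _ N D(1)] M C by simp
  also have "\<dots> \<le> 1 * onorm E (C * M) D * 1"
    using opspace_nonneg [OF E _ D(1)] M C pinj
    by (intro mult_mono mult_nonneg_nonneg cmnorm_01_le) auto
  finally show ?thesis using D(2) by simp
qed

section \<open>The norms on the tensor product\<close>

lemma mmul_apply:
  "mmul tsc k n a w b i l \<phi> \<psi> =
    (if i < k \<and> l < k then \<Sum>p<n. \<Sum>q<n. a i p * b q l * w p q \<phi> \<psi> else 0)"
  by (simp add: mmul_def sum_apply2)

lemma mmul_mmul:
  "mmul tsc k n a (mmul tsc n j a' w b') b =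
    mmul tsc k j (\<lambda>i p. \<Sum>m<n. a i m * a' m p) w (\<lambda>q l. \<Sum>m<n. b' q m * b m l)"
proof (intro ext)
  fix i l \<phi> \<psi>
  show "mmul tsc k n a (mmul tsc n j a' w b') b i l \<phi> \<psi> =
    mmul tsc k j (\<lambda>i p. \<Sum>m<n. a i m * a' m p) w (\<lambda>q l. \<Sum>m<n. b' q m * b m l) i l \<phi> \<psi>"
  proof (cases "i < k \<and> l < k")
    case True
    let ?T = "\<lambda>m m' p q. a i m * a' m p * (b' q m' * b m' l) * w p q \<phi> \<psi>"
    have "mmul tsc k n a (mmul tsc n j a' w b') b i l \<phi> \<psi>
        = (\<Sum>m<n. \<Sum>m'<n. \<Sum>p<j. \<Sum>q<j. ?T m m' p q)"
      using True by (simp add: mmul_apply sum_distrib_left mult_ac)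
    also have "\<dots> = (\<Sum>m<n. \<Sum>p<j. \<Sum>m'<n. \<Sum>q<j. ?T m m' p q)"
      by (intro sum.cong refl sum.swap)
    also have "\<dots> = (\<Sum>p<j. \<Sum>m<n. \<Sum>m'<n. \<Sum>q<j. ?T m m' p q)"
      by (rule sum.swap)
    also have "\<dots> = (\<Sum>p<j. \<Sum>m<n. \<Sum>q<j. \<Sum>m'<n. ?T m m' p q)"
      by (intro sum.cong refl sum.swap)
    also have "\<dots> = (\<Sum>p<j. \<Sum>q<j. \<Sum>m<n. \<Sum>m'<n. ?T m m' p q)"
      by (intro sum.cong refl sum.swap)
    also have "\<dots> = mmul tsc k j (\<lambda>i p. \<Sum>m<n. a i m * a' m p) w (\<lambda>q l. \<Sum>m<n. b' q m * b m l) i l \<phi> \<psi>"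
      unfolding mmul_apply sum_product using True by (simp add: sum_distrib_right)
    finally show ?thesis .
  qed (auto simp: mmul_apply)
qed

lemma odot_map_apply:
  "odot_map \<theta> E F j v1 v2 i l \<phi> \<psi> = (if i < j \<and> l < j \<and> lfun E \<phi> \<and> lfun F \<psi> then
      complex_of_real (1 - \<theta>) * (\<Sum>m<j. \<phi> (v1 i m) * \<psi> (v2 m l)) +
      complex_of_real \<theta> * (\<Sum>m<j. \<phi> (v1 m l) * \<psi> (v2 i m)) else 0)"
  by (auto simp: odot_map_def sum_apply2 ten_apply)

lemma mmul_odot_scale:
  assumes "v1 \<in> matset j j (ocar E)" "v2 \<in> matset j j (ocar F)" "\<alpha> * c * d * \<beta> = 1"
  shows "mmul tsc k j (\<lambda>i p. \<alpha> * a i p)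
      (odot_map \<theta> E F j (\<lambda>i l. osc E c (v1 i l)) (\<lambda>i l. osc F d (v2 i l))) (\<lambda>q l. \<beta> * b q l)
    = mmul tsc k j a (odot_map \<theta> E F j v1 v2) b"
proof -
  have o: "odot_map \<theta> E F j (\<lambda>i l. osc E c (v1 i l)) (\<lambda>i l. osc F d (v2 i l)) p q \<phi> \<psi>
      = c * d * odot_map \<theta> E F j v1 v2 p q \<phi> \<psi>" for p q \<phi> \<psi>
  proof (cases "p < j \<and> q < j \<and> lfun E \<phi> \<and> lfun F \<psi>")
    case True
    have "\<phi> (osc E c (v1 i l)) = c * \<phi> (v1 i l)" "\<psi> (osc F d (v2 i l)) = d * \<psi> (v2 i l)"
      if "i < j" "l < j" for i l
      using True that matset_mem [OF assms(1)] matset_mem [OF assms(2)] by (auto simp: lfun_def)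
    then show ?thesis
      using True by (simp add: odot_map_apply sum_distrib_left algebra_simps)
  qed (auto simp: odot_map_apply)
  have eq: "\<alpha> * A * (\<beta> * B) * (c * d * w) = A * B * w" for A B w :: complex
  proof -
    have "\<alpha> * A * (\<beta> * B) * (c * d * w) = (\<alpha> * c * d * \<beta>) * (A * B * w)" by (simp add: mult_ac)
    then show ?thesis by (simp add: assms(3))
  qed
  show ?thesis by (intro ext) (simp only: mmul_apply o eq)
qed

lemma kron_eq_odot_map:
  assumes E: "opspace E" and F: "opspace F"
  shows "kron E F p q x y = odot_map \<theta> E F (p * q)
     (\<lambda>I J. if I < p * q \<and> J < p * q \<and> I mod q = J mod q then x (I div q) (J div q) else 0)
     (\<lambda>I J. if I < p * q \<and> J < p * q \<and> I div q = J div q then y (I mod q) (J mod q) else 0)"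
    (is "_ = odot_map \<theta> E F _ ?X ?Y")
proof (intro ext)
  fix I J \<phi> \<psi>
  show "kron E F p q x y I J \<phi> \<psi> = odot_map \<theta> E F (p * q) ?X ?Y I J \<phi> \<psi>"
  proof (cases "I < p * q \<and> J < p * q \<and> lfun E \<phi> \<and> lfun F \<psi>")
    case True
    then have IJ: "I < p * q" "J < p * q" by auto
    note dm = div_less_of_less_mult [OF IJ(1)] div_less_of_less_mult [OF IJ(2)]
      mod_less_of_less_mult [OF IJ(1)] mod_less_of_less_mult [OF IJ(2)]
    have z: "\<phi> 0 = 0" "\<psi> 0 = 0"
      using True E F by (auto simp: lfun_iff_linfun cvec.linfun_0 [OF opspace_cvec])
    let ?t = "\<phi> (x (I div q) (J div q)) * \<psi> (y (I mod q) (J mod q))"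
    \<comment> \<open>The middle index is forced: \<open>?Y\<close> fixes its first leg to
      \<open>J div q\<close> and \<open>?X\<close> its second to \<open>I mod q\<close>. In the
      opposite order the legs are \<open>I div q\<close> and \<open>J mod q\<close>. Either way the
      same single term survives, and the two weights add up to 1.\<close>
    have "(\<Sum>m<p * q. \<phi> (?X I m) * \<psi> (?Y m J)) = (\<Sum>m<p * q. if m div q = J div q \<and> m mod q = I mod q
        then \<phi> (x (I div q) (m div q)) * \<psi> (y (m mod q) (J mod q)) else 0)"
      using IJ by (intro sum.cong) (auto simp: z)
    also have "\<dots> = (\<Sum>\<alpha><p. \<Sum>\<beta><q. if \<alpha> = J div q \<and> \<beta> = I mod q
        then \<phi> (x (I div q) \<alpha>) * \<psi> (y \<beta> (J mod q)) else 0)"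
      by (rule sum_div_mod)
    also have "\<dots> = ?t" using dm by (simp add: sum_if_and)
    finally have 1: "(\<Sum>m<p * q. \<phi> (?X I m) * \<psi> (?Y m J)) = ?t" .
    have "(\<Sum>m<p * q. \<phi> (?X m J) * \<psi> (?Y I m)) = (\<Sum>m<p * q. if m div q = I div q \<and> m mod q = J mod q
        then \<phi> (x (m div q) (J div q)) * \<psi> (y (I mod q) (m mod q)) else 0)"
      using IJ by (intro sum.cong) (auto simp: z)
    also have "\<dots> = (\<Sum>\<alpha><p. \<Sum>\<beta><q. if \<alpha> = I div q \<and> \<beta> = J mod q
        then \<phi> (x \<alpha> (J div q)) * \<psi> (y (I mod q) \<beta>) else 0)"
      by (rule sum_div_mod)
    also have "\<dots> = ?t" using dm by (simp add: sum_if_and)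
    finally have 2: "(\<Sum>m<p * q. \<phi> (?X m J) * \<psi> (?Y I m)) = ?t" .
    have "odot_map \<theta> E F (p * q) ?X ?Y I J \<phi> \<psi>
        = complex_of_real (1 - \<theta>) * ?t + complex_of_real \<theta> * ?t"
      unfolding odot_map_apply 1 2 using True by simp
    also have "\<dots> = ?t" by (simp add: algebra_simps)
    finally show ?thesis using True by (simp add: kron_def ten_apply)
  next
    case False
    then show ?thesis by (auto simp: kron_def odot_map_apply ten_apply)
  qed
qed

lemma less_add_cases:
  fixes i k k' :: nat
  assumes "i < k + k'"
  obtains "i < k" | i' where "i = k + i'" "i' < k'"
  using assms by (metis le_Suc_ex nat_add_left_cancel_less not_le)

lemma mmul_dsum:
  "mmul tsc (k + k') (j + j') (rdsum k j a a') (dsum j j' w w') (rdsum j k b b')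
    = dsum k k' (mmul tsc k j a w b) (mmul tsc k' j' a' w' b')"
proof (intro ext)
  fix i l \<phi> \<psi>
  show "mmul tsc (k + k') (j + j') (rdsum k j a a') (dsum j j' w w') (rdsum j k b b') i l \<phi> \<psi>
    = dsum k k' (mmul tsc k j a w b) (mmul tsc k' j' a' w' b') i l \<phi> \<psi>"
  proof (cases "i < k + k' \<and> l < k + k'")
    case False
    then show ?thesis by (auto simp: mmul_apply dsum_def)
  next
    case True
    then have "i < k + k'" "l < k + k'" by auto
    then show ?thesis
      by (elim less_add_cases) (simp_all add: mmul_apply sum_lessThan_add rdsum_simps dsum_simps)
  qed
qed

lemma odot_map_dsum:
  assumes E: "opspace E" and F: "opspace F"
  shows "odot_map \<theta> E F (j + j') (dsum j j' v1 w1) (dsum j j' v2 w2)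
    = dsum j j' (odot_map \<theta> E F j v1 v2) (odot_map \<theta> E F j' w1 w2)"
proof (intro ext)
  fix i l \<phi> \<psi>
  show "odot_map \<theta> E F (j + j') (dsum j j' v1 w1) (dsum j j' v2 w2) i l \<phi> \<psi>
    = dsum j j' (odot_map \<theta> E F j v1 v2) (odot_map \<theta> E F j' w1 w2) i l \<phi> \<psi>"
  proof (cases "i < j + j' \<and> l < j + j' \<and> lfun E \<phi> \<and> lfun F \<psi>")
    case True
    then have z: "\<phi> 0 = 0" "\<psi> 0 = 0"
      using E F by (auto simp: lfun_iff_linfun cvec.linfun_0 [OF opspace_cvec])
    have lf: "lfun E \<phi>" "lfun F \<psi>" and "i < j + j'" "l < j + j'" using True by auto
    then show ?thesis
      by (elim less_add_cases) (simp_all add: odot_map_apply sum_lessThan_add dsum_simps z)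
  next
    case False
    then have 1: "odot_map \<theta> E F (j + j') (dsum j j' v1 w1) (dsum j j' v2 w2) i l \<phi> \<psi> = 0"
      by (simp only: odot_map_apply) auto
    consider "\<not> (i < j + j' \<and> l < j + j')" | "\<not> (lfun E \<phi> \<and> lfun F \<psi>)" using False by blast
    then have "dsum j j' (odot_map \<theta> E F j v1 v2) (odot_map \<theta> E F j' w1 w2) i l \<phi> \<psi> = 0"
    proof cases
      case 1
      then have "dsum j j' (odot_map \<theta> E F j v1 v2) (odot_map \<theta> E F j' w1 w2) i l = 0"
        unfolding dsum_def by auto
      then show ?thesis by simp
    next
      case 2
      then have "odot_map \<theta> E F n v w i l \<phi> \<psi> = 0" for n v w i l
        by (simp only: odot_map_apply) auto
      then show ?thesis unfolding dsum_def by simp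
    qed
    then show ?thesis using 1 by simp
  qed
qed

text \<open>Rescaling divides by norms that may vanish. A small increase makes all four factors
  positive, and by continuity their product stays below \<open>r\<close>.\<close>

lemma four_factor_slack:
  fixes A B C D r :: real
  assumes "A * B * C * D < r"
  obtains e where "0 < e" "(A + e) * (B + e) * (C + e) * (D + e) < r"
proof -
  have "((\<lambda>e. (A + e) * (B + e) * (C + e) * (D + e)) \<longlongrightarrow> (A + 0) * (B + 0) * (C + 0) * (D + 0)) (at_right 0)"
    by (intro tendsto_intros)
  then have "\<forall>\<^sub>F e in at_right 0. (A + e) * (B + e) * (C + e) * (D + e) < r"
    using assms by (intro order_tendstoD(2)) auto
  moreover have "\<forall>\<^sub>F e in at_right (0::real). 0 < e"
    by (rule eventually_at_right_less)
  ultimately have "\<forall>\<^sub>F e in at_right 0. 0 < e \<and> (A + e) * (B + e) * (C + e) * (D + e) < r"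
    by eventually_elim simp
  then show thesis
    using that eventually_happens' [OF trivial_limit_at_right_real] by blast
qed

text \<open>The infimum need not be attained, so estimates are proved for every \<open>r\<close>
  above it and then passed to the limit.\<close>

lemma le_mult_of_gt:
  fixes c x y :: real
  assumes "0 \<le> c" "\<And>r. x < r \<Longrightarrow> y \<le> c * r"
  shows "y \<le> c * x"
proof (cases "c = 0")
  case True
  then show ?thesis using assms(2) [of "x + 1"] by simp
next
  case False
  then have c: "0 < c" using assms(1) by simp
  have "y / c \<le> x" by (rule dense_ge) (use assms(2) c in \<open>simp add: field_simps\<close>)
  then show ?thesis using c by (simp add: field_simps)
qed

section \<open>Decompositions and upper bounds for the tensor norm\<close>

locale odot_setup =
  fixes \<theta> :: real and E :: "'e::ab_group_add ospace" and F :: "'f::ab_group_add ospace"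
  assumes E: "opspace E" and F: "opspace F"
begin

sublocale EC: cvec "osc E" "ocar E" by (rule opspace_cvec [OF E])
sublocale FC: cvec "osc F" "ocar F" by (rule opspace_cvec [OF F])
sublocale TC: cvec tsc "tspace E F" by (rule tspace_cvec [OF E F])

definition costs :: "nat \<Rightarrow> ('e, 'f) tens mat \<Rightarrow> real set" where
  "costs k u = {cmnorm k j a * onorm E j v1 * onorm F j v2 * cmnorm j k b
      | j a v1 v2 b. 1 \<le> j \<and> v1 \<in> matset j j (ocar E) \<and> v2 \<in> matset j j (ocar F) \<and>
          u = mmul tsc k j a (odot_map \<theta> E F j v1 v2) b}"

lemma costs_I:
  assumes "1 \<le> j" "v1 \<in> matset j j (ocar E)" "v2 \<in> matset j j (ocar F)"
    and "u = mmul tsc k j a (odot_map \<theta> E F j v1 v2) b"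
  shows "cmnorm k j a * onorm E j v1 * onorm F j v2 * cmnorm j k b \<in> costs k u"
  unfolding costs_def mem_Collect_eq by (intro exI conjI) (rule refl assms)+

lemma odot_norm_costs: "odot_norm \<theta> E F k u = Inf (costs k u)"
  by (simp add: odot_norm_def costs_def)

lemma costs_nonneg: "c \<in> costs k u \<Longrightarrow> 0 \<le> c"
  unfolding costs_def by (auto intro!: mult_nonneg_nonneg opspace_nonneg E F)

lemma costs_bdd: "bdd_below (costs k u)"
  using costs_nonneg by (rule bdd_belowI)

lemma odot_norm_le:
  assumes "1 \<le> j" "v1 \<in> matset j j (ocar E)" "v2 \<in> matset j j (ocar F)"
    and "cmnorm k j a \<le> \<alpha>" "onorm E j v1 \<le> c" "onorm F j v2 \<le> d" "cmnorm j k b \<le> \<beta>"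
  shows "odot_norm \<theta> E F k (mmul tsc k j a (odot_map \<theta> E F j v1 v2) b) \<le> \<alpha> * c * d * \<beta>"
proof -
  have nn: "0 \<le> onorm E j v1" "0 \<le> onorm F j v2"
    using assms by (auto intro: opspace_nonneg E F)
  have nn': "0 \<le> \<alpha>" "0 \<le> c" "0 \<le> d"
    using assms(4-6) nn cmnorm_nonneg [of k j a] by linarith+
  have "odot_norm \<theta> E F k (mmul tsc k j a (odot_map \<theta> E F j v1 v2) b)
      \<le> cmnorm k j a * onorm E j v1 * onorm F j v2 * cmnorm j k b"
    unfolding odot_norm_costs by (rule cInf_lower [OF costs_I costs_bdd]) (rule refl assms)+
  also have "\<dots> \<le> \<alpha> * c * d * \<beta>"
    using assms nn nn' by (intro mult_mono mult_nonneg_nonneg) auto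
  finally show ?thesis .
qed

lemma kron_factors:
  assumes p: "1 \<le> p" and q: "1 \<le> q" and x: "x \<in> matset p p (ocar E)" and y: "y \<in> matset q q (ocar F)"
  obtains v1 v2 where "v1 \<in> matset (p * q) (p * q) (ocar E)" "v2 \<in> matset (p * q) (p * q) (ocar F)"
    "onorm E (p * q) v1 \<le> onorm E p x" "onorm F (p * q) v2 \<le> onorm F q y"
    "kron E F p q x y = odot_map \<theta> E F (p * q) v1 v2"
proof
  let ?X = "\<lambda>I J. if I < p * q \<and> J < p * q \<and> I mod q = J mod q then x (I div q) (J div q) else 0"
  let ?Y = "\<lambda>I J. if I < p * q \<and> J < p * q \<and> I div q = J div q then y (I mod q) (J mod q) else 0"
  have pq: "1 \<le> p * q" using p q by simp
  show "?X \<in> matset (p * q) (p * q) (ocar E)" "?Y \<in> matset (p * q) (p * q) (ocar F)"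
    using matset_mem' [OF x] matset_mem' [OF y] by (auto simp: matset_def)
  show "onorm E (p * q) ?X \<le> onorm E p x"
    by (rule opspace_ampl_le [OF E x p pq q])
      (auto simp: inj_on_def mod_less_of_less_mult div_less_of_less_mult, metis div_mult_mod_eq)
  show "onorm F (p * q) ?Y \<le> onorm F q y"
    by (rule opspace_ampl_le [OF F y q pq p])
      (auto simp: inj_on_def mod_less_of_less_mult div_less_of_less_mult, metis div_mult_mod_eq)
  show "kron E F p q x y = odot_map \<theta> E F (p * q) ?X ?Y"
    by (rule kron_eq_odot_map [OF E F])
qed

text \<open>Needed for \<open>Inf\<close> to carry information; a projective decomposition is turned
  into one of the required form.\<close>

lemma costs_nonempty:
  assumes "1 \<le> k" "u \<in> matset k k (tspace E F)"
  shows "costs k u \<noteq> {}"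
proof -
  obtain p q a x y b where pq: "1 \<le> p" "1 \<le> q" "x \<in> matset p p (ocar E)" "y \<in> matset q q (ocar F)"
    "u = mmul tsc k (p * q) a (kron E F p q x y) b"
    by (rule proj_decomposition_exists [OF E F assms(2,1)])
  obtain v1 v2 where v: "v1 \<in> matset (p * q) (p * q) (ocar E)" "v2 \<in> matset (p * q) (p * q) (ocar F)"
    "kron E F p q x y = odot_map \<theta> E F (p * q) v1 v2"
    by (rule kron_factors [OF pq(1-4)])
  have "1 \<le> p * q" using pq by simp
  then have "cmnorm k (p * q) a * onorm E (p * q) v1 * onorm F (p * q) v2 * cmnorm (p * q) k b \<in> costs k u"
    using v pq by (intro costs_I) auto
  then show ?thesis by blast
qed

lemma odot_norm_nonneg:
  assumes "1 \<le> k" "u \<in> matset k k (tspace E F)"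
  shows "0 \<le> odot_norm \<theta> E F k u"
  unfolding odot_norm_costs by (rule cInf_greatest [OF costs_nonempty [OF assms] costs_nonneg])

lemma odot_norm_le_proj_norm:
  assumes k: "1 \<le> k" and u: "u \<in> matset k k (tspace E F)"
  shows "odot_norm \<theta> E F k u \<le> proj_norm E F k u"
  unfolding proj_norm_def
proof (rule cInf_greatest)
  obtain p q a x y b where pq: "1 \<le> p" "1 \<le> q" "x \<in> matset p p (ocar E)" "y \<in> matset q q (ocar F)"
    "u = mmul tsc k (p * q) a (kron E F p q x y) b"
    by (rule proj_decomposition_exists [OF E F u k])
  then show "{cmnorm k (p * q) a * onorm E p x * onorm F q y * cmnorm (p * q) k b
      | p q a x y b. 1 \<le> p \<and> 1 \<le> q \<and> x \<in> matset p p (ocar E) \<and> y \<in> matset q q (ocar F) \<and>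
          u = mmul tsc k (p * q) a (kron E F p q x y) b} \<noteq> {}" by blast
next
  fix c assume "c \<in> {cmnorm k (p * q) a * onorm E p x * onorm F q y * cmnorm (p * q) k b
      | p q a x y b. 1 \<le> p \<and> 1 \<le> q \<and> x \<in> matset p p (ocar E) \<and> y \<in> matset q q (ocar F) \<and>
          u = mmul tsc k (p * q) a (kron E F p q x y) b}"
  then obtain p q a x y b where c: "c = cmnorm k (p * q) a * onorm E p x * onorm F q y * cmnorm (p * q) k b"
    and pq: "1 \<le> p" "1 \<le> q" "x \<in> matset p p (ocar E)" "y \<in> matset q q (ocar F)"
    and u: "u = mmul tsc k (p * q) a (kron E F p q x y) b" by blast
  obtain v1 v2 where v: "v1 \<in> matset (p * q) (p * q) (ocar E)" "v2 \<in> matset (p * q) (p * q) (ocar F)"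
    "onorm E (p * q) v1 \<le> onorm E p x" "onorm F (p * q) v2 \<le> onorm F q y"
    "kron E F p q x y = odot_map \<theta> E F (p * q) v1 v2"
    by (rule kron_factors [OF pq])
  show "odot_norm \<theta> E F k u \<le> c"
    unfolding u v(5) c using pq v by (intro odot_norm_le) auto
qed

text \<open>This is the form in which the infimum is used throughout. Each of the four factors has a
  bound that depends on \<open>r\<close> only, so decompositions of different matrices can be
  combined.\<close>

lemma balanced_decomposition:
  assumes k: "1 \<le> k" and u: "u \<in> matset k k (tspace E F)" and r: "odot_norm \<theta> E F k u < r"
  obtains j a v1 v2 b where "1 \<le> j" "v1 \<in> matset j j (ocar E)" "v2 \<in> matset j j (ocar F)"
    "u = mmul tsc k j a (odot_map \<theta> E F j v1 v2) b"
    "onorm E j v1 \<le> 1" "onorm F j v2 \<le> 1" "cmnorm k j a \<le> sqrt r" "cmnorm j k b \<le> sqrt r"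
proof -
  obtain c' where c': "c' \<in> costs k u" "c' < r"
    using cInf_lessD [OF costs_nonempty [OF k u]] r unfolding odot_norm_costs by blast
  from c'(1) obtain j a v1 v2 b where
    *: "c' = cmnorm k j a * onorm E j v1 * onorm F j v2 * cmnorm j k b \<and> 1 \<le> j \<and>
      v1 \<in> matset j j (ocar E) \<and> v2 \<in> matset j j (ocar F) \<and>
      u = mmul tsc k j a (odot_map \<theta> E F j v1 v2) b"
    unfolding costs_def mem_Collect_eq by (elim exE)
  with c'(2) have j: "1 \<le> j" and v: "v1 \<in> matset j j (ocar E)" "v2 \<in> matset j j (ocar F)"
    and u: "u = mmul tsc k j a (odot_map \<theta> E F j v1 v2) b"
    and c: "cmnorm k j a * onorm E j v1 * onorm F j v2 * cmnorm j k b < r"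
    by simp_all
  obtain e where e: "0 < e" and er: "(cmnorm k j a + e) * (onorm E j v1 + e) * (onorm F j v2 + e) * (cmnorm j k b + e) < r"
    by (rule four_factor_slack [OF c])
  define A where "A = cmnorm k j a + e"
  define C where "C = onorm E j v1 + e"
  define D where "D = onorm F j v2 + e"
  define B where "B = cmnorm j k b + e"
  have nn: "0 \<le> onorm E j v1" "0 \<le> onorm F j v2"
    using j v by (auto intro: opspace_nonneg E F)
  have pos: "0 < A" "0 < B" "0 < C" "0 < D"
    using e nn by (simp_all add: A_def B_def C_def D_def add_nonneg_pos)
  have nCD: "onorm E j v1 \<le> C" "onorm F j v2 \<le> D" using e by (simp_all add: C_def D_def)
  \<comment> \<open>Dividing the middle factors by \<open>C\<close> and \<open>D\<close> has to be
    compensated by \<alpha> \<beta> = C D. Subject to this, \<alpha> and \<beta> are chosen to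
    balance the outer factors: \<alpha> A = \<beta> B = sqrt (A B C D).\<close>
  define \<alpha> where "\<alpha> = sqrt (C * D * B / A)"
  define \<beta> where "\<beta> = sqrt (C * D * A / B)"
  have "\<alpha> * \<beta> = sqrt ((C * D) * (C * D))"
    unfolding \<alpha>_def \<beta>_def real_sqrt_mult [symmetric] using pos by (simp add: field_simps)
  then have ab: "\<alpha> * \<beta> = C * D" using pos by simp
  have one: "complex_of_real \<alpha> * complex_of_real (1 / C) * complex_of_real (1 / D) * complex_of_real \<beta> = 1"
  proof -
    have "\<alpha> * (1 / C) * (1 / D) * \<beta> = (\<alpha> * \<beta>) * (1 / C) * (1 / D)" by (simp add: mult_ac)
    also have "\<dots> = 1" unfolding ab using pos by simp
    finally have "complex_of_real (\<alpha> * (1 / C) * (1 / D) * \<beta>) = 1" by (simp only: of_real_1)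
    then show ?thesis by (simp only: of_real_mult)
  qed
  have sc: "t * sqrt (x / t) = sqrt (x * t)" if "0 < t" for x t :: real
  proof -
    have "t * sqrt (x / t) = sqrt (t\<^sup>2) * sqrt (x / t)" using that by simp
    also have "\<dots> = sqrt (x * t)" using that
      by (simp only: real_sqrt_mult [symmetric]) (simp add: power2_eq_square)
    finally show ?thesis .
  qed
  have le: "C * D * B * A \<le> r" "C * D * A * B \<le> r"
    using er by (auto simp: A_def B_def C_def D_def mult_ac)
  show thesis
  proof (rule that)
    show "u = mmul tsc k j (\<lambda>i p. complex_of_real \<alpha> * a i p)
      (odot_map \<theta> E F j (\<lambda>i l. osc E (complex_of_real (1 / C)) (v1 i l))
        (\<lambda>i l. osc F (complex_of_real (1 / D)) (v2 i l))) (\<lambda>q l. complex_of_real \<beta> * b q l)"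
      unfolding u by (rule mmul_odot_scale [OF v one, symmetric])
    show "1 \<le> j" by (rule j)
    show "(\<lambda>i l. osc E (complex_of_real (1 / C)) (v1 i l)) \<in> matset j j (ocar E)"
      "(\<lambda>i l. osc F (complex_of_real (1 / D)) (v2 i l)) \<in> matset j j (ocar F)"
      using v by (auto intro: EC.scale_matset FC.scale_matset)
    show "onorm E j (\<lambda>i l. osc E (complex_of_real (1 / C)) (v1 i l)) \<le> 1"
      unfolding opspace_scale [OF E j v(1)] using pos nCD by (simp add: norm_divide)
    show "onorm F j (\<lambda>i l. osc F (complex_of_real (1 / D)) (v2 i l)) \<le> 1"
      unfolding opspace_scale [OF F j v(2)] using pos nCD by (simp add: norm_divide)
    have "cmnorm k j (\<lambda>i p. complex_of_real \<alpha> * a i p) \<le> \<alpha> * cmnorm k j a"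
      using cmnorm_scale_le [of k j "complex_of_real \<alpha>" a] pos by (simp add: \<alpha>_def)
    also have "\<dots> \<le> \<alpha> * A" using e pos by (intro mult_left_mono) (auto simp: A_def \<alpha>_def)
    also have "\<dots> = sqrt (C * D * B * A)" using sc [OF pos(1), of "C * D * B"] by (simp add: \<alpha>_def mult.commute)
    also have "\<dots> \<le> sqrt r" using le by simp
    finally show "cmnorm k j (\<lambda>i p. complex_of_real \<alpha> * a i p) \<le> sqrt r" .
    have "cmnorm j k (\<lambda>i p. complex_of_real \<beta> * b i p) \<le> \<beta> * cmnorm j k b"
      using cmnorm_scale_le [of j k "complex_of_real \<beta>" b] pos by (simp add: \<beta>_def)
    also have "\<dots> \<le> \<beta> * B" using e pos by (intro mult_left_mono) (auto simp: B_def \<beta>_def)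
    also have "\<dots> = sqrt (C * D * A * B)" using sc [OF pos(2), of "C * D * A"] by (simp add: \<beta>_def mult.commute)
    also have "\<dots> \<le> sqrt r" using le by simp
    finally show "cmnorm j k (\<lambda>q l. complex_of_real \<beta> * b q l) \<le> sqrt r" .
  qed
qed

text \<open>The outer coefficients are absorbed into those of a decomposition at the price of their
  operator norms, while \<open>v1\<close> and \<open>v2\<close> stay the same.\<close>

lemma odot_norm_mmul:
  assumes n: "1 \<le> n" and k: "1 \<le> k" and u: "u \<in> matset n n (tspace E F)"
  shows "odot_norm \<theta> E F k (mmul tsc k n a u b) \<le> cmnorm k n a * odot_norm \<theta> E F n u * cmnorm n k b"
proof -
  have "odot_norm \<theta> E F k (mmul tsc k n a u b) \<le> cmnorm k n a * cmnorm n k b * r"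
    if r: "odot_norm \<theta> E F n u < r" for r
  proof -
    obtain j a' v1 v2 b' where j: "1 \<le> j" and v: "v1 \<in> matset j j (ocar E)" "v2 \<in> matset j j (ocar F)"
      and uv: "u = mmul tsc n j a' (odot_map \<theta> E F j v1 v2) b'"
      and nv: "onorm E j v1 \<le> 1" "onorm F j v2 \<le> 1" and ab: "cmnorm n j a' \<le> sqrt r" "cmnorm j n b' \<le> sqrt r"
      by (rule balanced_decomposition [OF n u r])
    have r0: "0 \<le> r" using odot_norm_nonneg [OF n u] r by simp
    have "odot_norm \<theta> E F k (mmul tsc k n a u b) \<le> (cmnorm k n a * sqrt r) * 1 * 1 * (sqrt r * cmnorm n k b)"
      unfolding uv mmul_mmul
    proof (intro odot_norm_le j v nv)
      show "cmnorm k j (\<lambda>i p. \<Sum>m<n. a i m * a' m p) \<le> cmnorm k n a * sqrt r"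
        by (rule order_trans [OF cmnorm_compose]) (use ab in \<open>simp add: mult_left_mono\<close>)
      show "cmnorm j k (\<lambda>q l. \<Sum>m<n. b' q m * b m l) \<le> sqrt r * cmnorm n k b"
        by (rule order_trans [OF cmnorm_compose]) (use ab in \<open>simp add: mult_right_mono\<close>)
    qed
    also have "\<dots> = cmnorm k n a * cmnorm n k b * r"
      using r0 mult.assoc [of "cmnorm k n a" "sqrt r" "sqrt r"] by simp
    finally show ?thesis .
  qed
  then have "odot_norm \<theta> E F k (mmul tsc k n a u b) \<le> cmnorm k n a * cmnorm n k b * odot_norm \<theta> E F n u"
    by (rule le_mult_of_gt [rotated]) simp_all
  then show ?thesis by (simp add: mult_ac)
qed

text \<open>Both decompositions are balanced for the same \<open>r\<close>, so the maxima arising in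
  the four direct sums obey the same bounds 1 and \<open>sqrt r\<close> as before, and the product
  is again at most \<open>r\<close>.\<close>

lemma odot_norm_dsum_le:
  assumes k: "1 \<le> k" and k': "1 \<le> k'" and u: "u \<in> matset k k (tspace E F)" and w: "w \<in> matset k' k' (tspace E F)"
  shows "odot_norm \<theta> E F (k + k') (dsum k k' u w) \<le> max (odot_norm \<theta> E F k u) (odot_norm \<theta> E F k' w)"
proof (rule dense_ge)
  fix r assume r: "max (odot_norm \<theta> E F k u) (odot_norm \<theta> E F k' w) < r"
  obtain j a v1 v2 b where j: "1 \<le> j" and v: "v1 \<in> matset j j (ocar E)" "v2 \<in> matset j j (ocar F)"
    and uv: "u = mmul tsc k j a (odot_map \<theta> E F j v1 v2) b"
    and nv: "onorm E j v1 \<le> 1" "onorm F j v2 \<le> 1" and ab: "cmnorm k j a \<le> sqrt r" "cmnorm j k b \<le> sqrt r"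
    by (rule balanced_decomposition [OF k u, of r]) (use r in auto)
  obtain j' a' w1 w2 b' where j': "1 \<le> j'" and w12: "w1 \<in> matset j' j' (ocar E)" "w2 \<in> matset j' j' (ocar F)"
    and uw: "w = mmul tsc k' j' a' (odot_map \<theta> E F j' w1 w2) b'"
    and nw: "onorm E j' w1 \<le> 1" "onorm F j' w2 \<le> 1" and ab': "cmnorm k' j' a' \<le> sqrt r" "cmnorm j' k' b' \<le> sqrt r"
    by (rule balanced_decomposition [OF k' w, of r]) (use r in auto)
  have r0: "0 \<le> r" using odot_norm_nonneg [OF k u] r by simp
  have "odot_norm \<theta> E F (k + k') (mmul tsc (k + k') (j + j') (rdsum k j a a')
      (odot_map \<theta> E F (j + j') (dsum j j' v1 w1) (dsum j j' v2 w2)) (rdsum j k b b'))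
    \<le> sqrt r * 1 * 1 * sqrt r"
  proof (rule odot_norm_le)
    show "1 \<le> j + j'" using j by simp
    show "dsum j j' v1 w1 \<in> matset (j + j') (j + j') (ocar E)"
      "dsum j j' v2 w2 \<in> matset (j + j') (j + j') (ocar F)"
      using v w12 by (auto intro: dsum_matset)
    show "cmnorm (k + k') (j + j') (rdsum k j a a') \<le> sqrt r"
      by (rule order_trans [OF cmnorm_rdsum_le]) (simp add: ab ab')
    show "cmnorm (j + j') (k + k') (rdsum j k b b') \<le> sqrt r"
      by (rule order_trans [OF cmnorm_rdsum_le]) (simp add: ab ab')
    show "onorm E (j + j') (dsum j j' v1 w1) \<le> 1"
      unfolding opspace_dsum [OF E j j' v(1) w12(1)] using nv nw by simp
    show "onorm F (j + j') (dsum j j' v2 w2) \<le> 1"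
      unfolding opspace_dsum [OF F j j' v(2) w12(2)] using nv nw by simp
  qed
  moreover have "dsum k k' u w = mmul tsc (k + k') (j + j') (rdsum k j a a')
      (odot_map \<theta> E F (j + j') (dsum j j' v1 w1) (dsum j j' v2 w2)) (rdsum j k b b')"
    by (simp only: uv uw odot_map_dsum [OF E F] mmul_dsum)
  ultimately show "odot_norm \<theta> E F (k + k') (dsum k k' u w) \<le> r" using r0 by simp
qed

end

section \<open>Slice functionals and definiteness\<close>

lemma idx_eqI:
  fixes I J P q :: nat
  assumes "I div P = J div P" "I mod P div q = J mod P div q" "I mod P mod q = J mod P mod q"
  shows "I = J"
  by (metis assms div_mult_mod_eq)

text \<open>An index \<open>K < j(pq)\<close> encodes a triple \<open>(m, \<alpha>, \<gamma>)\<close> with \<open>\<alpha> < p\<close> and \<open>\<gamma> < q\<close>.\<close>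
lemma sum_triple_index:
  fixes h :: "nat \<Rightarrow> complex"
  assumes "\<alpha>0 < p" "\<gamma>0 < q"
  shows "(\<Sum>K<j*(p*q). if K mod (p*q) div q = \<alpha>0 \<and> K mod (p*q) mod q = \<gamma>0
      then h (K div (p*q)) else 0) = (\<Sum>m<j. h m)"
proof -
  have "(\<Sum>K<j*(p*q). if K mod (p*q) div q = \<alpha>0 \<and> K mod (p*q) mod q = \<gamma>0
      then h (K div (p*q)) else 0)
      = (\<Sum>m<j. \<Sum>c<p*q. if c div q = \<alpha>0 \<and> c mod q = \<gamma>0 then h m else 0)"
    by (rule sum_div_mod [where f = "\<lambda>m c. if c div q = \<alpha>0 \<and> c mod q = \<gamma>0 then h m else 0"])
  also have "\<dots> = (\<Sum>m<j. \<Sum>\<alpha><p. \<Sum>\<gamma><q. if \<alpha> = \<alpha>0 \<and> \<gamma> = \<gamma>0 then h m else 0)"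
    by (intro sum.cong refl sum_div_mod)
  also have "\<dots> = (\<Sum>m<j. h m)"
    using assms by (simp add: sum_if_and)
  finally show ?thesis .
qed

section \<open>Lower bounds from pairs of matrix-valued maps\<close>

context odot_setup
begin

text \<open>With \<open>F1 = f(v\<^sub>1)\<close> acting on the legs \<open>(j, p)\<close> and \<open>G1 = g(v\<^sub>2)\<close> on the legs \<open>(j, q)\<close>, the image of
  \<open>u = a (v\<^sub>1 \<odot> v\<^sub>2) b\<close> is \<open>(a \<otimes> 1) ((1 - \<theta>) F1 G1 + \<theta> G1 F1) (b \<otimes> 1)\<close>.\<close>
lemma odot_norm_functional_bound:
  assumes \<theta>: "0 \<le> \<theta>" "\<theta> \<le> 1" and p: "1 \<le> p" and q: "1 \<le> q" and n: "1 \<le> n"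
    and u: "u \<in> matset n n (tspace E F)"
    and f: "\<And>\<alpha> \<beta>. lfun E (\<lambda>x. f x \<alpha> \<beta>)" and g: "\<And>\<alpha> \<beta>. lfun F (\<lambda>x. g x \<alpha> \<beta>)"
    and c: "0 \<le> c" "\<And>n v. 1 \<le> n \<Longrightarrow> v \<in> matset n n (ocar E) \<Longrightarrow>
      cmnorm (n * p) (n * p) (blk p (amp n f v)) \<le> c * onorm E n v"
    and d: "0 \<le> d" "\<And>n v. 1 \<le> n \<Longrightarrow> v \<in> matset n n (ocar F) \<Longrightarrow>
      cmnorm (n * q) (n * q) (blk q (amp n g v)) \<le> d * onorm F n v"
  shows "cmnorm (n * (p * q)) (n * (p * q)) (blk (p * q) (amp n (tfg p q f g) u)) \<le> c * d * odot_norm \<theta> E F n u"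
proof (rule le_mult_of_gt)
  show "0 \<le> c * d" using c(1) d(1) by simp
  fix r assume r: "odot_norm \<theta> E F n u < r"
  obtain j a v1 v2 b where j: "1 \<le> j" and v: "v1 \<in> matset j j (ocar E)" "v2 \<in> matset j j (ocar F)"
    and uv: "u = mmul tsc n j a (odot_map \<theta> E F j v1 v2) b"
    and nv: "onorm E j v1 \<le> 1" "onorm F j v2 \<le> 1" and ab: "cmnorm n j a \<le> sqrt r" "cmnorm j n b \<le> sqrt r"
    by (rule balanced_decomposition [OF n u r])
  have r0: "0 \<le> r" using odot_norm_nonneg [OF n u] r by simp
  define P where "P = p * q"
  have P: "0 < P" using p q by (simp add: P_def)
  \<comment> \<open>An index \<open>I\<close> codes three legs: \<open>I div P\<close> of size n or
    j, \<open>I mod P div q\<close> of size p and \<open>I mod P mod q\<close> of size q. For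
    in-range indices, \<open>\<Omega> s t c d\<close> is the entry at ((s, c), (t, d)) of the image
    of \<open>odot_map\<close> under f \<otimes> g.\<close>
  define \<Omega> where "\<Omega> = (\<lambda>s t c d. odot_map \<theta> E F j v1 v2 s t
    (\<lambda>x. f x (c div q) (d div q)) (\<lambda>y. g y (c mod q) (d mod q)))"
  define A1 where "A1 = (\<lambda>I L. if I mod P = L mod P then a (I div P) (L div P) else 0)"
  define B1 where "B1 = (\<lambda>I L. if I mod P = L mod P then b (I div P) (L div P) else 0)"
  define F1 where "F1 = (\<lambda>I L. if I mod P mod q = L mod P mod q
    then f (v1 (I div P) (L div P)) (I mod P div q) (L mod P div q) else 0)"
  define G1 where "G1 = (\<lambda>I L. if I mod P div q = L mod P div q
    then g (v2 (I div P) (L div P)) (I mod P mod q) (L mod P mod q) else 0)"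
  define W where "W = (\<lambda>L M. \<Omega> (L div P) (M div P) (L mod P) (M mod P))"
  have modP: "K mod P div q < p" "K mod P mod q < q" for K
  proof -
    have "K mod P < p * q" using P by (simp add: P_def)
    then show "K mod P div q < p" "K mod P mod q < q"
      by (auto intro: div_less_of_less_mult mod_less_of_less_mult)
  qed
  have modinj: "inj_on (\<lambda>I. (I mod P, I div P)) A" for A
    by (rule inj_onI) (metis Pair_inject div_mult_mod_eq)
  have nA: "cmnorm (n * P) (j * P) A1 \<le> sqrt r"
    by (rule order_trans [OF cmnorm_ampl_le [where \<kappa> = "\<lambda>I. I mod P" and \<kappa>' = "\<lambda>I. I mod P"
          and \<iota> = "\<lambda>I. I div P" and \<iota>' = "\<lambda>I. I div P" and X = a] ab(1)])
      (auto simp: modinj A1_def div_less_of_less_mult)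
  have nB: "cmnorm (j * P) (n * P) B1 \<le> sqrt r"
    by (rule order_trans [OF cmnorm_ampl_le [where \<kappa> = "\<lambda>I. I mod P" and \<kappa>' = "\<lambda>I. I mod P"
          and \<iota> = "\<lambda>I. I div P" and \<iota>' = "\<lambda>I. I div P" and X = b] ab(2)])
      (auto simp: modinj B1_def div_less_of_less_mult)
  have \<iota>: "i * m + l < j * m" if "i < j" "l < m" for i l m :: nat
  proof -
    have "i * m + l < Suc i * m" using that by simp
    also have "\<dots> \<le> j * m" using that by (intro mult_le_mono1) simp
    finally show ?thesis .
  qed
  have nF: "cmnorm (j * P) (j * P) F1 \<le> c"
  proof -
    \<comment> \<open>\<open>F1\<close> is the identity on the q-leg, which labels the copies; the
      j-leg and the p-leg together give the index inside \<open>blk p (amp j f v1)\<close>.\<close>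
    let ?\<iota> = "\<lambda>I. I div P * p + I mod P div q"
    have dm: "?\<iota> I div p = I div P" "?\<iota> I mod p = I mod P div q" for I
      using modP(1) [of I] by auto
    have inj: "inj_on (\<lambda>I. (I mod P mod q, ?\<iota> I)) A" for A
    proof (rule inj_onI)
      fix I J assume "(I mod P mod q, ?\<iota> I) = (J mod P mod q, ?\<iota> J)"
      then have e: "I mod P mod q = J mod P mod q" "?\<iota> I = ?\<iota> J" by simp_all
      show "I = J"
        by (rule idx_eqI [OF _ _ e(1)]) (use dm e(2) in metis)+
    qed
    have "cmnorm (j * P) (j * P) F1 \<le> cmnorm (j * p) (j * p) (blk p (amp j f v1))"
    proof (rule cmnorm_ampl_le [OF inj inj])
      fix I assume "I < j * P"
      then show "?\<iota> I < j * p" by (intro \<iota> div_less_of_less_mult modP)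
    next
      fix I assume "I < j * P"
      then show "?\<iota> I < j * p" by (intro \<iota> div_less_of_less_mult modP)
    next
      fix I J assume "I < j * P" "J < j * P"
      then show "F1 I J = (if I mod P mod q = J mod P mod q
          then blk p (amp j f v1) (?\<iota> I) (?\<iota> J) else 0)"
        unfolding blk_def dm by (simp add: F1_def amp_def div_less_of_less_mult)
    qed
    also have "\<dots> \<le> c * onorm E j v1" by (rule c(2) [OF j v(1)])
    also have "\<dots> \<le> c" using nv(1) c(1) by (simp add: mult_left_le)
    finally show ?thesis .
  qed
  have nG: "cmnorm (j * P) (j * P) G1 \<le> d"
  proof -
    \<comment> \<open>Here the p-leg labels the copies, although it sits between the two legs that
      form the inner index.\<close>
    let ?\<iota> = "\<lambda>I. I div P * q + I mod P mod q"
    have dm: "?\<iota> I div q = I div P" "?\<iota> I mod q = I mod P mod q" for I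
      using modP(2) [of I] by auto
    have inj: "inj_on (\<lambda>I. (I mod P div q, ?\<iota> I)) A" for A
    proof (rule inj_onI)
      fix I J assume "(I mod P div q, ?\<iota> I) = (J mod P div q, ?\<iota> J)"
      then have e: "I mod P div q = J mod P div q" "?\<iota> I = ?\<iota> J" by simp_all
      show "I = J"
        by (rule idx_eqI [OF _ e(1)]) (use dm e(2) in metis)+
    qed
    have "cmnorm (j * P) (j * P) G1 \<le> cmnorm (j * q) (j * q) (blk q (amp j g v2))"
    proof (rule cmnorm_ampl_le [OF inj inj])
      fix I assume "I < j * P"
      then show "?\<iota> I < j * q" by (intro \<iota> div_less_of_less_mult modP)
    next
      fix I assume "I < j * P"
      then show "?\<iota> I < j * q" by (intro \<iota> div_less_of_less_mult modP)
    next
      fix I J assume "I < j * P" "J < j * P"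
      then show "G1 I J = (if I mod P div q = J mod P div q
          then blk q (amp j g v2) (?\<iota> I) (?\<iota> J) else 0)"
        unfolding blk_def dm by (simp add: G1_def amp_def div_less_of_less_mult)
    qed
    also have "\<dots> \<le> d * onorm F j v2" by (rule d(2) [OF j v(2)])
    also have "\<dots> \<le> d" using nv(2) d(1) by (simp add: mult_left_le)
    finally show ?thesis .
  qed
  \<comment> \<open>\<open>G1\<close> fixes the p-leg of \<open>K\<close> to that of
    \<open>M\<close>, and \<open>F1\<close> fixes its q-leg to that of \<open>L\<close>; only the
    j-leg remains as a sum. In \<open>GF\<close> the roles of \<open>L\<close> and \<open>M\<close>
    are exchanged, yet f and g are read at the same entries, because they act on different
    legs.\<close>
  have FG: "(\<Sum>K<j*P. F1 L K * G1 K M) = (\<Sum>m<j. f (v1 (L div P) m) (L mod P div q) (M mod P div q)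
      * g (v2 m (M div P)) (L mod P mod q) (M mod P mod q))" for L M
  proof -
    have "(\<Sum>K<j*P. F1 L K * G1 K M) = (\<Sum>K<j*P. if K mod P div q = M mod P div q \<and> K mod P mod q = L mod P mod q
        then f (v1 (L div P) (K div P)) (L mod P div q) (M mod P div q)
          * g (v2 (K div P) (M div P)) (L mod P mod q) (M mod P mod q) else 0)"
      by (intro sum.cong) (auto simp: F1_def G1_def)
    also have "\<dots> = (\<Sum>m<j. f (v1 (L div P) m) (L mod P div q) (M mod P div q)
      * g (v2 m (M div P)) (L mod P mod q) (M mod P mod q))"
      using sum_triple_index [OF modP, where j = j and h = "\<lambda>m. f (v1 (L div P) m) (L mod P div q) (M mod P div q)
      * g (v2 m (M div P)) (L mod P mod q) (M mod P mod q)"] unfolding P_def by simp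
    finally show ?thesis .
  qed
  have GF: "(\<Sum>K<j*P. G1 L K * F1 K M) = (\<Sum>m<j. f (v1 m (M div P)) (L mod P div q) (M mod P div q)
      * g (v2 (L div P) m) (L mod P mod q) (M mod P mod q))" for L M
  proof -
    have "(\<Sum>K<j*P. G1 L K * F1 K M) = (\<Sum>K<j*P. if K mod P div q = L mod P div q \<and> K mod P mod q = M mod P mod q
        then f (v1 (K div P) (M div P)) (L mod P div q) (M mod P div q)
          * g (v2 (L div P) (K div P)) (L mod P mod q) (M mod P mod q) else 0)"
      by (intro sum.cong) (auto simp: F1_def G1_def)
    also have "\<dots> = (\<Sum>m<j. f (v1 m (M div P)) (L mod P div q) (M mod P div q)
      * g (v2 (L div P) m) (L mod P mod q) (M mod P mod q))"
      using sum_triple_index [OF modP, where j = j and h = "\<lambda>m. f (v1 m (M div P)) (L mod P div q) (M mod P div q)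
      * g (v2 (L div P) m) (L mod P mod q) (M mod P mod q)"] unfolding P_def by simp
    finally show ?thesis .
  qed
  have W: "W L M = complex_of_real (1 - \<theta>) * (\<Sum>K<j*P. F1 L K * G1 K M)
      + complex_of_real \<theta> * (\<Sum>K<j*P. G1 L K * F1 K M)" if "L < j * P" "M < j * P" for L M
    using that unfolding FG GF W_def \<Omega>_def
    by (simp add: odot_map_apply f g div_less_of_less_mult)
  have nW: "cmnorm (j * P) (j * P) W \<le> c * d"
  proof -
    have 1: "cmnorm (j * P) (j * P) (\<lambda>L M. \<Sum>K<j*P. F1 L K * G1 K M) \<le> c * d"
      by (rule order_trans [OF cmnorm_compose]) (intro mult_mono nF nG c(1) cmnorm_nonneg)
    have 2: "cmnorm (j * P) (j * P) (\<lambda>L M. \<Sum>K<j*P. G1 L K * F1 K M) \<le> d * c"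
      by (rule order_trans [OF cmnorm_compose]) (intro mult_mono nF nG d(1) cmnorm_nonneg)
    have "cmnorm (j * P) (j * P) W = cmnorm (j * P) (j * P) (\<lambda>L M. complex_of_real (1 - \<theta>) * (\<Sum>K<j*P. F1 L K * G1 K M)
      + complex_of_real \<theta> * (\<Sum>K<j*P. G1 L K * F1 K M))"
      by (rule cmnorm_cong) (rule W)
    also have "\<dots> \<le> cmod (complex_of_real (1 - \<theta>)) * (c * d) + cmod (complex_of_real \<theta>) * (d * c)"
      by (intro order_trans [OF cmnorm_add_le] add_mono order_trans [OF cmnorm_scale_le] mult_left_mono 1 2 norm_ge_zero)
    \<comment> \<open>Convexity: for \<theta> in [0,1] the moduli of the two weights add up to
      1.\<close>
    also have "\<dots> = c * d" unfolding norm_of_real using \<theta> by (simp add: algebra_simps)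
    finally show ?thesis .
  qed
  \<comment> \<open>\<open>A1\<close> and \<open>B1\<close> are a \<otimes> 1 and b \<otimes> 1, so
    the joint leg of size \<open>P\<close> is passed on unchanged and only the sums over j
    remain.\<close>
  have AW: "(\<Sum>L<j*P. A1 I L * W L M) = (\<Sum>s<j. a (I div P) s * \<Omega> s (M div P) (I mod P) (M mod P))" for I M
  proof -
    have "(\<Sum>L<j*P. A1 I L * W L M) = (\<Sum>L<j*P. if L mod P = I mod P
        then a (I div P) (L div P) * \<Omega> (L div P) (M div P) (I mod P) (M mod P) else 0)"
      by (intro sum.cong) (auto simp: A1_def W_def)
    also have "\<dots> = (\<Sum>s<j. \<Sum>c<P. if c = I mod P then a (I div P) s * \<Omega> s (M div P) (I mod P) (M mod P) else 0)"
      by (rule sum_div_mod [where f = "\<lambda>s c. if c = I mod P then a (I div P) s * \<Omega> s (M div P) (I mod P) (M mod P) else 0"])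
    also have "\<dots> = (\<Sum>s<j. a (I div P) s * \<Omega> s (M div P) (I mod P) (M mod P))"
      using P by simp
    finally show ?thesis .
  qed
  have AWB: "(\<Sum>M<j*P. (\<Sum>L<j*P. A1 I L * W L M) * B1 M J)
      = (\<Sum>t<j. \<Sum>s<j. a (I div P) s * b t (J div P) * \<Omega> s t (I mod P) (J mod P))" for I J
  proof -
    have "(\<Sum>M<j*P. (\<Sum>L<j*P. A1 I L * W L M) * B1 M J) = (\<Sum>M<j*P. if M mod P = J mod P
        then (\<Sum>s<j. a (I div P) s * \<Omega> s (M div P) (I mod P) (J mod P)) * b (M div P) (J div P) else 0)"
      unfolding AW by (intro sum.cong) (auto simp: B1_def)
    also have "\<dots> = (\<Sum>t<j. \<Sum>c<P. if c = J mod P then (\<Sum>s<j. a (I div P) s * \<Omega> s t (I mod P) (J mod P)) * b t (J div P) else 0)"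
      by (rule sum_div_mod [where f = "\<lambda>t c. if c = J mod P
        then (\<Sum>s<j. a (I div P) s * \<Omega> s t (I mod P) (J mod P)) * b t (J div P) else 0"])
    also have "\<dots> = (\<Sum>t<j. (\<Sum>s<j. a (I div P) s * \<Omega> s t (I mod P) (J mod P)) * b t (J div P))"
      using P by simp
    also have "\<dots> = (\<Sum>t<j. \<Sum>s<j. a (I div P) s * b t (J div P) * \<Omega> s t (I mod P) (J mod P))"
      by (simp add: sum_distrib_left mult_ac)
    finally show ?thesis .
  qed
  have "blk P (amp n (tfg p q f g) u) I J = (\<Sum>M<j*P. (\<Sum>L<j*P. A1 I L * W L M) * B1 M J)"
    if "I < n * P" "J < n * P" for I J
  proof -
    have "blk P (amp n (tfg p q f g) u) I J = u (I div P) (J div P)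
        (\<lambda>x. f x (I mod P div q) (J mod P div q)) (\<lambda>y. g y (I mod P mod q) (J mod P mod q))"
      using that P by (simp add: blk_def amp_def tfg_def div_less_of_less_mult P_def [symmetric])
    also have "\<dots> = (\<Sum>s<j. \<Sum>t<j. a (I div P) s * b t (J div P) * \<Omega> s t (I mod P) (J mod P))"
      unfolding uv mmul_apply \<Omega>_def using that by (simp add: div_less_of_less_mult)
    also have "\<dots> = (\<Sum>t<j. \<Sum>s<j. a (I div P) s * b t (J div P) * \<Omega> s t (I mod P) (J mod P))"
      by (rule sum.swap)
    finally show ?thesis unfolding AWB .
  qed
  then have "cmnorm (n * P) (n * P) (blk P (amp n (tfg p q f g) u))
      = cmnorm (n * P) (n * P) (\<lambda>I J. \<Sum>M<j*P. (\<Sum>L<j*P. A1 I L * W L M) * B1 M J)"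
    by (rule cmnorm_cong)
  also have "\<dots> \<le> (sqrt r * (c * d)) * sqrt r"
    using r0 c(1) d(1)
    by (intro order_trans [OF cmnorm_compose] mult_mono nA nB nW cmnorm_nonneg) auto
  also have "\<dots> = c * d * r" using r0 mult.assoc [of "c * d" "sqrt r" "sqrt r"] by (simp add: mult.commute)
  finally show "cmnorm (n * (p * q)) (n * (p * q)) (blk (p * q) (amp n (tfg p q f g) u)) \<le> c * d * r"
    unfolding P_def .
qed

end

text \<open>Completely bounded functionals with an unspecified constant, phrased so as to fit the
  hypotheses of \<open>odot_norm_functional_bound\<close> for p = q = 1.\<close>

definition bfun :: "'a::ab_group_add ospace \<Rightarrow> ('a \<Rightarrow> complex) \<Rightarrow> bool" where
  "bfun E \<phi> \<longleftrightarrow> lfun E \<phi> \<and> (\<exists>c\<ge>0. \<forall>n\<ge>1. \<forall>v\<in>matset n n (ocar E).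
      cmnorm n n (\<lambda>i j. \<phi> (v i j)) \<le> c * onorm E n v)"

definition sing :: "'a::zero \<Rightarrow> 'a mat" where
  "sing x = (\<lambda>i j. if i = 0 \<and> j = 0 then x else 0)"

lemma sing_matset: "x \<in> V \<Longrightarrow> sing x \<in> matset 1 1 V"
  by (auto simp: matset_def sing_def)

text \<open>A bounded functional is completely bounded: \<open>\<parallel>\<phi>\<^sub>n(v) x\<parallel>\<^sup>2 = \<phi>(z* v x)\<close> for \<open>z = \<phi>\<^sub>n(v) x\<close>.\<close>
lemma bounded_functional_amplification:
  assumes E: "opspace E" and \<phi>: "lfun E \<phi>" and c: "0 \<le> c"
    and bd: "\<And>x. x \<in> ocar E \<Longrightarrow> cmod (\<phi> x) \<le> c * onorm E 1 (sing x)"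
    and n: "1 \<le> n" and v: "v \<in> matset n n (ocar E)"
  shows "cmnorm n n (\<lambda>i j. \<phi> (v i j)) \<le> c * onorm E n v"
proof (rule cmnorm_le)
  interpret EC: cvec "osc E" "ocar E" by (rule opspace_cvec [OF E])
  have lin: "EC.linfun \<phi>" using \<phi> E by (simp add: lfun_iff_linfun)
  have N: "0 \<le> onorm E n v" by (rule opspace_nonneg [OF E n v])
  then show "0 \<le> c * onorm E n v" using c by simp
  fix x
  define z where "z = cvmul n (\<lambda>i j. \<phi> (v i j)) x"
  define w where "w = mmul (osc E) 1 n (\<lambda>_ i. cnj (z i)) v (\<lambda>j _. x j)"
  have vm: "v i j \<in> ocar E" for i j using matset_mem' [OF v] by simp
  have w0: "w 0 0 = (\<Sum>p<n. \<Sum>q<n. osc E (cnj (z p) * x q) (v p q))"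
    by (simp add: w_def mmul_def)
  then have wm: "w 0 0 \<in> ocar E" by (simp add: EC.sum_mem vm)
  have ws: "w = sing (w 0 0)"
    by (intro ext) (auto simp: w_def mmul_def sing_def)
  have "\<phi> (w 0 0) = (\<Sum>p<n. \<Sum>q<n. cnj (z p) * x q * \<phi> (v p q))"
    using lin unfolding w0 by (simp add: EC.linfun_sum [OF lin] EC.sum_mem vm) (simp add: EC.linfun_def vm)
  also have "\<dots> = (\<Sum>p<n. cnj (z p) * (\<Sum>q<n. \<phi> (v p q) * x q))"
    by (simp add: sum_distrib_left mult_ac)
  also have "\<dots> = (\<Sum>p<n. cnj (z p) * z p)"
    by (simp add: z_def cvmul_def)
  also have "\<dots> = complex_of_real ((vnorm2 n z)\<^sup>2)"
    by (simp add: vnorm2_power2 complex_norm_square mult.commute del: of_real_power)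
  finally have "(vnorm2 n z)\<^sup>2 = cmod (\<phi> (w 0 0))" by (simp add: norm_power)
  also have "\<dots> \<le> c * onorm E 1 w" using bd [OF wm] ws by simp
  also have "\<dots> \<le> c * (cmnorm 1 n (\<lambda>_ i. cnj (z i)) * onorm E n v * cmnorm n 1 (\<lambda>j _. x j))"
    unfolding w_def by (intro mult_left_mono opspace_mmul E n v c) simp
  also have "\<dots> \<le> c * (vnorm2 n z * onorm E n v * vnorm2 n x)"
  proof -
    have "cmnorm 1 n (\<lambda>_ i. cnj (z i)) \<le> vnorm2 n z"
      using cmnorm_row_le [of n "\<lambda>i. cnj (z i)"] by (simp add: vnorm2_def)
    then show ?thesis using N c
      by (intro mult_left_mono mult_mono cmnorm_col_le mult_nonneg_nonneg cmnorm_nonneg) auto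
  qed
  \<comment> \<open>The Euclidean norm of \<open>z\<close> occurs squared on the left and once on
    the right, so one factor cancels.\<close>
  finally have *: "vnorm2 n z * vnorm2 n z \<le> vnorm2 n z * (c * onorm E n v * vnorm2 n x)"
    by (simp add: power2_eq_square mult_ac)
  show "vnorm2 n (cvmul n (\<lambda>i j. \<phi> (v i j)) x) \<le> c * onorm E n v * vnorm2 n x"
  proof (cases "vnorm2 n z = 0")
    case True
    then show ?thesis using N c by (simp add: z_def [symmetric])
  next
    case False
    then have "0 < vnorm2 n z" using vnorm2_nonneg [of n z] by linarith
    then show ?thesis using * by (simp add: z_def [symmetric])
  qed
qed

text \<open>Hahn-Banach is applied to the norm of the first matrix level only;
  \<open>bounded_functional_amplification\<close> carries the constant 2 to all levels.\<close>

lemma bfun_separates: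
  assumes E: "opspace E" and x: "x \<in> ocar E" and all: "\<And>\<phi>. bfun E \<phi> \<Longrightarrow> \<phi> x = 0"
  shows "x = 0"
proof (rule ccontr)
  assume x0: "x \<noteq> 0"
  interpret EC: cvec "osc E" "ocar E" by (rule opspace_cvec [OF E])
  let ?p = "\<lambda>x. onorm E 1 (sing x)"
  have tri: "?p (y + z) \<le> ?p y + ?p z" if "y \<in> ocar E" "z \<in> ocar E" for y z
  proof -
    have "sing (y + z) = sing y + sing z" by (auto simp: sing_def fun_eq_iff)
    then show ?thesis using opspace_add [OF E _ sing_matset [OF that(1)] sing_matset [OF that(2)]] by simp
  qed
  have hom: "?p (osc E c y) = cmod c * ?p y" if "y \<in> ocar E" for c y
  proof -
    have "sing (osc E c y) = (\<lambda>i j. osc E c (sing y i j))" by (auto simp: sing_def fun_eq_iff)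
    then show ?thesis using opspace_scale [OF E _ sing_matset [OF that]] by simp
  qed
  have "sing x \<noteq> 0" using x0 by (auto simp: sing_def fun_eq_iff)
  then have "0 < ?p x"
    using opspace_nonneg [OF E _ sing_matset [OF x]] opspace_eq_0_iff [OF E _ sing_matset [OF x]] by force
  then obtain \<phi> where \<phi>: "EC.linfun \<phi>" "\<And>y. y \<in> ocar E \<Longrightarrow> cmod (\<phi> y) \<le> 2 * ?p y" "\<phi> x \<noteq> 0"
    using EC.bounded_functional_nonzero [of ?p x, OF tri hom x] by blast
  have l: "lfun E \<phi>" using \<phi>(1) E by (simp add: lfun_iff_linfun)
  have "bfun E \<phi>"
    unfolding bfun_def using bounded_functional_amplification [OF E l _ \<phi>(2)] l
    by (intro conjI exI [of _ "2::real"]) auto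
  then show False using all \<phi>(3) by blast
qed

text \<open>Apply separation first in \<open>F\<close> to \<open>\<Sum> \<phi>(x\<^sub>i) y\<^sub>i\<close>, which lets \<open>\<psi>\<close> be arbitrary,
  and then in \<open>E\<close> to \<open>\<Sum> \<psi>(y\<^sub>i) x\<^sub>i\<close>, which lets \<open>\<phi>\<close> be arbitrary.\<close>
lemma tspace_separated:
  assumes E: "opspace E" and F: "opspace F" and t: "t \<in> tspace E F"
    and all: "\<And>\<phi> \<psi>. bfun E \<phi> \<Longrightarrow> bfun F \<psi> \<Longrightarrow> t \<phi> \<psi> = 0"
  shows "t = 0"
proof -
  interpret EC: cvec "osc E" "ocar E" by (rule opspace_cvec [OF E])
  interpret FC: cvec "osc F" "ocar F" by (rule opspace_cvec [OF F])
  obtain m :: nat and x y where tm: "t = (\<Sum>i<m. ten E F (x i) (y i))"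
    and xy: "\<forall>i<m. x i \<in> ocar E \<and> y i \<in> ocar F"
    using t by (rule tspace_E)
  have tap: "t \<phi> \<psi> = (\<Sum>i<m. \<phi> (x i) * \<psi> (y i))" if "lfun E \<phi>" "lfun F \<psi>" for \<phi> \<psi>
    using that by (simp add: tm sum_apply2 ten_apply)
  have Fap: "\<psi> (\<Sum>i<m. osc F (\<phi> (x i)) (y i)) = (\<Sum>i<m. \<phi> (x i) * \<psi> (y i))" if "lfun F \<psi>" for \<phi> \<psi>
  proof -
    have l: "FC.linfun \<psi>" using that F by (simp add: lfun_iff_linfun)
    have "\<psi> (\<Sum>i<m. osc F (\<phi> (x i)) (y i)) = (\<Sum>i<m. \<psi> (osc F (\<phi> (x i)) (y i)))"
      using xy by (intro FC.linfun_sum [OF l]) auto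
    then show ?thesis using xy that by (simp add: lfun_def)
  qed
  have Eap: "\<phi> (\<Sum>i<m. osc E (\<psi> (y i)) (x i)) = (\<Sum>i<m. \<phi> (x i) * \<psi> (y i))" if "lfun E \<phi>" for \<phi> \<psi>
  proof -
    have l: "EC.linfun \<phi>" using that E by (simp add: lfun_iff_linfun)
    have "\<phi> (\<Sum>i<m. osc E (\<psi> (y i)) (x i)) = (\<Sum>i<m. \<phi> (osc E (\<psi> (y i)) (x i)))"
      using xy by (intro EC.linfun_sum [OF l]) auto
    then show ?thesis using xy that by (simp add: lfun_def mult.commute)
  qed
  have 1: "(\<Sum>i<m. osc F (\<phi> (x i)) (y i)) = 0" if \<phi>: "bfun E \<phi>" for \<phi>
  proof (rule bfun_separates [OF F])
    show "(\<Sum>i<m. osc F (\<phi> (x i)) (y i)) \<in> ocar F" using xy by (intro FC.sum_mem) auto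
    fix \<psi> assume \<psi>: "bfun F \<psi>"
    then show "\<psi> (\<Sum>i<m. osc F (\<phi> (x i)) (y i)) = 0"
      using all [OF \<phi> \<psi>] tap [of \<phi> \<psi>] Fap [of \<psi> \<phi>] \<phi> by (simp add: bfun_def)
  qed
  have 2: "(\<Sum>i<m. osc E (\<psi> (y i)) (x i)) = 0" if \<psi>: "lfun F \<psi>" for \<psi>
  proof (rule bfun_separates [OF E])
    show "(\<Sum>i<m. osc E (\<psi> (y i)) (x i)) \<in> ocar E" using xy by (intro EC.sum_mem) auto
    fix \<phi> assume \<phi>: "bfun E \<phi>"
    have "\<psi> 0 = 0" using \<psi> F by (simp add: lfun_iff_linfun FC.linfun_0)
    then show "\<phi> (\<Sum>i<m. osc E (\<psi> (y i)) (x i)) = 0"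
      using 1 [OF \<phi>] Fap [OF \<psi>, of \<phi>] Eap [of \<phi> \<psi>] \<phi> by (simp add: bfun_def)
  qed
  show ?thesis
  proof (intro ext)
    fix \<phi> \<psi>
    show "t \<phi> \<psi> = 0 \<phi> \<psi>"
    proof (cases "lfun E \<phi> \<and> lfun F \<psi>")
      case True
      then have "\<phi> 0 = 0" using E by (simp add: lfun_iff_linfun EC.linfun_0)
      then show ?thesis using 2 [of \<psi>] Eap [of \<phi> \<psi>] tap [of \<phi> \<psi>] True by simp
    next
      case False
      then show ?thesis by (auto simp: tm sum_apply2 ten_apply)
    qed
  qed
qed

section \<open>Definiteness and the operator space structure\<close>

context odot_setup
begin

text \<open>If the norm vanishes, the lower bound for M_1-valued maps annihilates every entry on all
  pairs of bounded functionals, and these separate tensors.\<close>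

lemma odot_norm_definite:
  assumes \<theta>: "0 \<le> \<theta>" "\<theta> \<le> 1" and n: "1 \<le> n" and u: "u \<in> matset n n (tspace E F)"
    and 0: "odot_norm \<theta> E F n u = 0"
  shows "u = 0"
proof (rule matset_eqI [OF u TC.zero_matset])
  fix i l assume il: "i < n" "l < n"
  have "u i l = 0"
  proof (rule tspace_separated [OF E F matset_mem [OF u il]])
    fix \<phi> \<psi> assume bf: "bfun E \<phi>" "bfun F \<psi>"
    then have l: "lfun E \<phi>" "lfun F \<psi>" by (auto simp: bfun_def)
    from bf(1) obtain c where c: "0 \<le> c" "\<And>n v. 1 \<le> n \<Longrightarrow> v \<in> matset n n (ocar E) \<Longrightarrow>
        cmnorm n n (\<lambda>i j. \<phi> (v i j)) \<le> c * onorm E n v" unfolding bfun_def by blast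
    from bf(2) obtain d where d: "0 \<le> d" "\<And>n v. 1 \<le> n \<Longrightarrow> v \<in> matset n n (ocar F) \<Longrightarrow>
        cmnorm n n (\<lambda>i j. \<psi> (v i j)) \<le> d * onorm F n v" unfolding bfun_def by blast
    \<comment> \<open>Functionals viewed as maps into M_1. The value is repeated at all indices,
      which keeps every slice linear; only the index (0, 0) is read.\<close>
    let ?f = "\<lambda>x (i::nat) (j::nat). \<phi> x" and ?g = "\<lambda>y (i::nat) (j::nat). \<psi> y"
    have blk1: "cmnorm (n * 1) (n * 1) (blk 1 (amp n (\<lambda>x (i::nat) (j::nat). \<chi> x) v)) = cmnorm n n (\<lambda>i j. \<chi> (v i j))"
      for n v and \<chi> :: "'x \<Rightarrow> complex"
      by (simp, rule cmnorm_cong) (simp add: blk_def amp_def)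
    have "cmnorm (n * (1 * 1)) (n * (1 * 1)) (blk (1 * 1) (amp n (tfg 1 1 ?f ?g) u)) \<le> c * d * odot_norm \<theta> E F n u"
    proof (rule odot_norm_functional_bound [OF \<theta> _ _ n u l c(1) _ d(1)])
      fix n :: nat and v :: "'e mat" assume "1 \<le> n" "v \<in> matset n n (ocar E)"
      then show "cmnorm (n * 1) (n * 1) (blk 1 (amp n ?f v)) \<le> c * onorm E n v"
        unfolding blk1 by (rule c(2))
    next
      fix n :: nat and v :: "'f mat" assume "1 \<le> n" "v \<in> matset n n (ocar F)"
      then show "cmnorm (n * 1) (n * 1) (blk 1 (amp n ?g v)) \<le> d * onorm F n v"
        unfolding blk1 by (rule d(2))
    qed auto
    then have "cmnorm n n (blk 1 (amp n (tfg 1 1 ?f ?g) u)) \<le> 0" by (simp add: 0)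
    then have "cmod (blk 1 (amp n (tfg 1 1 ?f ?g) u) i l) \<le> 0"
      using cmod_entry_le_cmnorm [OF il] order_trans by blast
    then show "u i l \<phi> \<psi> = 0" using il by (simp add: blk_def amp_def tfg_def)
  qed
  then show "u i l = (0 :: ('e, 'f) tens mat) i l" by simp
qed

theorem opspace_odot_ten:
  assumes "0 \<le> \<theta>" "\<theta> \<le> 1"
  shows "opspace (odot_ten \<theta> E F)"
  by (rule opspace_Ruan)
    (simp_all add: odot_ten_def TC.cvec_axioms odot_norm_nonneg odot_norm_definite [OF assms]
      odot_norm_dsum_le odot_norm_mmul)

end

section \<open>Completely bounded maps\<close>

lemma amp_id: "v \<in> matset n n V \<Longrightarrow> amp n id v = v"
  by (intro ext) (auto simp: amp_def dest: matset_outside)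

text \<open>The zero matrix of size 1 keeps the supremum from being taken over the empty set. Its
  norm is an explicit premise, instead of Ruan's axioms for \<open>E\<close>, so that the rule
  applies to \<open>proj_ten\<close> as a source; \<open>min_ten\<close> can be the target for the
  same reason.\<close>

lemma completely_boundedI:
  assumes lin: "oslinear E F T" and z: "0 \<in> matset 1 1 (ocar E)" "onorm E 1 0 \<le> 1"
    and le: "\<And>n v. 1 \<le> n \<Longrightarrow> v \<in> matset n n (ocar E) \<Longrightarrow> onorm E n v \<le> 1 \<Longrightarrow> onorm F n (amp n T v) \<le> c"
  shows "completely_bounded E F T \<and> cb_norm E F T \<le> c"
proof
  have c: "\<And>x. x \<in> cb_set E F T \<Longrightarrow> x \<le> c" using le unfolding cb_set_def by blast
  show "completely_bounded E F T"
    unfolding completely_bounded_def by (intro conjI lin bdd_aboveI [OF c])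
  have "onorm F 1 (amp 1 T 0) \<in> cb_set E F T" using z unfolding cb_set_def by blast
  then show "cb_norm E F T \<le> c" unfolding cb_norm_def using c by (intro cSup_least) auto
qed

lemma opspace_zero_le_1:
  assumes "opspace E"
  shows "0 \<in> matset 1 1 (ocar E)" "onorm E 1 0 = 0"
proof -
  interpret cvec "osc E" "ocar E" by (rule opspace_cvec [OF assms])
  show "0 \<in> matset 1 1 (ocar E)" by (rule zero_matset)
  then show "onorm E 1 0 = 0" using opspace_eq_0_iff [OF assms] by simp
qed

lemma cb_norm_nonneg:
  assumes E: "opspace E" and cb: "completely_bounded E F T"
    and nn: "\<And>n v. 1 \<le> n \<Longrightarrow> v \<in> matset n n (ocar E) \<Longrightarrow> 0 \<le> onorm F n (amp n T v)"
  shows "0 \<le> cb_norm E F T"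
proof -
  have "onorm F 1 (amp 1 T 0) \<in> cb_set E F T"
    using opspace_zero_le_1 [OF E] unfolding cb_set_def by force
  then have "onorm F 1 (amp 1 T 0) \<le> cb_norm E F T"
    using cb unfolding cb_norm_def completely_bounded_def by (auto intro: cSup_upper)
  moreover have "0 \<le> onorm F 1 (amp 1 T 0)" by (rule nn [OF le_refl opspace_zero_le_1(1) [OF E]])
  ultimately show ?thesis by linarith
qed

text \<open>Of the target only homogeneity is required, which lets the lemma cover
  \<open>Mspace p\<close> as well as operator spaces.\<close>

lemma cb_norm_bound:
  assumes E: "opspace E" and cb: "completely_bounded E F T"
    and hom: "\<And>n c v. 1 \<le> n \<Longrightarrow> v \<in> matset n n (ocar E) \<Longrightarrow>
      onorm F n (\<lambda>i j. osc F c (amp n T v i j)) = cmod c * onorm F n (amp n T v)"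
    and F0: "\<And>c. osc F c 0 = 0"
    and n: "1 \<le> n" and v: "v \<in> matset n n (ocar E)"
  shows "onorm F n (amp n T v) \<le> cb_norm E F T * onorm E n v"
proof -
  interpret EC: cvec "osc E" "ocar E" by (rule opspace_cvec [OF E])
  have T: "T (osc E c x) = osc F c (T x)" if "x \<in> ocar E" for c x
    using cb that by (simp add: completely_bounded_def oslinear_def)
  have amp: "amp n T (\<lambda>i j. osc E c (v i j)) = (\<lambda>i j. osc F c (amp n T v i j))" for c
    using matset_mem' [OF v] by (auto simp: amp_def fun_eq_iff T F0)
  show ?thesis
  proof (cases "onorm E n v = 0")
    case True
    then have "v = 0" using opspace_eq_0_iff [OF E n v] by simp
    \<comment> \<open>The zero matrix is written as 0 times itself, so that homogeneity of the
      target norm yields the value 0.\<close>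
    then have "(\<lambda>i j. osc E 0 (v i j)) = v" by (auto simp: fun_eq_iff)
    then have "onorm F n (amp n T v) = cmod 0 * onorm F n (amp n T v)"
      using amp [of 0] hom [OF n v, of 0] by simp
    then show ?thesis using True by simp
  next
    case False
    define s where "s = onorm E n v"
    have s: "0 < s" using False opspace_nonneg [OF E n v] by (simp add: s_def)
    define w where "w = (\<lambda>i j. osc E (complex_of_real (1 / s)) (v i j))"
    have w: "w \<in> matset n n (ocar E)" unfolding w_def by (rule EC.scale_matset [OF v])
    have "onorm E n w = 1"
      unfolding w_def opspace_scale [OF E n v] using s by (simp add: s_def [symmetric] norm_divide)
    then have "onorm F n (amp n T w) \<in> cb_set E F T"
      unfolding cb_set_def using n w by force
    then have "onorm F n (amp n T w) \<le> cb_norm E F T"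
      using cb unfolding cb_norm_def completely_bounded_def by (auto intro: cSup_upper)
    moreover have "onorm F n (amp n T w) = 1 / s * onorm F n (amp n T v)"
      unfolding w_def amp hom [OF n v] using s by (simp add: norm_divide)
    ultimately show ?thesis using s by (simp add: s_def [symmetric] field_simps)
  qed
qed

lemma cb_norm_bound_opspace:
  assumes E: "opspace E" and F: "opspace F" and cb: "completely_bounded E F T"
    and n: "1 \<le> n" and v: "v \<in> matset n n (ocar E)"
  shows "amp n T v \<in> matset n n (ocar F)" "onorm F n (amp n T v) \<le> cb_norm E F T * onorm E n v"
    "0 \<le> cb_norm E F T"
proof -
  interpret FC: cvec "osc F" "ocar F" by (rule opspace_cvec [OF F])
  have m: "amp n T v \<in> matset n n (ocar F)" if "v \<in> matset n n (ocar E)" for n v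
    using cb that by (auto simp: matset_def amp_def completely_bounded_def oslinear_def)
  then show "amp n T v \<in> matset n n (ocar F)" using v .
  show "onorm F n (amp n T v) \<le> cb_norm E F T * onorm E n v"
    by (rule cb_norm_bound [OF E cb opspace_scale [OF F _ m] FC.sc_0_right n v])
  show "0 \<le> cb_norm E F T"
    by (rule cb_norm_nonneg [OF E cb opspace_nonneg [OF F _ m]])
qed

text \<open>The factor 1 is kept so that the conclusion has the shape of the hypotheses on
  \<open>c\<close> and \<open>d\<close> in \<open>odot_norm_functional_bound\<close>.\<close>

lemma cb_norm_bound_Mspace:
  assumes E: "opspace E" and cb: "completely_bounded E (Mspace p) f" and f1: "cb_norm E (Mspace p) f \<le> 1"
    and n: "1 \<le> n" and v: "v \<in> matset n n (ocar E)"
  shows "cmnorm (n * p) (n * p) (blk p (amp n f v)) \<le> 1 * onorm E n v"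
proof -
  have "onorm (Mspace p) n (amp n f v) \<le> cb_norm E (Mspace p) f * onorm E n v"
  proof (rule cb_norm_bound [OF E cb _ _ n v])
    fix n c and w :: "'a mat"
    have "blk p (\<lambda>i j. osc (Mspace p) c (amp n f w i j)) = (\<lambda>I J. c * blk p (amp n f w) I J)"
      by (simp add: blk_def Mspace_def)
    then show "onorm (Mspace p) n (\<lambda>i j. osc (Mspace p) c (amp n f w i j)) = cmod c * onorm (Mspace p) n (amp n f w)"
      by (simp add: Mspace_def cmnorm_scale)
  qed (simp add: Mspace_def fun_eq_iff)
  also have "\<dots> \<le> 1 * onorm E n v"
    using f1 by (intro mult_right_mono opspace_nonneg [OF E n v])
  finally show ?thesis by (simp add: Mspace_def)
qed

lemma lfun_entry:
  assumes "completely_bounded E (Mspace p) f"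
  shows "lfun E (\<lambda>x. f x \<alpha> \<beta>)"
  using assms by (simp add: completely_bounded_def oslinear_def lfun_def Mspace_def)

text \<open>Supplies an element of the set whose supremum is \<open>min_norm\<close>.\<close>

lemma zero_completely_contractive:
  assumes E: "opspace E"
  shows "completely_bounded E (Mspace p) (\<lambda>x. 0) \<and> cb_norm E (Mspace p) (\<lambda>x. 0) \<le> 1"
proof (rule completely_boundedI [OF _ opspace_zero_le_1(1) [OF E]])
  show "oslinear E (Mspace p) (\<lambda>x. 0)"
    by (auto simp: oslinear_def Mspace_def matset_def fun_eq_iff)
  show "onorm E 1 0 \<le> 1" using opspace_zero_le_1(2) [OF E] by simp
  fix n and v :: "'a mat"
  have "blk p (amp n (\<lambda>x. 0) v) = (\<lambda>I J. 0 :: complex)" by (simp add: blk_def amp_def fun_eq_iff)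
  then show "onorm (Mspace p) n (amp n (\<lambda>x. 0) v) \<le> 1" by (simp add: Mspace_def)
qed

section \<open>Comparison with the minimal norm, and functoriality\<close>

context odot_setup
begin

lemma min_norm_le_odot_norm:
  assumes \<theta>: "0 \<le> \<theta>" "\<theta> \<le> 1" and n: "1 \<le> n" and u: "u \<in> matset n n (tspace E F)"
  shows "min_norm E F n u \<le> odot_norm \<theta> E F n u"
  unfolding min_norm_def
proof (rule cSup_least)
  let ?S = "{onorm (Mspace (p * q)) n (amp n (tfg p q f g) u)
      | p q f g. 1 \<le> p \<and> 1 \<le> q \<and>
          completely_bounded E (Mspace p) f \<and> cb_norm E (Mspace p) f \<le> 1 \<and>
          completely_bounded F (Mspace q) g \<and> cb_norm F (Mspace q) g \<le> 1}"
  have "onorm (Mspace (1 * 1)) n (amp n (tfg 1 1 (\<lambda>x. 0) (\<lambda>x. 0)) u) \<in> ?S"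
    unfolding mem_Collect_eq
    by (intro exI conjI) (rule refl le_refl conjunct1 [OF zero_completely_contractive [OF E]]
      conjunct2 [OF zero_completely_contractive [OF E]] conjunct1 [OF zero_completely_contractive [OF F]]
      conjunct2 [OF zero_completely_contractive [OF F]])+
  then show "?S \<noteq> {}" by blast
  fix s assume "s \<in> ?S"
  then obtain p q f g where *: "s = onorm (Mspace (p * q)) n (amp n (tfg p q f g) u) \<and> 1 \<le> p \<and> 1 \<le> q \<and>
          completely_bounded E (Mspace p) f \<and> cb_norm E (Mspace p) f \<le> 1 \<and>
          completely_bounded F (Mspace q) g \<and> cb_norm F (Mspace q) g \<le> 1"
    unfolding mem_Collect_eq by (elim exE)
  then have "s = cmnorm (n * (p * q)) (n * (p * q)) (blk (p * q) (amp n (tfg p q f g) u))"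
    by (simp add: Mspace_def)
  also have "\<dots> \<le> 1 * 1 * odot_norm \<theta> E F n u"
    using * by (intro odot_norm_functional_bound \<theta> n u lfun_entry cb_norm_bound_Mspace E F) auto
  finally show "s \<le> odot_norm \<theta> E F n u" by simp
qed

text \<open>The premise of \<open>completely_boundedI\<close> on the zero matrix, read off from a
  decomposition with zero coefficients; Ruan's axioms are not established for
  \<open>proj_ten\<close>.\<close>

lemma proj_norm_zero: "proj_norm E F 1 0 \<le> 0"
proof -
  let ?S = "{cmnorm 1 (p * q) a * onorm E p x * onorm F q y * cmnorm (p * q) 1 b
      | p q a x y b. 1 \<le> p \<and> 1 \<le> q \<and> x \<in> matset p p (ocar E) \<and> y \<in> matset q q (ocar F) \<and>
          0 = mmul tsc 1 (p * q) a (kron E F p q x y) b}"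
  have m: "0 = mmul tsc 1 (1 * 1) (\<lambda>i j. 0) (kron E F 1 1 0 0) (\<lambda>i j. 0)"
    by (intro ext) (simp add: mmul_apply)
  have "cmnorm 1 (1 * 1) (\<lambda>i j. 0) * onorm E 1 0 * onorm F 1 0 * cmnorm (1 * 1) 1 (\<lambda>i j. 0) \<in> ?S"
    unfolding mem_Collect_eq
    by (intro exI conjI) (rule refl le_refl EC.zero_matset FC.zero_matset m)+
  moreover have "bdd_below ?S"
    by (rule bdd_belowI [of _ 0]) (auto intro!: mult_nonneg_nonneg opspace_nonneg E F)
  ultimately have "Inf ?S \<le> cmnorm 1 (1 * 1) (\<lambda>i j. 0) * onorm E 1 0 * onorm F 1 0 * cmnorm (1 * 1) 1 (\<lambda>i j. 0)"
    by (rule cInf_lower)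
  then show ?thesis unfolding proj_norm_def by simp
qed

text \<open>S \<otimes> T takes a (v1 \<odot> v2) b to a (S v1 \<odot> T v2) b: decompositions are
  transported with unchanged coefficients, and only the two middle factors pay, each with a
  completely bounded norm.\<close>

lemma odot_norm_tensmap:
  fixes E2 :: "'e2::ab_group_add ospace" and F2 :: "'f2::ab_group_add ospace"
  assumes E2: "opspace E2" and F2: "opspace F2"
    and S: "completely_bounded E E2 S" and T: "completely_bounded F F2 T"
    and n: "1 \<le> n" and u: "u \<in> matset n n (tspace E F)"
  shows "odot_norm \<theta> E2 F2 n (amp n (tensmap E2 F2 S T) u)
    \<le> cb_norm E E2 S * cb_norm F F2 T * odot_norm \<theta> E F n u"
proof (rule le_mult_of_gt)
  note S' = cb_norm_bound_opspace [OF E E2 S] and T' = cb_norm_bound_opspace [OF F F2 T]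
  have nn: "0 \<le> cb_norm E E2 S" "0 \<le> cb_norm F F2 T"
    using S'(3) [OF _ EC.zero_matset, of 1] T'(3) [OF _ FC.zero_matset, of 1] by simp_all
  then show "0 \<le> cb_norm E E2 S * cb_norm F F2 T" by simp
  fix r assume r: "odot_norm \<theta> E F n u < r"
  obtain j a v1 v2 b where j: "1 \<le> j" and v: "v1 \<in> matset j j (ocar E)" "v2 \<in> matset j j (ocar F)"
    and uv: "u = mmul tsc n j a (odot_map \<theta> E F j v1 v2) b"
    and nv: "onorm E j v1 \<le> 1" "onorm F j v2 \<le> 1" and ab: "cmnorm n j a \<le> sqrt r" "cmnorm j n b \<le> sqrt r"
    by (rule balanced_decomposition [OF n u r])
  have r0: "0 \<le> r" using odot_norm_nonneg [OF n u] r by simp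
  interpret O2: odot_setup \<theta> E2 F2 by unfold_locales (rule E2 F2)+
  have comp: "lfun E (\<phi> \<circ> S)" if "lfun E2 \<phi>" for \<phi>
    using that S by (auto simp: lfun_def completely_bounded_def oslinear_def)
  have comp': "lfun F (\<psi> \<circ> T)" if "lfun F2 \<psi>" for \<psi>
    using that T by (auto simp: lfun_def completely_bounded_def oslinear_def)
  have amp_eq: "amp n (tensmap E2 F2 S T) u = mmul tsc n j a (odot_map \<theta> E2 F2 j (amp j S v1) (amp j T v2)) b"
  proof (intro ext)
    fix i l \<phi> \<psi>
    show "amp n (tensmap E2 F2 S T) u i l \<phi> \<psi>
        = mmul tsc n j a (odot_map \<theta> E2 F2 j (amp j S v1) (amp j T v2)) b i l \<phi> \<psi>"
    proof (cases "i < n \<and> l < n \<and> lfun E2 \<phi> \<and> lfun F2 \<psi>")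
      case True
      have eq: "odot_map \<theta> E F j v1 v2 p q (\<phi> \<circ> S) (\<psi> \<circ> T)
          = odot_map \<theta> E2 F2 j (amp j S v1) (amp j T v2) p q \<phi> \<psi>" for p q
        using True comp [of \<phi>] comp' [of \<psi>] by (simp add: odot_map_apply amp_def)
      have "amp n (tensmap E2 F2 S T) u i l \<phi> \<psi> = u i l (\<phi> \<circ> S) (\<psi> \<circ> T)"
        using True by (simp add: amp_def tensmap_def)
      also have "\<dots> = mmul tsc n j a (odot_map \<theta> E2 F2 j (amp j S v1) (amp j T v2)) b i l \<phi> \<psi>"
        unfolding uv mmul_apply eq ..
      finally show ?thesis .
    next
      \<comment> \<open>Outside the index range, and at functionals that are not linear, both sides
        take the default value 0.\<close>
      case False
      then consider "\<not> (i < n \<and> l < n)" | "\<not> (lfun E2 \<phi> \<and> lfun F2 \<psi>)" by blast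
      then show ?thesis
      proof cases
        case 1
        then show ?thesis by (cases "i < n") (simp_all add: amp_def mmul_apply)
      next
        case 2
        then have "odot_map \<theta> E2 F2 j (amp j S v1) (amp j T v2) p q \<phi> \<psi> = 0" for p q
          by (cases "lfun E2 \<phi>") (simp_all add: odot_map_apply)
        moreover have "amp n (tensmap E2 F2 S T) u i l \<phi> \<psi> = 0"
          using 2 by (cases "lfun E2 \<phi>") (simp_all add: amp_def tensmap_def)
        ultimately show ?thesis unfolding mmul_apply by simp
      qed
    qed
  qed
  have "odot_norm \<theta> E2 F2 n (amp n (tensmap E2 F2 S T) u) \<le> sqrt r * cb_norm E E2 S * cb_norm F F2 T * sqrt r"
    unfolding amp_eq
  proof (rule O2.odot_norm_le [OF j S'(1) [OF j v(1)] T'(1) [OF j v(2)] ab(1) _ _ ab(2)])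
    show "onorm E2 j (amp j S v1) \<le> cb_norm E E2 S"
      using S'(2) [OF j v(1)] mult_left_le [OF nv(1) nn(1)] by simp
    show "onorm F2 j (amp j T v2) \<le> cb_norm F F2 T"
      using T'(2) [OF j v(2)] mult_left_le [OF nv(2) nn(2)] by simp
  qed
  also have "\<dots> = cb_norm E E2 S * cb_norm F F2 T * (sqrt r * sqrt r)" by (simp only: mult_ac)
  also have "\<dots> = cb_norm E E2 S * cb_norm F F2 T * r" using r0 by simp
  finally show "odot_norm \<theta> E2 F2 n (amp n (tensmap E2 F2 S T) u) \<le> cb_norm E E2 S * cb_norm F F2 T * r" .
qed

text \<open>In the model, S \<otimes> T is pullback of the two functionals, so it is well defined
  and linear without choosing a representation. A representation is needed only to see that the
  image lies in the span of the elementary tensors.\<close>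

lemma oslinear_tensmap:
  assumes S: "oslinear E E2 S" and T: "oslinear F F2 T"
  shows "oslinear (odot_ten \<theta> E F) (odot_ten \<theta> E2 F2) (tensmap E2 F2 S T)"
proof -
  have "tensmap E2 F2 S T t \<in> tspace E2 F2" if t: "t \<in> tspace E F" for t
  proof -
    obtain m :: nat and x y where tm: "t = (\<Sum>i<m. ten E F (x i) (y i))"
      and xy: "\<forall>i<m. x i \<in> ocar E \<and> y i \<in> ocar F"
      using t by (rule tspace_E)
    have c: "lfun E (\<phi> \<circ> S)" if "lfun E2 \<phi>" for \<phi>
      using that S by (auto simp: lfun_def oslinear_def)
    have c': "lfun F (\<psi> \<circ> T)" if "lfun F2 \<psi>" for \<psi>
      using that T by (auto simp: lfun_def oslinear_def)
    have "tensmap E2 F2 S T t = (\<Sum>i<m. ten E2 F2 (S (x i)) (T (y i)))"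
      by (intro ext) (auto simp: tensmap_def tm sum_apply2 ten_apply c c')
    also have "\<dots> \<in> tspace E2 F2"
      using xy S T by (intro tspace_I) (auto simp: oslinear_def)
    finally show ?thesis .
  qed
  then show ?thesis
    by (auto simp: oslinear_def odot_ten_def tensmap_def fun_eq_iff)
qed

end

theorem theorem2p8:
  fixes \<theta> :: real and E :: "'e::ab_group_add ospace" and F :: "'f::ab_group_add ospace"
  assumes "0 \<le> \<theta>" and "\<theta> \<le> 1" and "opspace E" and "opspace F"
  shows "opspace (odot_ten \<theta> E F)
    \<and> completely_bounded (proj_ten E F) (odot_ten \<theta> E F) id
    \<and> cb_norm (proj_ten E F) (odot_ten \<theta> E F) id \<le> 1
    \<and> completely_bounded (odot_ten \<theta> E F) (min_ten E F) id
    \<and> cb_norm (odot_ten \<theta> E F) (min_ten E F) id \<le> 1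
    \<and> (\<forall>(E2 :: 'e2::ab_group_add ospace) (F2 :: 'f2::ab_group_add ospace) S T.
         opspace E2 \<and> opspace F2 \<and> completely_bounded E E2 S \<and> completely_bounded F F2 T \<longrightarrow>
           completely_bounded (odot_ten \<theta> E F) (odot_ten \<theta> E2 F2) (tensmap E2 F2 S T)
           \<and> cb_norm (odot_ten \<theta> E F) (odot_ten \<theta> E2 F2) (tensmap E2 F2 S T)
               \<le> cb_norm E E2 S * cb_norm F F2 T)"
proof -
  interpret odot_setup \<theta> E F by unfold_locales (rule assms)+
  have os: "opspace (odot_ten \<theta> E F)" by (rule opspace_odot_ten [OF assms(1,2)])
  note os0 = opspace_zero_le_1 [OF os]
  have proj: "completely_bounded (proj_ten E F) (odot_ten \<theta> E F) id \<and> cb_norm (proj_ten E F) (odot_ten \<theta> E F) id \<le> 1"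
  proof (rule completely_boundedI)
    show "oslinear (proj_ten E F) (odot_ten \<theta> E F) id"
      by (simp add: oslinear_def proj_ten_def odot_ten_def)
    show "0 \<in> matset 1 1 (ocar (proj_ten E F))" using TC.zero_matset by (simp add: proj_ten_def)
    show "onorm (proj_ten E F) 1 0 \<le> 1" using proj_norm_zero by (simp add: proj_ten_def)
    fix n v assume "1 \<le> n" "v \<in> matset n n (ocar (proj_ten E F))" "onorm (proj_ten E F) n v \<le> 1"
    then show "onorm (odot_ten \<theta> E F) n (amp n id v) \<le> 1"
      using odot_norm_le_proj_norm [of n v] by (simp add: proj_ten_def odot_ten_def amp_id)
  qed
  have min: "completely_bounded (odot_ten \<theta> E F) (min_ten E F) id \<and> cb_norm (odot_ten \<theta> E F) (min_ten E F) id \<le> 1"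
  proof (rule completely_boundedI [OF _ os0(1)])
    show "oslinear (odot_ten \<theta> E F) (min_ten E F) id"
      by (simp add: oslinear_def min_ten_def odot_ten_def)
    show "onorm (odot_ten \<theta> E F) 1 0 \<le> 1" using os0 by simp
    fix n v assume "1 \<le> n" "v \<in> matset n n (ocar (odot_ten \<theta> E F))" "onorm (odot_ten \<theta> E F) n v \<le> 1"
    then show "onorm (min_ten E F) n (amp n id v) \<le> 1"
      using min_norm_le_odot_norm [OF assms(1,2), of n v] by (simp add: min_ten_def odot_ten_def amp_id)
  qed
  have functorial: "completely_bounded (odot_ten \<theta> E F) (odot_ten \<theta> E2 F2) (tensmap E2 F2 S T)
      \<and> cb_norm (odot_ten \<theta> E F) (odot_ten \<theta> E2 F2) (tensmap E2 F2 S T) \<le> cb_norm E E2 S * cb_norm F F2 T"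
    if E2: "opspace E2" and F2: "opspace F2" and S: "completely_bounded E E2 S" and T: "completely_bounded F F2 T"
    for E2 :: "'e2 ospace" and F2 :: "'f2 ospace" and S T
  proof (rule completely_boundedI [OF _ os0(1)])
    show "oslinear (odot_ten \<theta> E F) (odot_ten \<theta> E2 F2) (tensmap E2 F2 S T)"
      using S T by (intro oslinear_tensmap) (auto simp: completely_bounded_def)
    show "onorm (odot_ten \<theta> E F) 1 0 \<le> 1" using os0 by simp
    fix n v assume n: "1 \<le> n" and v: "v \<in> matset n n (ocar (odot_ten \<theta> E F))"
      and v1: "onorm (odot_ten \<theta> E F) n v \<le> 1"
    have "0 \<le> cb_norm E E2 S * cb_norm F F2 T"
      using cb_norm_bound_opspace(3) [OF E E2 S _ EC.zero_matset, of 1]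
        cb_norm_bound_opspace(3) [OF F F2 T _ FC.zero_matset, of 1] by simp
    then have "cb_norm E E2 S * cb_norm F F2 T * odot_norm \<theta> E F n v \<le> cb_norm E E2 S * cb_norm F F2 T"
      using v1 by (intro mult_left_le) (auto simp: odot_ten_def)
    then show "onorm (odot_ten \<theta> E2 F2) n (amp n (tensmap E2 F2 S T) v) \<le> cb_norm E E2 S * cb_norm F F2 T"
      using odot_norm_tensmap [OF E2 F2 S T n, of v] v by (simp add: odot_ten_def)
  qed
  show ?thesis
    by (intro conjI allI impI os conjunct1 [OF proj] conjunct2 [OF proj] conjunct1 [OF min] conjunct2 [OF min])
      (elim conjE, rule conjunct1 [OF functorial] conjunct2 [OF functorial], assumption+)+
qed

end
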